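(* Let $E=(e_n:n\in\mathbb{N})$ be a Leja sequence for the closed unit disk $D$ with $e_0=1$, and for $d\ge 1$ let $E_d=(e_0,\ldots,e_{d-1})$. Let $\mathcal K[E_d;f]$ denote the (extended) Kergin interpolation polynomial of $f$ at $E_d$. (1) If $f\in C^4(D)$, then $\mathcal K[E_d;f]$ converges uniformly to $f$ on $D$ as $d\to\infty$. (2) If $f\in C^\infty(D)$, then for every two-dimensional multi-index $\beta\in\mathbb{N}^2$, $\mathrm{D}^\beta\big(\mathcal K[E_d;f]\big)$ converges uniformly to $\mathrm{D}^\beta f$ on $D$ as $d\to\infty$.
   Context: $\mathbb{C}$ is identified with $\mathbb{R}^2$ via $x=(x^1,x^2)\leftrightarrow x^1+ix^2$, and $D=\{\|x\|\le 1\}$ is the closed unit disk. $C^k(D)$ is the space of (real-valued) functions that are $k$ times continuously differentiable on a neighbourhood of $D$, and $C^\infty(D)$ is the corresponding space of infinitely differentiable functions. $\mathrm{D}^\beta$ is the usual partial derivative of multi-index $\beta$. $\mathcal P_m(\mathbb{R}^2)$ is the space of real polynomials in two variables of degree at most $m$. A sequence $E=(e_n:n\in\mathbb{N})$ of points of $D$ is a Leja sequence for $D$ if $\big|\prod_{j=0}^{d-1}(e_d-e_j)\big|=\max_{z\in D}\big|\prod_{j=0}^{d-1}(z-e_j)\big|$ for all $d\ge1$. (When $e_0=1$ the points $e_n$ are pairwise distinct points of the unit circle, so no three of them are collinear.) Simplex functional: $\int_{[a_0,\dots,a_m]}g:=\int_{\Delta_m}g\big(a_0+\sum_{j=1}^m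 t_j(a_j-a_0)\big)\,dt$ for $m\ge1$, where $\Delta_m=\{t\in[0,1]^m:\sum t_j\le1\}$ and $dt$ is Lebesgue measure; $\int_{[a_0]}g:=g(a_0)$. Kergin interpolation: for a tuple $A=(a_0,\dots,a_{d-1})$ in an open convex set $\Omega\subset\mathbb{R}^2$ and $g\in C^{d-1}(\Omega)$, $\mathcal K[A;g]$ is the unique $P\in\mathcal P_{d-1}(\mathbb{R}^2)$ such that $\int_{[a_0,\dots,a_j]}\mathrm{D}^\alpha(g-P)=0$ for all $|\alpha|=j$, $j=0,\dots,d-1$. When the $a_j$ are pairwise distinct and no three are collinear, the operator extends continuously to functions $f$ of class $C^1$ on the convex hull of $A$ by the formula $$\mathcal K[A;f]=\sum_{j=0}^{d-1}f(a_j)P_j+\sum_{0\le s<t\le d-1}P_{st}\int_{[a_s,a_t]}\mathrm{D}_{(a_s-a_t)^\bot}f,$$ where $y^\bot=(-y^2,y^1)$ for $y=(y^1,y^2)$, $\mathrm{D}_yf(x)=\sum_{j}\frac{\partial f}{\partial x^j}(x)\,y^j$, $P_j(x)=\Re\prod_{m\ne j}\frac{(x^1+ix^2)-a_m}{a_j-a_m}$, $P_{st}(x)=\frac{h_{st}(\langle(a_s-a_t)^\bot,x\rangle)}{\|a_s-a_t\|^2\,h_{st}'(\langle(a_s-a_t)^\bot,a_s\rangle)}$ and $h_{st}(w)=\prod_{m=0,m\ne s}^{d-1}\big(w-\langle(a_s-a_t)^\bot,a_m\rangle\big)$. This extended operator is the one meant by $\mathcal K[E_d;f]$. *)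

theory Defs
  imports "HOL-Analysis.Analysis"
begin

text \<open>
  The plane is the type \<^typ>\<open>complex\<close>, with its real inner product and with
  \<^term>\<open>Basis\<close> consisting of \<^term>\<open>1\<close> and \<^term>\<open>\<i>\<close>.
  The closed unit disk is \<^term>\<open>cball (0::complex) 1\<close>.
\<close>

definition leja_sequence :: "complex set \<Rightarrow> (nat \<Rightarrow> complex) \<Rightarrow> bool" where
  "leja_sequence K e \<longleftrightarrow>
     (\<forall>n. e n \<in> K) \<and>
     (\<forall>d\<ge>1. \<forall>z\<in>K. cmod (\<Prod>j<d. z - e j) \<le> cmod (\<Prod>j<d. e d - e j))"


definition partial_deriv :: "complex \<Rightarrow> (complex \<Rightarrow> real) \<Rightarrow> complex \<Rightarrow> real" where
  "partial_deriv b f x = deriv (\<lambda>t::real. f (x + t *\<^sub>R b)) 0"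

definition dir_deriv :: "complex \<Rightarrow> (complex \<Rightarrow> real) \<Rightarrow> complex \<Rightarrow> real" where
  "dir_deriv y f x = (\<Sum>b\<in>Basis. partial_deriv b f x * (y \<bullet> b))"

definition multi_deriv :: "nat \<times> nat \<Rightarrow> (complex \<Rightarrow> real) \<Rightarrow> complex \<Rightarrow> real" where
  "multi_deriv \<beta> f = (partial_deriv 1 ^^ fst \<beta>) ((partial_deriv \<i> ^^ snd \<beta>) f)"

text \<open>
  Membership in the class \<open>C\<^sup>k\<close> of an open set. Differentiability (in the Frechet sense) is
  required at each stage because \<^const>\<open>deriv\<close>, and hence
  \<^const>\<open>partial_deriv\<close>, has an unspecified value where the derivative does not exist.
\<close>

primrec Ck_on :: "nat \<Rightarrow> complex set \<Rightarrow> (complex \<Rightarrow> real) \<Rightarrow> bool" where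
  "Ck_on 0 U f \<longleftrightarrow> continuous_on U f"
| "Ck_on (Suc k) U f \<longleftrightarrow>
     (\<forall>x\<in>U. f differentiable (at x)) \<and> (\<forall>b\<in>Basis. Ck_on k U (partial_deriv b f))"

text \<open>
  For an arbitrary (typically compact) set, smoothness is meant on some open neighbourhood. In the
  infinitely differentiable case a single neighbourhood serves all orders.
\<close>

definition Ck_near :: "nat \<Rightarrow> complex set \<Rightarrow> (complex \<Rightarrow> real) \<Rightarrow> bool" where
  "Ck_near k K f \<longleftrightarrow> (\<exists>U. open U \<and> K \<subseteq> U \<and> Ck_on k U f)"

definition Cinf_near :: "complex set \<Rightarrow> (complex \<Rightarrow> real) \<Rightarrow> bool" where
  "Cinf_near K f \<longleftrightarrow> (\<exists>U. open U \<and> K \<subseteq> U \<and> (\<forall>k. Ck_on k U f))"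


definition perp :: "complex \<Rightarrow> complex" where
  "perp y = Complex (- Im y) (Re y)"

text \<open>The simplex functional for two points; here the simplex is the unit interval.\<close>

definition segment_functional :: "complex \<Rightarrow> complex \<Rightarrow> (complex \<Rightarrow> real) \<Rightarrow> real" where
  "segment_functional a b g = integral {0..1} (\<lambda>t::real. g (a + t *\<^sub>R (b - a)))"

text \<open>
  The ingredients of the extended Kergin operator at the \<open>d\<close> points
  \<open>a 0, \<dots>, a (d - 1)\<close>; the remaining values of the sequence \<open>a\<close> play no role.
  The operator is meant for points that are pairwise distinct with no three collinear,
  so that the denominators below do not vanish.
\<close>

definition kergin_P :: "nat \<Rightarrow> (nat \<Rightarrow> complex) \<Rightarrow> nat \<Rightarrow> complex \<Rightarrow> real" where
  "kergin_P d a j x = Re (\<Prod>m\<in>{..<d} - {j}. (x - a m) / (a j - a m))"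

definition kergin_h :: "nat \<Rightarrow> (nat \<Rightarrow> complex) \<Rightarrow> nat \<Rightarrow> nat \<Rightarrow> real \<Rightarrow> real" where
  "kergin_h d a s t w = (\<Prod>m\<in>{..<d} - {s}. w - perp (a s - a t) \<bullet> a m)"

definition kergin_PP :: "nat \<Rightarrow> (nat \<Rightarrow> complex) \<Rightarrow> nat \<Rightarrow> nat \<Rightarrow> complex \<Rightarrow> real" where
  "kergin_PP d a s t x =
     kergin_h d a s t (perp (a s - a t) \<bullet> x) /
     ((norm (a s - a t))\<^sup>2 * deriv (kergin_h d a s t) (perp (a s - a t) \<bullet> a s))"

definition kergin :: "nat \<Rightarrow> (nat \<Rightarrow> complex) \<Rightarrow> (complex \<Rightarrow> real) \<Rightarrow> complex \<Rightarrow> real" where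
  "kergin d a f x =
     (\<Sum>j<d. f (a j) * kergin_P d a j x) +
     (\<Sum>t<d. \<Sum>s<t. kergin_PP d a s t x *
        segment_functional (a s) (a t) (dir_deriv (perp (a s - a t)) f))"

end

theory Submission
  imports Defs "HOL-Complex_Analysis.Complex_Analysis"
begin

text \<open>
  The extended operator reproduces polynomials of degree below \<open>d\<close>: on a ridge function
  \<open>g (\<xi> \<bullet> x)\<close> it acts as Lagrange interpolation at the projected nodes, because its
  coefficients are the partial fraction coefficients, in the direction \<open>\<xi>\<close>, of the projected
  Lagrange polynomials. Its norm from \<open>C\<^sup>1\<close> to \<open>C\<^sup>0\<close> is controlled by the
  complex Lagrange polynomials of the nodes: projecting a point of the circle along the chord
  direction of two nodes bounds each \<open>P\<^sub>s\<^sub>t\<close> by a product of two of them. For a Leja sequence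
  \<open>e\<close> with \<open>e 0 = 1\<close> one has \<open>e (2 n + 1) = - e (2 n)\<close>, and the squares
  \<open>(e (2 n))\<^sup>2\<close> form a Leja sequence again, so a recursion on the binary digits of
  \<open>d\<close> bounds the Lagrange polynomials by \<open>1 + log 2 d\<close>, and the norm of the operator is
  \<open>O(d\<^sup>2 (log d)\<^sup>2)\<close>. A Jackson approximation of \<open>f \<in> C\<^sup>4\<close> has error
  \<open>O(d\<^sup>-\<^sup>3)\<close> in \<open>C\<^sup>1\<close>, which proves the first claim. For derivatives, a crude
  Markov inequality costs a further power of \<open>d\<close>, which the approximation of a smooth function absorbs.
\<close>

section \<open>Functions of class \<open>C\<^sup>k\<close>\<close>

text \<open>Reproduction makes convergence a count of powers of \<open>d\<close>. If
  \<open>Q\<close> has degree below \<open>d\<close> and \<open>h = f - Q\<close>, the interpolant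
  of \<open>f\<close> is that of \<open>h\<close> plus \<open>Q\<close>, and the interpolant of
  \<open>h\<close> is bounded through the values and first partials of \<open>h\<close> on the disk.
  The operator loses \<open>d^2\<close> up to logarithms, so \<open>h\<close> must be of order
  \<open>d^(-3)\<close> in \<open>C^1\<close>: this is \<open>4 = 1 + 3\<close>. A derivative of
  order \<open>l\<close> loses a further \<open>d^(2 l)\<close>, whence the order
  \<open>2 l + 3\<close>. Nodes may be very close, and the polynomial of a pair carries the inverse
  of their distance; it is cancelled by the length of the direction in the segment functional. The
  approximant has to be an algebraic polynomial in two variables, and the same one for
  \<open>f\<close> and its derivatives. So \<open>f\<close> is first replaced by a compactly
  supported function on the plane, which is then convolved with a polynomial kernel in each
  coordinate: compact support makes the result a polynomial near the disk, and convolution commutes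
  with differentiation.\<close>

lemma partial_deriv_eq:
  assumes "(f has_derivative f') (at x)"
  shows "partial_deriv b f x = f' b"
proof -
  have "((\<lambda>t::real. x + t *\<^sub>R b) has_derivative (\<lambda>t. t *\<^sub>R b)) (at 0)"
    by (auto intro!: derivative_eq_intros)
  from has_derivative_compose[OF this, of f f']
  have "((\<lambda>t::real. f (x + t *\<^sub>R b)) has_derivative (\<lambda>t. f' (t *\<^sub>R b))) (at 0)"
    using assms by simp
  moreover have "f' (t *\<^sub>R b) = f' b * t" for t
    using has_derivative_bounded_linear[OF assms] by (simp add: linear_cmul bounded_linear.linear mult.commute)
  ultimately have "((\<lambda>t::real. f (x + t *\<^sub>R b)) has_field_derivative f' b) (at 0)"
    by (simp add: has_field_derivative_def)
  then show ?thesis unfolding partial_deriv_def by (rule DERIV_imp_deriv)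
qed

lemma has_partial_deriv:
  assumes "f differentiable at (x + t *\<^sub>R b)"
  shows "((\<lambda>t. f (x + t *\<^sub>R b)) has_real_derivative partial_deriv b f (x + t *\<^sub>R b)) (at t)"
proof -
  obtain f' where f': "(f has_derivative f') (at (x + t *\<^sub>R b))"
    using assms unfolding differentiable_def by blast
  have "((\<lambda>t::real. x + t *\<^sub>R b) has_derivative (\<lambda>t. t *\<^sub>R b)) (at t)"
    by (auto intro!: derivative_eq_intros)
  from has_derivative_compose[OF this f']
  have "((\<lambda>t::real. f (x + t *\<^sub>R b)) has_derivative (\<lambda>t. f' (t *\<^sub>R b))) (at t)" .
  moreover have "f' (s *\<^sub>R b) = f' b * s" for s
    using has_derivative_bounded_linear[OF f'] by (simp add: linear_cmul bounded_linear.linear mult.commute)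
  ultimately show ?thesis by (simp add: has_field_derivative_def partial_deriv_eq[OF f'])
qed

lemma partial_deriv_cong:
  assumes "open U" "x \<in> U" "\<And>y. y \<in> U \<Longrightarrow> f y = g y"
  shows "partial_deriv b f x = partial_deriv b g x"
proof -
  have "((\<lambda>t::real. x + t *\<^sub>R b) \<longlongrightarrow> x + 0 *\<^sub>R b) (nhds 0)"
    by (intro tendsto_intros filterlim_ident)
  then have "eventually (\<lambda>t::real. x + t *\<^sub>R b \<in> U) (nhds 0)"
    using assms(1,2) by (simp add: tendsto_def)
  then show ?thesis unfolding partial_deriv_def
    by (intro deriv_cong_ev) (auto elim!: eventually_mono simp: assms(3))
qed

lemma dir_deriv_eq:
  assumes "(f has_derivative f') (at x)"
  shows "dir_deriv y f x = f' y"
proof -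
  interpret bounded_linear f' using has_derivative_bounded_linear[OF assms] .
  have "f' y = f' (\<Sum>b\<in>Basis. (y \<bullet> b) *\<^sub>R b)" by (simp add: euclidean_representation)
  also have "\<dots> = (\<Sum>b\<in>Basis. f' b * (y \<bullet> b))" by (simp add: sum scaleR mult.commute)
  finally show ?thesis by (simp add: dir_deriv_def partial_deriv_eq[OF assms])
qed

lemma partial_deriv_add:
  assumes "f differentiable at x" "g differentiable at x"
  shows "partial_deriv b (\<lambda>x. f x + g x) x = partial_deriv b f x + partial_deriv b g x"
proof -
  obtain f' g' where *: "(f has_derivative f') (at x)" "(g has_derivative g') (at x)"
    using assms unfolding differentiable_def by blast
  show ?thesis
    using partial_deriv_eq[OF has_derivative_add[OF *]] partial_deriv_eq[OF *(1)] partial_deriv_eq[OF *(2)] by simp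
qed

lemma partial_deriv_mult:
  assumes "f differentiable at x" "g differentiable at x"
  shows "partial_deriv b (\<lambda>x. f x * g x) x = f x * partial_deriv b g x + partial_deriv b f x * g x"
proof -
  obtain f' g' where *: "(f has_derivative f') (at x)" "(g has_derivative g') (at x)"
    using assms unfolding differentiable_def by blast
  show ?thesis
    using partial_deriv_eq[OF has_derivative_mult[OF *]] partial_deriv_eq[OF *(1)] partial_deriv_eq[OF *(2)] by simp
qed

lemma partial_deriv_const [simp]: "partial_deriv b (\<lambda>x. c) x = 0"
  by (simp add: partial_deriv_def)

lemma partial_deriv_inverse:
  assumes "g differentiable at x" "g x \<noteq> 0"
  shows "partial_deriv b (\<lambda>x. inverse (g x)) x = - (inverse (g x) * inverse (g x) * partial_deriv b g x)"
proof -
  obtain g' where *: "(g has_derivative g') (at x)"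
    using assms unfolding differentiable_def by blast
  show ?thesis
    using partial_deriv_eq[OF Deriv.has_derivative_inverse[OF assms(2) *]] partial_deriv_eq[OF *]
    by (simp add: mult.assoc mult.commute mult.left_commute)
qed

lemma Ck_on_cong:
  assumes "open U" "\<And>x. x \<in> U \<Longrightarrow> f x = g x"
  shows "Ck_on k U f \<longleftrightarrow> Ck_on k U g"
  using assms(2)
proof (induction k arbitrary: f g)
  case 0
  then show ?case by (auto cong: continuous_on_cong)
next
  case (Suc k)
  have "f differentiable at x \<longleftrightarrow> g differentiable at x" if "x \<in> U" for x
    unfolding differentiable_def
    using has_derivative_transform_within_open[OF _ assms(1) that] Suc.prems by (metis (no_types, lifting))
  moreover have "Ck_on k U (partial_deriv b f) \<longleftrightarrow> Ck_on k U (partial_deriv b g)" for b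
    using partial_deriv_cong[OF assms(1)] Suc.prems by (intro Suc.IH) blast
  ultimately show ?case by auto
qed

lemma Ck_on_subset: "Ck_on k U f \<Longrightarrow> V \<subseteq> U \<Longrightarrow> Ck_on k V f"
  by (induction k arbitrary: f) (auto intro: continuous_on_subset)

lemma Ck_on_pred: "Ck_on (Suc k) U f \<Longrightarrow> Ck_on k U f"
proof (induction k arbitrary: f)
  case 0
  then show ?case
    by (auto intro!: continuous_at_imp_continuous_on differentiable_imp_continuous_within)
qed auto

lemma Ck_on_le: "Ck_on k U f \<Longrightarrow> l \<le> k \<Longrightarrow> Ck_on l U f"
proof (induction k)
  case (Suc k)
  then show ?case using Ck_on_pred le_Suc_eq by metis
qed simp

lemma Ck_on_continuous: "Ck_on k U f \<Longrightarrow> continuous_on U f"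
  using Ck_on_le[of k U f 0] by simp

lemma Ck_on_Un:
  assumes "open U" "open V"
  shows "Ck_on k U f \<Longrightarrow> Ck_on k V f \<Longrightarrow> Ck_on k (U \<union> V) f"
  by (induction k arbitrary: f) (use assms in \<open>auto intro: continuous_on_open_Un\<close>)

lemma Ck_on_const [simp]: "Ck_on k U (\<lambda>x. c)"
  by (induction k arbitrary: c) (auto simp: partial_deriv_const[abs_def])

lemma Ck_on_add:
  assumes "open U"
  shows "Ck_on k U f \<Longrightarrow> Ck_on k U g \<Longrightarrow> Ck_on k U (\<lambda>x. f x + g x)"
proof (induction k arbitrary: f g)
  case (Suc k)
  then have "Ck_on k U (\<lambda>x. partial_deriv b f x + partial_deriv b g x)" if "b \<in> Basis" for b
    using that by auto
  moreover have "Ck_on k U (\<lambda>x. partial_deriv b f x + partial_deriv b g x)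
     \<longleftrightarrow> Ck_on k U (partial_deriv b (\<lambda>x. f x + g x))" for b
    by (rule Ck_on_cong[OF assms]) (use Suc.prems in \<open>auto simp: partial_deriv_add\<close>)
  ultimately show ?case using Suc.prems by (auto intro!: differentiable_add)
qed (auto intro: continuous_on_add)

lemma Ck_on_mult:
  assumes "open U"
  shows "Ck_on k U f \<Longrightarrow> Ck_on k U g \<Longrightarrow> Ck_on k U (\<lambda>x. f x * g x)"
proof (induction k arbitrary: f g)
  case (Suc k)
  note k = Ck_on_pred[OF Suc.prems(1)] Ck_on_pred[OF Suc.prems(2)]
  have "Ck_on k U (\<lambda>x. f x * partial_deriv b g x + partial_deriv b f x * g x)" if "b \<in> Basis" for b
    using Suc.prems that k by (intro Ck_on_add[OF assms] Suc.IH) auto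
  moreover have "Ck_on k U (\<lambda>x. f x * partial_deriv b g x + partial_deriv b f x * g x)
     \<longleftrightarrow> Ck_on k U (partial_deriv b (\<lambda>x. f x * g x))" for b
    by (rule Ck_on_cong[OF assms]) (use Suc.prems in \<open>auto simp: partial_deriv_mult\<close>)
  ultimately show ?case using Suc.prems by (auto intro!: differentiable_mult)
qed (auto intro: continuous_on_mult)

lemma Ck_on_cmult: "open U \<Longrightarrow> Ck_on k U f \<Longrightarrow> Ck_on k U (\<lambda>x. c * f x)"
  by (intro Ck_on_mult) auto

lemma Ck_on_minus: "open U \<Longrightarrow> Ck_on k U f \<Longrightarrow> Ck_on k U (\<lambda>x. - f x)"
  using Ck_on_cmult[of U k f "-1"] by simp

lemma Ck_on_diff: "open U \<Longrightarrow> Ck_on k U f \<Longrightarrow> Ck_on k U g \<Longrightarrow> Ck_on k U (\<lambda>x. f x - g x)"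
  using Ck_on_add[of U k f "\<lambda>x. - g x"] Ck_on_minus[of U k g] by simp

lemma Ck_on_power: "open U \<Longrightarrow> Ck_on k U f \<Longrightarrow> Ck_on k U (\<lambda>x. f x ^ n)"
  by (induction n) (auto intro: Ck_on_mult)

lemma Ck_on_sum:
  assumes "open U" "\<And>i. i \<in> I \<Longrightarrow> Ck_on k U (f i)"
  shows "Ck_on k U (\<lambda>x. \<Sum>i\<in>I. f i x)"
  using assms(2) by (induction I rule: infinite_finite_induct) (auto intro: Ck_on_add[OF assms(1)])

lemma Ck_on_inverse:
  assumes "open U" "\<And>x. x \<in> U \<Longrightarrow> g x \<noteq> 0"
  shows "Ck_on k U g \<Longrightarrow> Ck_on k U (\<lambda>x. inverse (g x))"
proof (induction k)
  case (Suc k)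
  note k = Suc.IH[OF Ck_on_pred[OF Suc.prems]]
  have "Ck_on k U (\<lambda>x. - (inverse (g x) * inverse (g x) * partial_deriv b g x))" if "b \<in> Basis" for b
    using Suc.prems that k by (intro Ck_on_minus Ck_on_mult assms(1)) auto
  moreover have "Ck_on k U (\<lambda>x. - (inverse (g x) * inverse (g x) * partial_deriv b g x))
     \<longleftrightarrow> Ck_on k U (partial_deriv b (\<lambda>x. inverse (g x)))" for b
    by (rule Ck_on_cong[OF assms(1)]) (use Suc.prems assms(2) in \<open>auto simp: partial_deriv_inverse\<close>)
  ultimately show ?case using Suc.prems assms(2) by (auto intro!: differentiable_inverse)
qed (use assms(2) in \<open>auto intro: continuous_on_inverse\<close>)

lemma Ck_on_bounded_linear:
  assumes "bounded_linear f"
  shows "Ck_on k U f"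
proof -
  have f: "(f has_derivative f) (at x)" for x
    using bounded_linear_imp_has_derivative[OF assms] .
  have "partial_deriv b f = (\<lambda>x. f b)" for b using partial_deriv_eq[OF f] by auto
  then show ?thesis using f linear_continuous_on[OF assms]
    by (cases k) (auto simp: differentiable_def)
qed

lemma Ck_on_Re [simp]: "Ck_on k U Re"
  by (rule Ck_on_bounded_linear) (rule bounded_linear_Re)

lemma Ck_on_Im [simp]: "Ck_on k U Im"
  by (rule Ck_on_bounded_linear) (rule bounded_linear_Im)

section \<open>Linearity of the segment functional and of the Kergin operator\<close>

lemma segment_point_in_disc:
  assumes "cmod a \<le> 1" "cmod b \<le> 1" "t \<in> {0..1}"
  shows "cmod (a + t *\<^sub>R (b - a)) \<le> 1"
proof -
  have "a + t *\<^sub>R (b - a) = (1 - t) *\<^sub>R a + t *\<^sub>R b" by (simp add: algebra_simps)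
  then show ?thesis using convexD_alt[OF convex_cball[of 0 1], of a b t] assms by auto
qed

lemma dir_deriv_segment_continuous:
  assumes "cball 0 1 \<subseteq> U" "Ck_on 1 U f" "cmod a \<le> 1" "cmod b \<le> 1"
  shows "continuous_on {0..1} (\<lambda>t::real. dir_deriv y f (a + t *\<^sub>R (b - a)))"
proof -
  have "continuous_on {0..1} (\<lambda>t::real. partial_deriv c f (a + t *\<^sub>R (b - a)))" if "c \<in> Basis" for c
    by (rule continuous_on_compose2[of U "partial_deriv c f"])
      (use that assms segment_point_in_disc[OF assms(3,4)] in \<open>auto intro!: continuous_intros\<close>)
  then show ?thesis unfolding dir_deriv_def by (intro continuous_intros) auto
qed

text \<open>Linearity needs the functions to be smooth on a common open set, since
  \<^const>\<open>partial_deriv\<close> is arbitrary at points of non-differentiability.\<close>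

lemma segment_functional_lincomb:
  assumes "open U" "cball 0 1 \<subseteq> U" "Ck_on 1 U f" "Ck_on 1 U g" "cmod a \<le> 1" "cmod b \<le> 1"
  shows "segment_functional a b (dir_deriv y (\<lambda>x. \<alpha> * f x + \<beta> * g x)) =
    \<alpha> * segment_functional a b (dir_deriv y f) + \<beta> * segment_functional a b (dir_deriv y g)"
proof -
  let ?\<gamma> = "\<lambda>t::real. a + t *\<^sub>R (b - a)"
  have in_ball: "?\<gamma> t \<in> cball 0 1" if "t \<in> {0..1}" for t
    using segment_point_in_disc[OF assms(5,6) that] by simp
  note cont = dir_deriv_segment_continuous[OF assms(2) _ assms(5,6)]
  have pd: "partial_deriv c (\<lambda>x. \<alpha> * f x + \<beta> * g x) z = \<alpha> * partial_deriv c f z + \<beta> * partial_deriv c g z"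
    if "z \<in> cball 0 1" for c z
  proof -
    have d: "f differentiable at z" "g differentiable at z" using assms that by auto
    show ?thesis using partial_deriv_add[of "\<lambda>x. \<alpha> * f x" z "\<lambda>x. \<beta> * g x"]
      partial_deriv_mult[OF differentiable_const d(1)] partial_deriv_mult[OF differentiable_const d(2)] d
      by (simp add: differentiable_mult)
  qed
  have "segment_functional a b (dir_deriv y (\<lambda>x. \<alpha> * f x + \<beta> * g x)) =
    integral {0..1} (\<lambda>t. \<alpha> * dir_deriv y f (?\<gamma> t) + \<beta> * dir_deriv y g (?\<gamma> t))"
    unfolding segment_functional_def
  proof (rule Henstock_Kurzweil_Integration.integral_cong)
    fix t :: real assume "t \<in> {0..1}"
    from pd[OF in_ball[OF this]] show "dir_deriv y (\<lambda>x. \<alpha> * f x + \<beta> * g x) (?\<gamma> t) =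
      \<alpha> * dir_deriv y f (?\<gamma> t) + \<beta> * dir_deriv y g (?\<gamma> t)"
      unfolding dir_deriv_def by (simp add: sum.distrib sum_distrib_left algebra_simps)
  qed
  also have "\<dots> = \<alpha> * segment_functional a b (dir_deriv y f) + \<beta> * segment_functional a b (dir_deriv y g)"
    unfolding segment_functional_def
    using cont[OF assms(3)] cont[OF assms(4)]
    by (subst Henstock_Kurzweil_Integration.integral_add) (auto intro!: integrable_continuous_real continuous_intros)
  finally show ?thesis .
qed

lemma kergin_lincomb:
  assumes "open U" "cball 0 1 \<subseteq> U" "Ck_on 1 U f" "Ck_on 1 U g" "\<And>j. cmod (a j) \<le> 1"
  shows "kergin d a (\<lambda>x. \<alpha> * f x + \<beta> * g x) x = \<alpha> * kergin d a f x + \<beta> * kergin d a g x"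
  unfolding kergin_def segment_functional_lincomb[OF assms(1-4) assms(5) assms(5)]
  by (simp add: sum.distrib sum_distrib_left algebra_simps)

lemma kergin_sum:
  assumes "open U" "cball 0 1 \<subseteq> U" "\<And>i. i \<in> I \<Longrightarrow> Ck_on 1 U (f i)" "\<And>j. cmod (a j) \<le> 1"
  shows "kergin d a (\<lambda>x. \<Sum>i\<in>I. c i * f i x) x = (\<Sum>i\<in>I. c i * kergin d a (f i) x)"
  using assms(3)
proof (induction I rule: infinite_finite_induct)
  case (insert i I)
  have "Ck_on 1 U (\<lambda>x. \<Sum>i\<in>I. c i * f i x)"
    by (rule Ck_on_sum[OF assms(1)], rule Ck_on_cmult[OF assms(1)], rule insert.prems) simp
  from kergin_lincomb[OF assms(1,2) insert.prems[of i] this, where d=d and \<alpha>="c i" and \<beta>=1 and a=a and x=x]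
  show ?case using insert assms(4) by (simp del: Ck_on.simps)
qed (simp_all add: kergin_def dir_deriv_def[abs_def] segment_functional_def)

section \<open>Leja sequences for the disk\<close>

definition node_prod :: "nat \<Rightarrow> (nat \<Rightarrow> complex) \<Rightarrow> complex \<Rightarrow> complex" where
  "node_prod d a z = (\<Prod>j<d. z - a j)"

definition lagrange :: "nat \<Rightarrow> (nat \<Rightarrow> complex) \<Rightarrow> nat \<Rightarrow> complex \<Rightarrow> complex" where
  "lagrange d a j z = (\<Prod>m\<in>{..<d} - {j}. (z - a m) / (a j - a m))"

lemma node_prod_Suc: "node_prod (Suc d) a z = node_prod d a z * (z - a d)"
  by (simp add: node_prod_def)

lemma prod_lessThan_double:
  fixes g :: "nat \<Rightarrow> 'a::comm_monoid_mult"
  shows "(\<Prod>m<2*N. g m) = (\<Prod>m<N. g (2*m) * g (Suc (2*m)))"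
  by (induction N) (simp_all add: mult.assoc)

lemma prod_remove_if:
  assumes "finite A"
  shows "(\<Prod>m\<in>A - {j}. g m) = (\<Prod>m\<in>A. if m = j then 1 else g m)"
  using assms by (simp add: prod.If_cases Int_def Diff_eq Compl_eq)

text \<open>The disk is infinite, so the product is nonzero at some point of it, and
  \<open>e d\<close> maximises its modulus.\<close>

lemma leja_distinct:
  assumes "leja_sequence (cball 0 1) e"
  shows "node_prod d e (e d) \<noteq> 0"
proof (cases "d = 0")
  case False
  have "infinite (cball (0::complex) 1)"
    using uncountable_cball[of 1 "0::complex"] uncountable_infinite by simp
  then have "\<exists>z. z \<in> cball 0 1 - e ` {..<d}"
    by (metis Diff_eq_empty_iff finite_imageI finite_lessThan finite_subset ex_in_conv)
  then obtain z where z: "z \<in> cball 0 1" "z \<notin> e ` {..<d}" by blast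
  have "0 < cmod (\<Prod>j<d. z - e j)" using z(2) by (auto simp: prod_zero_iff)
  also have "\<dots> \<le> cmod (\<Prod>j<d. e d - e j)"
    using assms False z(1) unfolding leja_sequence_def by auto
  finally show ?thesis by (simp add: node_prod_def)
qed (simp add: node_prod_def)

lemma leja_node_prod_le:
  assumes "leja_sequence (cball 0 1) e" "cmod z \<le> 1"
  shows "cmod (node_prod d e z) \<le> cmod (node_prod d e (e d))"
proof (cases "d = 0")
  case False
  then show ?thesis using assms unfolding leja_sequence_def node_prod_def by auto
qed (simp add: node_prod_def)

lemma leja_inj:
  assumes "leja_sequence (cball 0 1) e"
  shows "inj e"
proof -
  have *: "e i \<noteq> e d" if "i < d" for i d
  proof
    assume "e i = e d"
    then have "node_prod d e (e d) = 0" unfolding node_prod_def using that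
      by (intro prod_zero bexI[of _ i]) auto
    then show False using leja_distinct[OF assms] by blast
  qed
  show ?thesis by (rule injI) (metis * linorder_neqE_nat)
qed

text \<open>Maximum modulus principle: an interior maximum would make the node polynomial constant
  on the closed disk, although it vanishes at the boundary point \<open>e 0 = 1\<close>.\<close>

lemma leja_norm:
  assumes "leja_sequence (cball 0 1) e" "e 0 = 1"
  shows "cmod (e d) = 1"
proof (rule ccontr)
  assume ne: "cmod (e d) \<noteq> 1"
  have le: "cmod (e d) \<le> 1" using assms(1) unfolding leja_sequence_def by auto
  have "d \<noteq> 0" using ne assms(2) by (metis norm_one)
  have hol: "node_prod d e holomorphic_on A" for A unfolding node_prod_def by (intro holomorphic_intros)
  have "node_prod d e constant_on ball 0 1"
  proof (rule maximum_modulus_principle[where U="ball 0 1" and \<xi>="e d"])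
    show "\<And>z. z \<in> ball 0 1 \<Longrightarrow> cmod (node_prod d e z) \<le> cmod (node_prod d e (e d))"
      using leja_node_prod_le[OF assms(1)] by auto
  qed (use le ne hol in auto)
  then obtain c where c: "\<And>z. z \<in> ball 0 1 \<Longrightarrow> node_prod d e z = c"
    unfolding constant_on_def by blast
  have "node_prod d e z = c" if "z \<in> closure (ball 0 1)" for z
    using continuous_constant_on_closure[of "ball 0 1" "node_prod d e" c z] c that
      holomorphic_on_imp_continuous_on[OF hol] by blast
  \<comment> \<open>The constant is read off at the node \<open>e 0 = 1\<close>, which lies in the
    closure of the open disk.\<close>
  from this[of 1] have "c = node_prod d e 1" by simp
  also have "\<dots> = 0" using \<open>d \<noteq> 0\<close> assms(2) unfolding node_prod_def by (intro prod_zero) auto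
  finally have "node_prod d e (e d) = 0" using c[of "e d"] le ne by auto
  then show False using leja_distinct[OF assms(1)] by blast
qed

lemma node_prod_double:
  assumes "\<And>j. j < N \<Longrightarrow> e (Suc (2*j)) = - e (2*j)"
  shows "node_prod (2*N) e z = node_prod N (\<lambda>j. (e (2*j))\<^sup>2) (z\<^sup>2)"
  unfolding node_prod_def prod_lessThan_double
  by (rule prod.cong) (use assms in \<open>auto simp: power2_eq_square algebra_simps\<close>)

text \<open>By induction the first \<open>2 N\<close> nodes form antipodal pairs, so their node
  polynomial is even. At \<open>- e (2*N)\<close> both this polynomial and the distance to
  \<open>e (2*N)\<close> are as large as possible, and a maximiser of the product must then reach
  distance 2.\<close>

lemma leja_odd:
  assumes L: "leja_sequence (cball 0 1) e" and e0: "e 0 = 1"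
  shows "e (Suc (2*N)) = - e (2*N)"
proof (induction N rule: less_induct)
  case (less N)
  let ?P = "node_prod (2*N) e"
  have n: "cmod (e m) = 1" for m using leja_norm[OF L e0] .
  have sym: "?P (-z) = ?P z" for z using node_prod_double[of N e] less by simp
  let ?z = "e (Suc (2*N))" and ?a = "e (2*N)"
  have "cmod (?P ?a) * 2 = cmod (node_prod (Suc (2*N)) e (- ?a))"
  proof -
    have "- ?a - ?a = - (2 * ?a)" by simp
    then have "cmod (- ?a - ?a) = 2" using n[of "2*N"] by (simp only: norm_minus_cancel norm_mult) simp
    then show ?thesis by (simp add: node_prod_Suc norm_mult sym)
  qed
  also have "\<dots> \<le> cmod (node_prod (Suc (2*N)) e ?z)" using leja_node_prod_le[OF L] n by simp
  also have "\<dots> = cmod (?P ?z) * cmod (?z - ?a)" by (simp add: node_prod_Suc norm_mult)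
  also have "\<dots> \<le> cmod (?P ?a) * cmod (?z - ?a)"
    using leja_node_prod_le[OF L] n by (intro mult_right_mono) auto
  finally have "2 \<le> cmod (?z - ?a)" using leja_distinct[OF L, of "2*N"] by simp
  \<comment> \<open>Distance 2 between unit vectors is the equality case of the triangle
    inequality.\<close>
  then have "norm (?z + (- ?a)) = norm ?z + norm (- ?a)"
    using norm_triangle_ineq4[of ?z ?a] n by simp
  then have "norm ?z *\<^sub>R (- ?a) = norm (- ?a) *\<^sub>R ?z" by (simp only: norm_triangle_eq)
  then show ?case using n by simp
qed

text \<open>The node polynomial of \<open>2 d\<close> antipodally paired points is a polynomial in
  \<open>z^2\<close>, and every point of the disk is the square of a point of the disk, so
  maximality passes to the squares.\<close>

lemma leja_squares:
  assumes L: "leja_sequence (cball 0 1) e" and e0: "e 0 = 1"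
  shows "leja_sequence (cball 0 1) (\<lambda>j. (e (2*j))\<^sup>2)"
  unfolding leja_sequence_def
proof (intro conjI allI impI ballI)
  fix n show "(e (2*n))\<^sup>2 \<in> cball 0 1" using leja_norm[OF L e0] by (simp add: norm_power)
next
  fix d :: nat and w :: complex assume "w \<in> cball 0 1"
  then have w: "cmod (csqrt w) \<le> 1" by simp
  have eq: "node_prod (2*d) e z = node_prod d (\<lambda>j. (e (2*j))\<^sup>2) (z\<^sup>2)" for z
    by (rule node_prod_double) (rule leja_odd[OF L e0])
  show "cmod (\<Prod>j<d. w - (e (2*j))\<^sup>2) \<le> cmod (\<Prod>j<d. (e (2*d))\<^sup>2 - (e (2*j))\<^sup>2)"
    using leja_node_prod_le[OF L w, of "2*d"] unfolding eq by (simp add: node_prod_def)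
qed

section \<open>Recursive bounds for the Lagrange polynomials\<close>

lemma lagrange_if: "lagrange d a j z = (\<Prod>m<d. if m = j then 1 else (z - a m) / (a j - a m))"
  unfolding lagrange_def by (subst prod_remove_if) auto

lemma lagrange_Suc:
  assumes "j < d"
  shows "lagrange (Suc d) a j z = lagrange d a j z * ((z - a d) / (a j - a d))"
  using assms by (simp add: lagrange_if)

lemma lagrange_Suc_last: "lagrange (Suc d) a d z = node_prod d a z / node_prod d a (a d)"
proof -
  have "{..<Suc d} - {d} = {..<d}" by auto
  then show ?thesis by (simp add: lagrange_def node_prod_def prod_dividef)
qed

lemma node_prod_lagrange:
  assumes "j < d" "inj a"
  shows "node_prod d a z = (z - a j) * lagrange d a j z * (\<Prod>m\<in>{..<d} - {j}. a j - a m)"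
proof -
  have "(\<Prod>m\<in>{..<d} - {j}. a j - a m) \<noteq> 0"
    using assms by (auto simp: prod_zero_iff inj_def)
  moreover have "node_prod d a z = (z - a j) * (\<Prod>m\<in>{..<d} - {j}. z - a m)"
    unfolding node_prod_def using assms(1) by (simp add: prod.remove)
  ultimately show ?thesis by (simp add: lagrange_def prod_dividef)
qed

text \<open>Both polynomials take the same values at the first \<open>d\<close> nodes, so they
  differ by a multiple of the node polynomial. Unlike the product form, whose denominator
  \<open>a j - a d\<close> may be small, this form can be estimated: for a Leja sequence the
  quotient of node polynomials has modulus at most 1.\<close>

lemma lagrange_Suc_diff:
  assumes "j < d" "inj a"
  shows "lagrange (Suc d) a j z =
    lagrange d a j z - lagrange d a j (a d) * (node_prod d a z / node_prod d a (a d))"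
proof -
  let ?c = "\<Prod>m\<in>{..<d} - {j}. a j - a m"
  have ne: "a d \<noteq> a j" "?c \<noteq> 0" using assms by (auto simp: inj_def prod_zero_iff)
  have l: "lagrange d a j (a d) \<noteq> 0"
    using assms by (auto simp: lagrange_def prod_zero_iff inj_def)
  have "lagrange d a j (a d) * (node_prod d a z / node_prod d a (a d))
    = lagrange d a j z * ((z - a j) / (a d - a j))"
    using ne l by (simp add: node_prod_lagrange[OF assms])
  moreover have "lagrange (Suc d) a j z = lagrange d a j z * (1 - (z - a j) / (a d - a j))"
    using ne(1) by (simp add: lagrange_Suc[OF assms(1)] divide_simps) (simp add: algebra_simps)
  ultimately show ?thesis by (simp add: algebra_simps)
qed

text \<open>Each antipodal pair contributes a factor in \<open>z^2\<close>, except the pair of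
  \<open>e j\<close> itself, where only the factor of \<open>- e j\<close> remains. That factor has
  modulus at most 1 on the disk, so doubling the number of nodes does not increase the
  bound.\<close>

lemma lagrange_double:
  assumes L: "leja_sequence (cball 0 1) e" and e0: "e 0 = 1" and j: "j < 2*N"
  shows "lagrange (2*N) e j z =
    lagrange N (\<lambda>i. (e (2*i))\<^sup>2) (j div 2) (z\<^sup>2) * ((z + e j) / (2 * e j))"
proof -
  let ?i = "j div 2" and ?F = "\<lambda>i. (e (2*i))\<^sup>2"
  have odd: "e (Suc (2*i)) = - e (2*i)" for i by (rule leja_odd[OF L e0])
  have sq: "(e j)\<^sup>2 = ?F ?i"
  proof (cases "even j")
    case False
    then obtain i where "j = Suc (2*i)" by (metis oddE Suc_eq_plus1)
    then show ?thesis using odd[of i] by simp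
  qed auto
  have nz: "e j \<noteq> 0" using leja_norm[OF L e0, of j] by auto
  have "lagrange (2*N) e j z =
    (\<Prod>m<N. (if 2*m = j then 1 else (z - e (2*m)) / (e j - e (2*m))) *
            (if Suc (2*m) = j then 1 else (z + e (2*m)) / (e j + e (2*m))))"
    unfolding lagrange_if prod_lessThan_double odd diff_minus_eq_add ..
  also have "\<dots> = (\<Prod>m<N. (if m = ?i then 1 else (z\<^sup>2 - ?F m) / (?F ?i - ?F m)) *
      (if m = ?i then (z + e j) / (2 * e j) else 1))"
  proof (rule prod.cong[OF refl])
    fix m assume "m \<in> {..<N}"
    show "(if 2*m = j then 1 else (z - e (2*m)) / (e j - e (2*m))) *
            (if Suc (2*m) = j then 1 else (z + e (2*m)) / (e j + e (2*m))) =
      (if m = ?i then 1 else (z\<^sup>2 - ?F m) / (?F ?i - ?F m)) *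
      (if m = ?i then (z + e j) / (2 * e j) else 1)"
    proof (cases "m = ?i")
      case True
      have "j = 2*m \<or> j = Suc (2*m)" using True by linarith
      then consider "j = 2*m" | "j = Suc (2*m)" by blast
      then show ?thesis
      proof cases
        case 1
        then have "Suc (2*m) \<noteq> j" "e (2*m) = e j" by simp_all
        then show ?thesis
          by (simp only: 1[symmetric] True[symmetric] refl if_True if_False mult_1_left mult_2[of "e j"])
      next
        case 2
        then have "2*m \<noteq> j" "e (2*m) = - e j" using odd[of m] by simp_all
        then show ?thesis
          by (simp only: 2[symmetric] True[symmetric] refl if_True if_False mult_1_left mult_1_right mult_2[of "e j"]
              diff_minus_eq_add)
      qed
    next
      case False
      then have "2*m \<noteq> j" "Suc (2*m) \<noteq> j" by auto
      have "(z\<^sup>2 - ?F m) / (?F ?i - ?F m) = ((z - e (2*m)) * (z + e (2*m))) / ((e j - e (2*m)) * (e j + e (2*m)))"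
        unfolding sq[symmetric] by (simp only: power2_eq_square square_diff_square_factored mult.commute)
      then show ?thesis using False \<open>2*m \<noteq> j\<close> \<open>Suc (2*m) \<noteq> j\<close>
        by (simp only: if_False mult_1_right times_divide_times_eq)
    qed
  qed
  also have "\<dots> = lagrange N ?F ?i (z\<^sup>2) * ((z + e j) / (2 * e j))"
    using j less_mult_imp_div_less[of j N 2, unfolded mult.commute[of N]] by (simp add: prod.distrib lagrange_if)
  finally show ?thesis .
qed

lemma cmod_half_sum_le:
  assumes "cmod z \<le> 1" "cmod a = 1"
  shows "cmod ((z + a) / (2 * a)) \<le> 1"
  using norm_triangle_ineq[of z a] assms by (simp add: norm_divide norm_mult)

text \<open>This controls the coefficient in \<open>lagrange_Suc_diff\<close>. Both parities of
  \<open>d\<close> reduce to the squared sequence at \<open>d div 2\<close>; in the odd case the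
  small denominator cancels because \<open>e d\<close> is antipodal to
  \<open>e (2*N)\<close>.\<close>

lemma leja_lagrange_next_le_1:
  assumes "leja_sequence (cball 0 1) e" "e 0 = 1" "j < d"
  shows "cmod (lagrange d e j (e d)) \<le> 1"
  using assms
proof (induction d arbitrary: e j rule: less_induct)
  case (less d)
  note L = \<open>leja_sequence (cball 0 1) e\<close> and e0 = \<open>e 0 = 1\<close>
  let ?F = "\<lambda>i. (e (2*i))\<^sup>2"
  define N where "N = d div 2"
  have n: "cmod (e m) = 1" for m using leja_norm[OF L e0] .
  have IH: "cmod (lagrange N ?F i (?F N)) \<le> 1" if "i < N" for i
    using less.IH[of N ?F i] leja_squares[OF L e0] e0 that less.prems N_def by auto
  show ?case
  proof (cases "even d")
    case True
    then have d: "d = 2*N" by (simp add: N_def)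
    have "cmod (lagrange N ?F (j div 2) (?F N)) * cmod ((e d + e j) / (2 * e j)) \<le> 1 * 1"
      using less.prems d by (intro mult_mono IH cmod_half_sum_le) (auto simp: n)
    then show ?thesis using less.prems d lagrange_double[OF L e0, of j N "e d"] by (simp add: norm_mult norm_divide)
  next
    case False
    then have d: "d = Suc (2*N)" by (auto simp: N_def elim!: oddE)
    have o: "e (Suc (2*i)) = - e (2*i)" for i by (rule leja_odd[OF L e0])
    show ?thesis
    proof (cases "j = 2*N")
      case True
      have "node_prod (2*N) e (- e (2*N)) = node_prod (2*N) e (e (2*N))"
        using node_prod_double[of N e] o by simp
      then show ?thesis using True d o[of N] leja_distinct[OF L, of "2*N"]
        by (simp add: lagrange_Suc_last)
    next
      case False
      then have j: "j < 2*N" using less.prems d by auto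
      have ne: "e j \<noteq> e (2*N)" using leja_inj[OF L] False by (auto simp: inj_def)
      have "lagrange d e j (e d) = lagrange N ?F (j div 2) (?F N) *
         (((- e (2*N) + e j) / (2 * e j)) * ((- e (2*N) - e (2*N)) / (e j - e (2*N))))"
        unfolding d o lagrange_Suc[OF j] lagrange_double[OF L e0 j] by simp
      \<comment> \<open>The factor left over from the pair of \<open>e j\<close> cancels
        \<open>e j - e (2*N)\<close>, and a number of modulus 1 remains.\<close>
      also have "((- e (2*N) + e j) / (2 * e j)) * ((- e (2*N) - e (2*N)) / (e j - e (2*N)))
         = - e (2*N) / e j"
        using ne n[of j] by (auto simp: divide_simps)
      finally show ?thesis using IH[of "j div 2"] j by (simp add: norm_mult norm_divide n less_mult_imp_div_less)
    qed
  qed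
qed

text \<open>Halving an even \<open>d\<close> costs nothing, while an odd \<open>d\<close> costs at
  most 1 for the extra node. The number of halvings gives the logarithm.\<close>

lemma leja_lagrange_le:
  assumes "leja_sequence (cball 0 1) e" "e 0 = 1" "j < d" "cmod z \<le> 1"
  shows "cmod (lagrange d e j z) \<le> 1 + log 2 d"
  using assms
proof (induction d arbitrary: e j z rule: less_induct)
  case (less d)
  note L = \<open>leja_sequence (cball 0 1) e\<close> and e0 = \<open>e 0 = 1\<close>
  let ?F = "\<lambda>i. (e (2*i))\<^sup>2"
  define N where "N = d div 2"
  have n: "cmod (e m) = 1" for m using leja_norm[OF L e0] .
  have even: "cmod (lagrange (2*N) e i z) \<le> 1 + log 2 N" if "i < 2*N" for i
  proof -
    have "cmod (lagrange N ?F (i div 2) (z\<^sup>2)) * cmod ((z + e i) / (2 * e i)) \<le> (1 + log 2 N) * 1"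
    proof (intro mult_mono cmod_half_sum_le n less.prems)
      show "cmod (lagrange N ?F (i div 2) (z\<^sup>2)) \<le> 1 + log 2 N"
        using that less.prems leja_squares[OF L e0] e0
        by (intro less.IH) (auto simp: N_def norm_power power_le_one)
    qed (use that in auto)
    then show ?thesis using lagrange_double[OF L e0 that, of z] by (simp add: norm_mult norm_divide)
  qed
  show ?case
  proof (cases "even d")
    case True
    then have d: "d = 2*N" by (simp add: N_def)
    have "log 2 N \<le> log 2 d" using less.prems d by (subst log_le_cancel_iff) auto
    then show ?thesis using even[of j] \<open>j < d\<close> unfolding d by linarith
  next
    case False
    then have d: "d = Suc (2*N)" by (auto simp: N_def elim!: oddE)
    show ?thesis
    proof (cases "j = 2*N")
      case True
      have "0 \<le> log 2 d" using d by simp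
      moreover have "cmod (lagrange d e j z) \<le> 1"
        using True d leja_node_prod_le[OF L \<open>cmod z \<le> 1\<close>, of "2*N"] leja_distinct[OF L, of "2*N"]
        by (simp add: lagrange_Suc_last norm_divide)
      ultimately show ?thesis by linarith
    next
      case False
      then have j: "j < 2*N" using less.prems d by auto
      have "cmod (lagrange (2*N) e j (e (2*N)) * (node_prod (2*N) e z / node_prod (2*N) e (e (2*N)))) \<le> 1 * 1"
        unfolding norm_mult
        using leja_node_prod_le[OF L \<open>cmod z \<le> 1\<close>, of "2*N"] leja_distinct[OF L, of "2*N"]
        by (intro mult_mono leja_lagrange_next_le_1[OF L e0 j]) (auto simp: norm_divide)
      then have "cmod (lagrange d e j z) \<le> (1 + log 2 N) + 1"
        unfolding d lagrange_Suc_diff[OF j leja_inj[OF L]]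
        using norm_triangle_ineq4 even[OF j] by (smt (verit))
      \<comment> \<open>The unit lost at the odd step is exactly what halving takes off the
        logarithm.\<close>
      also have "\<dots> = 1 + log 2 (2 * N)" using j by (simp add: log_mult)
      also have "\<dots> \<le> 1 + log 2 d" using j d by (simp del: log_mult)
      finally show ?thesis .
    qed
  qed
qed

section \<open>Partial fractions and reproduction of polynomials\<close>

lemma perp_eq: "perp y = \<i> * y"
  by (simp add: perp_def complex_eq_iff)

lemma of_real_inner: "complex_of_real (u \<bullet> x) = (cnj u * x + u * cnj x) / 2"
  by (simp add: inner_complex_def complex_eq_iff)

text \<open>The points \<open>z\<close> and \<open>z'\<close> are those of the unit circle whose projection onto \<open>u\<close> is \<open>w\<close>.\<close>

lemma norm_mult_chords:
  assumes "cmod u = 1" "cmod m = 1" "z * z' = u\<^sup>2" "z + z' = 2 * of_real w * u"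
  shows "cmod (z - m) * cmod (z' - m) = 2 * \<bar>w - u \<bullet> m\<bar>"
proof -
  have u: "u * cnj u = 1" "m * cnj m = 1" using assms(1,2) by (simp_all flip: complex_norm_square)
  have "(z - m) * (z' - m) = z * z' - m * (z + z') + m * m" by (simp add: algebra_simps)
  also have "\<dots> = 2 * m * u * ((cnj u * m + u * cnj m) / 2 - of_real w)"
  proof -
    have "m * u * (cnj u * m + u * cnj m) = m * m + u * u"
      using u by algebra
    moreover have "2 * m * u * ((cnj u * m + u * cnj m) / 2 - of_real w) =
        m * u * (cnj u * m + u * cnj m) - m * (2 * of_real w * u)" by (simp add: algebra_simps)
    ultimately show ?thesis using assms(3,4) by (simp add: power2_eq_square)
  qed
  also have "\<dots> = 2 * m * u * of_real (u \<bullet> m - w)" by (simp add: of_real_inner)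
  finally have "cmod ((z - m) * (z' - m)) = 2 * \<bar>u \<bullet> m - w\<bar>"
    using assms(1,2) by (simp only: norm_mult norm_of_real) simp
  then show ?thesis by (simp add: norm_mult abs_minus_commute)
qed

text \<open>Here \<open>u\<close> is normal to the chord, so \<open>a\<close> and \<open>b\<close>
  are the two points of the circle with the same projection onto \<open>u\<close>. The second and
  fourth claims are the hypotheses of \<open>norm_mult_chords\<close> for this pair; it then turns
  \<open>u \<bullet> (a - m)\<close> into a product of two chord lengths.\<close>

lemma unit_chord:
  assumes "cmod a = 1" "cmod b = 1" "a \<noteq> b"
  defines "u \<equiv> perp (a - b) / of_real (cmod (a - b))"
  shows "cmod u = 1" "a * b = u\<^sup>2" "u \<bullet> a = u \<bullet> b" "a + b = 2 * of_real (u \<bullet> a) * u"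
proof -
  define r where "r = cmod (a - b)"
  have r: "r > 0" using assms(3) by (simp add: r_def)
  have u: "u = \<i> * (a - b) / of_real r" by (simp add: u_def perp_eq r_def)
  have ab: "a * cnj a = 1" "b * cnj b = 1" using assms(1,2) by (simp_all flip: complex_norm_square)
  have r2: "(of_real r)\<^sup>2 = (a - b) * (cnj a - cnj b)"
    unfolding r_def of_real_power[symmetric] complex_norm_square by simp
  show nu: "cmod u = 1" using r by (simp add: u norm_mult norm_divide) (simp add: r_def)
  have "a * b * ((a - b) * (cnj a - cnj b)) = (a - b) * (b * (a * cnj a) - a * (b * cnj b))"
    by (simp add: algebra_simps)
  also have "\<dots> = - ((a - b)\<^sup>2)" unfolding ab by (simp add: power2_eq_square algebra_simps)
  finally have "a * b * (of_real r)\<^sup>2 = - ((a - b)\<^sup>2)" by (simp add: r2)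
  then show sq: "a * b = u\<^sup>2" using r by (simp add: u power_divide power_mult_distrib divide_simps)
  have "cnj u * a + u * cnj a = u * cnj u * (a + b) * cnj u"
  proof -
    have "u * (u * cnj u) * cnj a = u\<^sup>2 * cnj a * cnj u" by (simp add: power2_eq_square algebra_simps)
    also have "\<dots> = b * cnj u * (a * cnj a)" by (simp flip: sq)
    finally have "u * cnj a = b * cnj u" using ab nu by (simp flip: complex_norm_square)
    then show ?thesis using nu by (simp add: algebra_simps flip: complex_norm_square)
  qed
  then have eq: "2 * of_real (u \<bullet> a) = (a + b) * cnj u"
    using nu by (simp add: of_real_inner flip: complex_norm_square)
  then show "a + b = 2 * of_real (u \<bullet> a) * u"
    using nu by (simp add: mult.assoc) (simp add: mult.commute flip: complex_norm_square)
  show "u \<bullet> a = u \<bullet> b"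
    by (simp add: u inner_complex_def) (simp add: algebra_simps diff_divide_distrib add_divide_distrib)
qed

lemma perp_inner_self: "perp y \<bullet> y = 0"
  by (simp add: perp_def inner_complex_def)

lemma norm_perp: "norm (perp y) = norm y"
  by (simp add: perp_eq norm_mult)

text \<open>Three distinct points of a circle are not collinear: the inner product is proportional
  to the product of the distances from \<open>c\<close> to \<open>a\<close> and
  \<open>b\<close>.\<close>

lemma perp_inner_chord_nonzero:
  assumes "cmod a = 1" "cmod b = 1" "cmod c = 1" "a \<noteq> b" "a \<noteq> c" "b \<noteq> c"
  shows "perp (a - b) \<bullet> (a - c) \<noteq> 0"
proof
  assume 0: "perp (a - b) \<bullet> (a - c) = 0"
  define u where "u = perp (a - b) / of_real (cmod (a - b))"
  note uc = unit_chord[OF assms(1,2,4), folded u_def]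
  have "u \<bullet> (a - c) = 0"
    using 0 unfolding u_def divide_inverse of_real_inverse[symmetric]
    by (metis inner_scaleR_left mult.commute mult_zero_right scaleR_conv_of_real)
  then have "cmod (a - c) * cmod (b - c) = 0"
    using norm_mult_chords[OF uc(1) assms(3) uc(2,4)] by (simp add: inner_diff_right)
  then show False using assms by simp
qed

text \<open>The nodes \<open>s\<close> and \<open>t\<close> have the same projection. The product
  \<open>kergin_h\<close> omits \<open>s\<close> but keeps \<open>t\<close>, so it has a zero at
  that projection, and its derivative there is the product of the remaining factors.\<close>

lemma kergin_PP_eq:
  assumes "s < d" "t < d" "s \<noteq> t"
  shows "kergin_PP d a s t x =
    (\<Prod>m\<in>{..<d} - {s}. perp (a s - a t) \<bullet> (x - a m)) /
    ((cmod (a s - a t))\<^sup>2 * (\<Prod>m\<in>{..<d} - {s} - {t}. perp (a s - a t) \<bullet> (a s - a m)))"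
proof -
  let ?p = "perp (a s - a t)"
  have eq: "?p \<bullet> a t = ?p \<bullet> a s"
    using perp_inner_self[of "a s - a t"] by (simp add: inner_diff_right)
  let ?g = "\<lambda>w. \<Prod>m\<in>{..<d} - {s} - {t}. w - ?p \<bullet> a m"
  have h: "kergin_h d a s t = (\<lambda>w. (w - ?p \<bullet> a s) * ?g w)"
  proof
    fix w
    show "kergin_h d a s t w = (w - ?p \<bullet> a s) * ?g w"
      unfolding kergin_h_def eq[symmetric] using assms by (intro prod.remove) auto
  qed
  have "\<exists>D. (?g has_field_derivative D) (at w)" for w
    by (rule exI, rule has_field_derivative_prod) (auto intro!: derivative_eq_intros)
  then obtain g' where "\<And>w. (?g has_field_derivative g' w) (at w)" by metis
  then have "(kergin_h d a s t has_field_derivative ?g (?p \<bullet> a s)) (at (?p \<bullet> a s))"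
    unfolding h by (auto intro!: derivative_eq_intros)
  then have "deriv (kergin_h d a s t) (?p \<bullet> a s) = ?g (?p \<bullet> a s)"
    by (rule DERIV_imp_deriv)
  then show ?thesis
    unfolding kergin_PP_def by (simp add: kergin_h_def inner_diff_right)
qed

text \<open>Exchanging the nodes negates \<open>perp (a s - a t)\<close>, which enters
  \<open>d - 1\<close> times in the numerator and \<open>d - 2\<close> times in the denominator. The
  antisymmetry allows sums over \<open>s < t\<close> to be regrouped by node.\<close>

lemma kergin_PP_swap:
  assumes "s < d" "t < d" "s \<noteq> t"
  shows "kergin_PP d a t s x = - kergin_PP d a s t x"
proof -
  let ?p = "perp (a s - a t)"
  have p: "perp (a t - a s) = - ?p" by (simp add: perp_eq algebra_simps)
  have eq: "?p \<bullet> a t = ?p \<bullet> a s"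
    using perp_inner_self[of "a s - a t"] by (simp add: inner_diff_right)
  have "(\<Prod>m\<in>{..<d} - {t}. (- ?p) \<bullet> (x - a m)) = - ((?p \<bullet> (x - a s)) * (\<Prod>m\<in>{..<d} - {s} - {t}. (- ?p) \<bullet> (x - a m)))"
    using assms by (subst prod.remove[of _ s]) (auto simp: insert_commute Diff_insert2[symmetric])
  moreover have "(\<Prod>m\<in>{..<d} - {s}. ?p \<bullet> (x - a m)) = (?p \<bullet> (x - a s)) * (\<Prod>m\<in>{..<d} - {s} - {t}. ?p \<bullet> (x - a m))"
    using assms by (subst prod.remove[of _ t]) (auto simp: inner_diff_right eq)
  moreover have "(\<Prod>m\<in>{..<d} - {t} - {s}. (- ?p) \<bullet> (a t - a m)) = (\<Prod>m\<in>{..<d} - {s} - {t}. (- ?p) \<bullet> (a s - a m))"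
    by (intro prod.cong) (auto simp: inner_diff_right eq)
  ultimately show ?thesis
    unfolding kergin_PP_eq[OF assms(2,1) assms(3)[symmetric]] kergin_PP_eq[OF assms] p
    by (simp add: prod_uminus norm_minus_commute)
qed

text \<open>The difference of the two sides has degree below \<open>card I\<close> and
  \<open>card I\<close> distinct roots. Avoiding division by the leading coefficients keeps the case
  where one of them vanishes.\<close>

lemma poly_eq_lead_smult_prod_roots:
  fixes p :: "'a::field poly"
  assumes "finite I" "inj_on r I" "\<And>t. t \<in> I \<Longrightarrow> poly p (r t) = 0" "degree p \<le> card I"
    and "\<And>t. t \<in> I \<Longrightarrow> poly q (r t) = 0" "degree q \<le> card I"
  shows "smult (coeff q (card I)) p = smult (coeff p (card I)) q"
proof (rule ccontr)
  define E where "E = smult (coeff q (card I)) p - smult (coeff p (card I)) q"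
  assume "smult (coeff q (card I)) p \<noteq> smult (coeff p (card I)) q"
  then have E0: "E \<noteq> 0" by (simp add: E_def)
  have "card I = card (r ` I)" by (simp add: card_image assms)
  also have "\<dots> \<le> card {x. poly E x = 0}"
    using assms E0 by (intro card_mono poly_roots_finite) (auto simp: E_def)
  also have "\<dots> \<le> degree E" by (rule card_poly_roots_bound[OF E0])
  finally have ge: "card I \<le> degree E" .
  have "degree E \<le> card I" unfolding E_def using assms(4,6)
    by (intro degree_diff_le) (auto intro: order_trans[OF degree_smult_le])
  with ge have "degree E = card I" by simp
  moreover have "coeff E (card I) = 0" by (simp add: E_def mult.commute)
  ultimately show False using E0 leading_coeff_0_iff by metis
qed

lemma coeff_prod_linear:
  fixes u v :: "'i \<Rightarrow> 'a::comm_ring_1"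
  assumes "finite I"
  shows "degree (\<Prod>m\<in>I. [:u m, v m:]) \<le> card I"
    and "coeff (\<Prod>m\<in>I. [:u m, v m:]) (card I) = (\<Prod>m\<in>I. v m)"
    and "coeff (\<Prod>m\<in>I. [:u m, v m:]) 0 = (\<Prod>m\<in>I. u m)"
proof -
  have "degree (\<Prod>m\<in>I. [:u m, v m:]) \<le> card I \<and> coeff (\<Prod>m\<in>I. [:u m, v m:]) (card I) = (\<Prod>m\<in>I. v m)"
    using assms
  proof (induction I rule: finite_induct)
    case (insert i I)
    let ?P = "\<Prod>m\<in>I. [:u m, v m:]"
    have "degree ([:u i, v i:] * ?P) \<le> 1 + card I"
      by (rule order_trans[OF degree_mult_le]) (use insert.IH in \<open>auto intro!: add_mono\<close>)
    moreover have "coeff ?P (Suc (card I)) = 0"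
      using insert.IH by (intro coeff_eq_0) auto
    ultimately show ?case using insert by simp
  qed simp
  then show "degree (\<Prod>m\<in>I. [:u m, v m:]) \<le> card I"
    and "coeff (\<Prod>m\<in>I. [:u m, v m:]) (card I) = (\<Prod>m\<in>I. v m)" by auto
  show "coeff (\<Prod>m\<in>I. [:u m, v m:]) 0 = (\<Prod>m\<in>I. u m)"
    by (simp add: poly_0_coeff_0[symmetric] poly_prod)
qed

text \<open>With \<open>\<zeta> = \<xi> / cnj \<xi>\<close> the inner product \<open>\<xi> \<bullet> v\<close> is a multiple of
  \<open>v + \<zeta> * cnj v\<close>, so the identity below is the partial fraction decomposition in \<open>\<zeta>\<close> of the
  Lagrange polynomial of the nodes projected along \<open>\<xi>\<close>. Its constant term is found from
  the values at \<open>\<zeta> = 0\<close> and \<open>\<zeta> = \<infinity>\<close>, which are complex conjugates.\<close>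

lemma kergin_partial_fractions_poly:
  fixes X y :: "'i \<Rightarrow> complex" and \<rho> :: "'i \<Rightarrow> real"
  assumes fin: "finite I" and nc: "\<And>s t. s \<in> I \<Longrightarrow> t \<in> I \<Longrightarrow> s \<noteq> t \<Longrightarrow> perp (y t) \<bullet> y s \<noteq> 0"
    and y0: "\<And>t. t \<in> I \<Longrightarrow> y t \<noteq> 0"
    and \<rho>: "\<And>t. t \<in> I \<Longrightarrow> \<rho> t = (\<Prod>m\<in>I. perp (y t) \<bullet> X m) / ((cmod (y t))\<^sup>2 * (\<Prod>m\<in>I - {t}. perp (y t) \<bullet> y m))"
  shows "(\<Prod>m\<in>I. X m + \<zeta> * cnj (X m)) =
    of_real (Re (\<Prod>m\<in>I. X m / y m)) * (\<Prod>m\<in>I. y m + \<zeta> * cnj (y m)) +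
    (\<Sum>t\<in>I. of_real (\<rho> t) * (\<i> * (y t - \<zeta> * cnj (y t))) * (\<Prod>m\<in>I - {t}. y m + \<zeta> * cnj (y m)))"
proof -
  define n where "n = card I"
  define P where "P = Re (\<Prod>m\<in>I. X m / y m)"
  define D where "D = (\<Prod>m\<in>I. [:y m, cnj (y m):])"
  define R where "R t = (\<Prod>m\<in>I - {t}. [:y m, cnj (y m):])" for t
  define \<Delta> where "\<Delta> = (\<Prod>m\<in>I. [:X m, cnj (X m):]) - smult (of_real P) D
      - (\<Sum>t\<in>I. smult (of_real (\<rho> t) * \<i>) ([:y t, - cnj (y t):] * R t))"
  define r where "r t = - y t / cnj (y t)" for t
  \<comment> \<open>At the root belonging to \<open>t\<close> the linear factors become multiples of
    the real projections along \<open>perp (y t)\<close>, the quantities from which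
    \<open>\<rho> t\<close> is formed.\<close>
  have at_r: "v + r t * cnj v = (2 * \<i> / cnj (y t)) * of_real (perp (y t) \<bullet> v)" if "t \<in> I" for t v
    using y0[OF that] by (simp add: r_def of_real_inner perp_eq field_simps)
  have inj: "inj_on r I"
  proof (rule inj_onI, rule ccontr)
    fix s t assume st: "s \<in> I" "t \<in> I" "r s = r t" "s \<noteq> t"
    have "y s + r s * cnj (y s) = 0" using y0[OF st(1)] by (simp add: r_def)
    then show False using at_r[OF st(2), of "y s"] nc[OF st(1,2,4)] y0[OF st(2)] st(3) by auto
  qed
  have card_less: "card (I - {t}) = n - 1" "n > 0" if "t \<in> I" for t
    using that fin by (auto simp: n_def card_gt_0_iff)
  have split: "(\<Prod>m\<in>I. g m) = g t * (\<Prod>m\<in>I - {t}. g m)" if "t \<in> I" for t and g :: "'i \<Rightarrow> complex"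
    using that fin by (rule prod.remove[rotated])
  have D_r: "poly D (r t) = 0" if "t \<in> I" for t
    using that y0[OF that] fin unfolding D_def poly_prod
    by (intro prod_zero) (auto simp: r_def intro!: bexI[of _ t])
  \<comment> \<open>At \<open>r t\<close> the product \<open>D\<close> vanishes and only the summand
    of \<open>t\<close> survives; \<open>\<rho> t\<close> is its residue and matches the left-hand
    side.\<close>
  have \<Delta>_r: "poly \<Delta> (r t) = 0" if "t \<in> I" for t
  proof -
    let ?k = "2 * \<i> / cnj (y t)"
    have R: "poly (R s) (r t) = (if s = t then ?k ^ (n - 1) * of_real (\<Prod>m\<in>I - {t}. perp (y t) \<bullet> y m) else 0)"
      if "s \<in> I" for s
    proof (cases "s = t")
      case True
      have "poly (R t) (r t) = (\<Prod>m\<in>I - {t}. ?k * of_real (perp (y t) \<bullet> y m))"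
        unfolding at_r[OF \<open>t \<in> I\<close>, symmetric] by (simp add: R_def poly_prod)
      then show ?thesis using card_less[OF \<open>t \<in> I\<close>] True
        by (simp only: prod.distrib prod_constant of_real_prod) simp
    next
      case False
      then show ?thesis using \<open>t \<in> I\<close> fin y0[OF \<open>t \<in> I\<close>] unfolding R_def poly_prod
        by (auto simp: r_def prod_zero_iff intro!: bexI[of _ t])
    qed
    have "(\<Sum>s\<in>I. poly (smult (of_real (\<rho> s) * \<i>) ([:y s, - cnj (y s):] * R s)) (r t)) =
       (\<Sum>s\<in>I. if s = t then (of_real (\<rho> t) * \<i>) * (y t - r t * cnj (y t)) * (?k ^ (n - 1) * of_real (\<Prod>m\<in>I - {t}. perp (y t) \<bullet> y m)) else 0)"
      by (rule sum.cong) (auto simp: R algebra_simps)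
    also have "\<dots> = (of_real (\<rho> t) * \<i>) * (2 * y t) * (?k ^ (n - 1) * of_real (\<Prod>m\<in>I - {t}. perp (y t) \<bullet> y m))"
      using that fin y0[OF that] by (simp add: r_def)
    also have "\<dots> = ?k ^ n * of_real (\<Prod>m\<in>I. perp (y t) \<bullet> X m)"
    proof -
      let ?q = "\<Prod>m\<in>I - {t}. perp (y t) \<bullet> y m"
      have q: "?q \<noteq> 0" using fin nc that by (auto simp: prod_zero_iff)
      have 1: "\<rho> t * (cmod (y t))\<^sup>2 * ?q = (\<Prod>m\<in>I. perp (y t) \<bullet> X m)"
        using q y0[OF that] by (simp add: \<rho>[OF that])
      have 2: "\<i> * (2 * y t) = ?k * of_real ((cmod (y t))\<^sup>2)"
        unfolding complex_norm_square using y0[OF that] by simp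
      have 3: "?k ^ n = ?k * ?k ^ (n - 1)" using card_less[OF that] by (simp flip: power_Suc)
      have "(of_real (\<rho> t) * \<i>) * (2 * y t) = of_real (\<rho> t) * (\<i> * (2 * y t))"
        by (simp only: mult_ac)
      also have "\<dots> = of_real (\<rho> t) * (?k * of_real ((cmod (y t))\<^sup>2))" by (simp only: 2)
      finally have 4: "(of_real (\<rho> t) * \<i>) * (2 * y t) = of_real (\<rho> t) * (?k * of_real ((cmod (y t))\<^sup>2))" .
      show ?thesis unfolding 1[symmetric] 3 4 of_real_mult by (simp only: mult_ac)
    qed
    finally have sum: "(\<Sum>s\<in>I. poly (smult (of_real (\<rho> s) * \<i>) ([:y s, - cnj (y s):] * R s)) (r t)) =
      ?k ^ n * of_real (\<Prod>m\<in>I. perp (y t) \<bullet> X m)" .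
    have "poly (\<Prod>m\<in>I. [:X m, cnj (X m):]) (r t) = (\<Prod>m\<in>I. ?k * of_real (perp (y t) \<bullet> X m))"
      unfolding at_r[OF that, symmetric] by (simp add: poly_prod)
    then have X: "poly (\<Prod>m\<in>I. [:X m, cnj (X m):]) (r t) = ?k ^ n * of_real (\<Prod>m\<in>I. perp (y t) \<bullet> X m)"
      by (simp only: prod.distrib prod_constant of_real_prod n_def)
    have PD: "poly (smult (of_real P) D) (r t) = 0" using D_r[OF that] by simp
    show ?thesis unfolding \<Delta>_def
      by (simp only: poly_diff poly_sum X PD sum diff_0_right diff_self)
  qed
  have deg_R: "degree ([:y t, - cnj (y t):] * R t) \<le> n" if "t \<in> I" for t
  proof -
    have "degree (R t) \<le> n - 1" using coeff_prod_linear(1)[of "I - {t}"] fin card_less[OF that] by (simp add: R_def)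
    then have "degree ([:y t, - cnj (y t):] * R t) \<le> 1 + (n - 1)"
      by (intro order_trans[OF degree_mult_le]) (auto intro!: add_mono)
    then show ?thesis using card_less[OF that] by simp
  qed
  have deg: "degree \<Delta> \<le> n" "degree D \<le> n"
    unfolding \<Delta>_def D_def using deg_R coeff_prod_linear(1)[OF fin] fin
    by (auto intro!: degree_diff_le degree_sum_le order_trans[OF degree_smult_le] simp: n_def)
  \<comment> \<open>Degree at most \<open>n\<close> and \<open>n\<close> common roots make
    \<open>\<Delta>\<close> a multiple of \<open>D\<close>; it remains to see that the factor is
    0.\<close>
  have eq: "smult (coeff D n) \<Delta> = smult (coeff \<Delta> n) D"
    unfolding n_def using deg by (intro poly_eq_lead_smult_prod_roots[OF fin inj] \<Delta>_r D_r) (auto simp: n_def)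
  define S where "S = (\<Sum>t\<in>I. \<rho> t)"
  define Y where "Y = (\<Prod>m\<in>I. y m)"
  have Y0: "Y \<noteq> 0" using y0 fin by (auto simp: Y_def)
  define l where "l = (\<Prod>m\<in>I. X m / y m)"
  have XY: "(\<Prod>m\<in>I. X m) = l * Y" using Y0 by (simp add: l_def Y_def prod_dividef)
  have c_D: "coeff D n = cnj Y" "coeff D 0 = Y"
    using coeff_prod_linear[OF fin, of y "\<lambda>m. cnj (y m)"] by (simp_all add: D_def n_def Y_def)
  have "coeff ([:y t, - cnj (y t):] * R t) n = - cnj Y \<and> coeff ([:y t, - cnj (y t):] * R t) 0 = Y" if "t \<in> I" for t
  proof -
    note c = coeff_prod_linear[of "I - {t}" y "\<lambda>m. cnj (y m)", folded R_def]
    have "coeff (R t) n = 0" using c(1) fin card_less[OF that] by (intro coeff_eq_0) auto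
    moreover obtain k where "n = Suc k" using card_less(2)[OF \<open>t \<in> I\<close>] by (cases n) auto
    ultimately show ?thesis using c(2,3) fin card_less[OF that]
      by (simp add: Y_def split[OF that] coeff_mult_0)
  qed
  then have c_sum: "(\<Sum>t\<in>I. coeff (smult (of_real (\<rho> t) * \<i>) ([:y t, - cnj (y t):] * R t)) n) = - \<i> * of_real S * cnj Y"
    "(\<Sum>t\<in>I. coeff (smult (of_real (\<rho> t) * \<i>) ([:y t, - cnj (y t):] * R t)) 0) = \<i> * of_real S * Y"
    by (simp_all add: S_def sum_distrib_left sum_distrib_right sum_negf mult_ac del: mult_pCons_left)
  have c_\<Delta>: "coeff \<Delta> n = (cnj l - of_real P + \<i> * of_real S) * cnj Y" "coeff \<Delta> 0 = (l - of_real P - \<i> * of_real S) * Y"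
    unfolding \<Delta>_def coeff_diff coeff_sum c_sum
    using coeff_prod_linear[OF fin, of X "\<lambda>m. cnj (X m)"]
    by (simp_all add: c_D n_def[symmetric] XY algebra_simps flip: complex_cnj_mult cnj_prod)
  from arg_cong[OF eq, of "\<lambda>p. coeff p 0"]
  have "l - of_real P - \<i> * of_real S = cnj l - of_real P + \<i> * of_real S"
    using Y0 by (simp add: c_\<Delta> c_D)
  \<comment> \<open>The factor has been computed from the top and from the constant coefficient.
    Equating the two gives \<open>S = Im l\<close>, and with \<open>P = Re l\<close> the factor
    vanishes.\<close>
  then have "cnj l - of_real P + \<i> * of_real S = 0"
    by (simp add: P_def complex_eq_iff l_def[symmetric])
  then have "smult (cnj Y) \<Delta> = 0" using eq by (simp add: c_\<Delta> c_D)
  then have "poly \<Delta> \<zeta> = 0" using Y0 by simp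
  then show ?thesis
    unfolding \<Delta>_def P_def D_def R_def by (simp add: poly_sum poly_prod mult.assoc diff_eq_eq add.commute del: mult_pCons_left)
qed

text \<open>Each \<open>\<xi> \<bullet> v\<close> is \<open>k\<close> times a linear form in
  \<open>\<zeta>\<close>, so multiplying the polynomial identity by a power of \<open>k\<close>
  gives the real one. The case \<open>\<xi> = 0\<close> is separate because \<open>\<zeta>\<close>
  is a quotient.\<close>

lemma kergin_partial_fractions:
  assumes a: "inj a" "\<And>m. cmod (a m) = 1" and j: "j < d"
  shows "(\<Prod>m\<in>{..<d} - {j}. \<xi> \<bullet> (x - a m)) =
    kergin_P d a j x * (\<Prod>m\<in>{..<d} - {j}. \<xi> \<bullet> (a j - a m)) +
    (\<Sum>t\<in>{..<d} - {j}. kergin_PP d a j t x * (\<xi> \<bullet> perp (a j - a t)) *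
       (\<Prod>m\<in>{..<d} - {j} - {t}. \<xi> \<bullet> (a j - a m)))"
proof (cases "\<xi> = 0 \<or> d = 1")
  case True
  show ?thesis
  proof (cases "d = 1")
    case True
    then have empty: "{..<d} - {j} = {}" using j by auto
    show ?thesis unfolding kergin_P_def empty by simp
  next
    case False
    then have "(if j = 0 then 1 else 0) \<in> {..<d} - {j}" using j by auto
    then have "(\<Prod>m\<in>{..<d} - {j}. (0::real)) = 0" by (intro prod_zero) auto
    then show ?thesis using True False by simp
  qed
next
  case False
  let ?I = "{..<d} - {j}"
  have ne: "a s = a t \<longleftrightarrow> s = t" for s t using a(1) by (auto simp: inj_def)
  define k where "k = cnj \<xi> / 2"
  define \<zeta> where "\<zeta> = \<xi> / cnj \<xi>"
  have in1: "complex_of_real (\<xi> \<bullet> v) = k * (v + \<zeta> * cnj v)" for v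
    using False by (simp add: k_def \<zeta>_def of_real_inner field_simps)
  have in2: "complex_of_real (\<xi> \<bullet> perp v) = k * (\<i> * (v - \<zeta> * cnj v))" for v
    using False by (simp add: k_def \<zeta>_def of_real_inner perp_eq field_simps)
  have pf: "(\<Prod>m\<in>?I. (x - a m) + \<zeta> * cnj (x - a m)) =
    of_real (Re (\<Prod>m\<in>?I. (x - a m) / (a j - a m))) * (\<Prod>m\<in>?I. (a j - a m) + \<zeta> * cnj (a j - a m)) +
    (\<Sum>t\<in>?I. of_real (kergin_PP d a j t x) * (\<i> * ((a j - a t) - \<zeta> * cnj (a j - a t))) *
      (\<Prod>m\<in>?I - {t}. (a j - a m) + \<zeta> * cnj (a j - a m)))"
    by (rule kergin_partial_fractions_poly)
      (use j in \<open>auto simp: ne kergin_PP_eq perp_inner_chord_nonzero[OF a(2) a(2) a(2)]\<close>)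
  have card: "card (?I - {t}) = card ?I - 1" "card ?I > 0" if "t \<in> ?I" for t
    using that by (auto simp: card_gt_0_iff)
  have "complex_of_real (\<Prod>m\<in>?I. \<xi> \<bullet> (x - a m)) = k ^ card ?I * (\<Prod>m\<in>?I. (x - a m) + \<zeta> * cnj (x - a m))"
    unfolding of_real_prod in1 by (simp add: prod.distrib)
  also have "\<dots> = of_real (kergin_P d a j x) * (k ^ card ?I * (\<Prod>m\<in>?I. (a j - a m) + \<zeta> * cnj (a j - a m))) +
    (\<Sum>t\<in>?I. of_real (kergin_PP d a j t x) * (k * (\<i> * ((a j - a t) - \<zeta> * cnj (a j - a t)))) *
      (k ^ card (?I - {t}) * (\<Prod>m\<in>?I - {t}. (a j - a m) + \<zeta> * cnj (a j - a m))))"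
  proof -
    have *: "k ^ card ?I * (A * B * C) = A * (k * B) * (k ^ card (?I - {t}) * C)" if "t \<in> ?I" for t A B C
      unfolding card(1)[OF that] using card(2)[OF that] power_minus_mult[of "card ?I" k]
      by (simp only: mult_ac)
    have "k ^ card ?I * (of_real (kergin_P d a j x) * p) = of_real (kergin_P d a j x) * (k ^ card ?I * p)" for p
      by (simp only: mult_ac)
    then show ?thesis unfolding pf distrib_left sum_distrib_left kergin_P_def[symmetric]
      by (intro arg_cong2[where f="(+)"] sum.cong refl *)
  qed
  also have "\<dots> = of_real (kergin_P d a j x * (\<Prod>m\<in>?I. \<xi> \<bullet> (a j - a m)) +
    (\<Sum>t\<in>?I. kergin_PP d a j t x * (\<xi> \<bullet> perp (a j - a t)) * (\<Prod>m\<in>?I - {t}. \<xi> \<bullet> (a j - a m))))"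
    unfolding of_real_add of_real_sum of_real_mult of_real_prod in2
    unfolding in1 prod.distrib by simp
  finally show ?thesis by (simp only: of_real_eq_iff)
qed

section \<open>Reproduction of ridge powers, monomials and polynomials\<close>

lemma lagrange_interpolation_power:
  fixes w :: "nat \<Rightarrow> 'a::field"
  assumes "inj_on w {..<d}" "n < d"
  shows "(\<Sum>j<d. w j ^ n * (\<Prod>m\<in>{..<d} - {j}. (v - w m) / (w j - w m))) = v ^ n"
proof -
  define L where "L j = (\<Prod>m\<in>{..<d} - {j}. smult (inverse (w j - w m)) [:- w m, 1:])" for j
  define E where "E = (\<Sum>j<d. smult (w j ^ n) (L j)) - monom 1 n"
  have pL: "poly (L j) v = (\<Prod>m\<in>{..<d} - {j}. (v - w m) / (w j - w m))" for j v
    unfolding L_def poly_prod by (rule prod.cong) (simp_all add: divide_inverse algebra_simps)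
  have nodes: "poly (L j) (w i) = (if i = j then 1 else 0)" if "i < d" "j < d" for i j
  proof (cases "i = j")
    case True
    have "w j \<noteq> w m" if "m \<in> {..<d} - {j}" for m
      using inj_onD[OF assms(1), of j m] that \<open>j < d\<close> by auto
    then show ?thesis using True by (simp add: pL)
  next
    case False
    then show ?thesis using that by (auto simp: pL prod_zero_iff)
  qed
  have root: "poly E (w i) = 0" if "i < d" for i
  proof -
    have "(\<Sum>j<d. w j ^ n * poly (L j) (w i)) = (\<Sum>j<d. if i = j then w j ^ n else 0)"
      by (rule sum.cong) (auto simp: nodes that)
    then show ?thesis using that by (simp add: E_def poly_sum poly_monom)
  qed
  have "degree (L j) \<le> d - 1" if "j < d" for j
  proof -
    have "degree (L j) \<le> (\<Sum>m\<in>{..<d} - {j}. 1)" unfolding L_def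
    proof (rule order_trans[OF degree_prod_sum_le], simp, rule sum_mono)
      fix m show "(degree \<circ> (\<lambda>m. smult (inverse (w j - w m)) [:- w m, 1:])) m \<le> 1"
        using degree_smult_le[of "inverse (w j - w m)" "[:- w m, 1:]"] by (simp only: o_def) simp
    qed
    then show ?thesis using that by simp
  qed
  then have "degree E \<le> d - 1" unfolding E_def using assms(2)
    by (intro degree_diff_le degree_sum_le order_trans[OF degree_monom_le] order_trans[OF degree_smult_le]) auto
  moreover have "d \<le> degree E" if "E \<noteq> 0"
  proof -
    have "d = card (w ` {..<d})" by (simp add: card_image assms)
    also have "\<dots> \<le> card {x. poly E x = 0}"
      using that root by (intro card_mono poly_roots_finite) auto
    also have "\<dots> \<le> degree E" by (rule card_poly_roots_bound[OF that])
    finally show ?thesis .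
  qed
  ultimately have "E = 0" using assms(2) by (cases "E = 0") linarith+
  then have "poly E v = 0" by simp
  then show ?thesis by (simp add: E_def poly_sum poly_monom pL)
qed

lemma sum_antisym_pairs:
  fixes c :: "nat \<Rightarrow> nat \<Rightarrow> real"
  assumes "\<And>s t. s < d \<Longrightarrow> t < d \<Longrightarrow> s \<noteq> t \<Longrightarrow> c t s = - c s t"
  shows "(\<Sum>t<d. \<Sum>s<t. c s t * (g s - g t)) = (\<Sum>j<d. g j * (\<Sum>t\<in>{..<d} - {j}. c j t))"
  using assms
proof (induction d)
  case (Suc d)
  have "(\<Sum>j<d. g j * (\<Sum>t\<in>{..<Suc d} - {j}. c j t)) = (\<Sum>j<d. g j * (\<Sum>t\<in>{..<d} - {j}. c j t) + g j * c j d)"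
  proof (rule sum.cong[OF refl])
    fix j assume "j \<in> {..<d}"
    then have "{..<Suc d} - {j} = insert d ({..<d} - {j})" by auto
    then show "g j * (\<Sum>t\<in>{..<Suc d} - {j}. c j t) = g j * (\<Sum>t\<in>{..<d} - {j}. c j t) + g j * c j d"
      by (simp add: algebra_simps)
  qed
  moreover have "{..<Suc d} - {d} = {..<d}" by auto
  moreover have "(\<Sum>t<d. c d t) = - (\<Sum>s<d. c s d)"
    unfolding sum_negf[symmetric] by (rule sum.cong[OF refl], rule Suc.prems) auto
  moreover have "(\<Sum>t<d. \<Sum>s<t. c s t * (g s - g t)) = (\<Sum>j<d. g j * (\<Sum>t\<in>{..<d} - {j}. c j t))"
    by (rule Suc.IH, rule Suc.prems) auto
  moreover have "(\<Sum>s<d. c s d * (g s - g d)) = (\<Sum>j<d. g j * c j d) + g d * - (\<Sum>s<d. c s d)"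
    by (simp add: algebra_simps sum_subtractf sum_distrib_left)
  ultimately show ?case by (simp only: sum.lessThan_Suc sum.distrib add.assoc)
qed simp

text \<open>Along the segment the integrand is a multiple of the derivative of the ridge power, so
  the fundamental theorem of calculus gives a divided difference of the projected end
  points.\<close>

lemma segment_functional_ridge:
  assumes "\<xi> \<bullet> a \<noteq> \<xi> \<bullet> b"
  shows "segment_functional a b (dir_deriv v (\<lambda>x. (\<xi> \<bullet> x) ^ n)) =
    (\<xi> \<bullet> v) * ((\<xi> \<bullet> a) ^ n - (\<xi> \<bullet> b) ^ n) / (\<xi> \<bullet> (a - b))"
proof -
  let ?w = "\<lambda>t::real. \<xi> \<bullet> a + t * (\<xi> \<bullet> (b - a))"
  have "((\<lambda>x. (\<xi> \<bullet> x) ^ n) has_derivative (\<lambda>h. of_nat n * (\<xi> \<bullet> h) * (\<xi> \<bullet> x) ^ (n - 1))) (at x)" for x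
    by (auto intro!: derivative_eq_intros)
  note dd = dir_deriv_eq[OF this]
  have ne: "\<xi> \<bullet> (b - a) \<noteq> 0" using assms by (simp add: inner_diff_right)
  have "((\<lambda>t. of_nat n * (\<xi> \<bullet> v) * ?w t ^ (n - 1)) has_integral
      (\<xi> \<bullet> v) / (\<xi> \<bullet> (b - a)) * ?w 1 ^ n - (\<xi> \<bullet> v) / (\<xi> \<bullet> (b - a)) * ?w 0 ^ n) {0..1}"
    using ne by (intro fundamental_theorem_of_calculus)
      (auto intro!: derivative_eq_intros simp: has_real_derivative_iff_has_vector_derivative[symmetric])
  then have "segment_functional a b (dir_deriv v (\<lambda>x. (\<xi> \<bullet> x) ^ n)) =
     (\<xi> \<bullet> v) / (\<xi> \<bullet> (b - a)) * ?w 1 ^ n - (\<xi> \<bullet> v) / (\<xi> \<bullet> (b - a)) * ?w 0 ^ n"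
    unfolding segment_functional_def dd by (intro integral_unique) (simp add: inner_add_right)
  also have "\<dots> = (\<xi> \<bullet> v) * ((\<xi> \<bullet> a) ^ n - (\<xi> \<bullet> b) ^ n) / (\<xi> \<bullet> (a - b))"
  proof -
    have "\<xi> \<bullet> (a - b) = - (\<xi> \<bullet> (b - a))" by (simp add: inner_diff_right)
    moreover have "?w 1 = \<xi> \<bullet> b" "?w 0 = \<xi> \<bullet> a" by (simp_all add: inner_diff_right)
    moreover have "V / W * B - V / W * A = V * (A - B) / - W" for V W A B :: real
      by (simp add: algebra_simps diff_divide_distrib)
    ultimately show ?thesis by (simp only:)
  qed
  finally show ?thesis .
qed

text \<open>Antisymmetry collects everything multiplying the value at node \<open>j\<close> into one
  coefficient, and \<open>kergin_partial_fractions\<close> identifies it with the Lagrange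
  polynomial of the projected nodes. The last hypothesis keeps the projections distinct.\<close>

lemma kergin_ridge_power:
  assumes a: "inj a" "\<And>m. cmod (a m) = 1" and n: "n < d"
    and \<xi>: "\<And>s t. s < d \<Longrightarrow> t < d \<Longrightarrow> s \<noteq> t \<Longrightarrow> \<xi> \<bullet> (a s - a t) \<noteq> 0"
  shows "kergin d a (\<lambda>x. (\<xi> \<bullet> x) ^ n) x = (\<xi> \<bullet> x) ^ n"
proof -
  define c where "c s t = kergin_PP d a s t x * (\<xi> \<bullet> perp (a s - a t)) / (\<xi> \<bullet> (a s - a t))" for s t
  let ?w = "\<lambda>j. \<xi> \<bullet> a j"
  have anti: "c t s = - c s t" if "s < d" "t < d" "s \<noteq> t" for s t
  proof -
    have "a t - a s = - (a s - a t)" "perp (- (a s - a t)) = - perp (a s - a t)"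
      by (simp_all add: perp_eq algebra_simps)
    then have "c t s = (- kergin_PP d a s t x) * (- (\<xi> \<bullet> perp (a s - a t))) / (- (\<xi> \<bullet> (a s - a t)))"
      unfolding c_def kergin_PP_swap[OF that] by (metis inner_minus_right)
    then show ?thesis by (simp add: c_def)
  qed
  have "(\<Sum>t<d. \<Sum>s<t. kergin_PP d a s t x *
      segment_functional (a s) (a t) (dir_deriv (perp (a s - a t)) (\<lambda>x. (\<xi> \<bullet> x) ^ n))) =
    (\<Sum>t<d. \<Sum>s<t. c s t * (?w s ^ n - ?w t ^ n))"
  proof (intro sum.cong refl)
    fix s t assume "t \<in> {..<d}" "s \<in> {..<t}"
    then have "?w s \<noteq> ?w t" using \<xi>[of s t] by (auto simp: inner_diff_right)
    then show "kergin_PP d a s t x * segment_functional (a s) (a t) (dir_deriv (perp (a s - a t)) (\<lambda>x. (\<xi> \<bullet> x) ^ n)) =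
      c s t * (?w s ^ n - ?w t ^ n)"
      by (simp add: segment_functional_ridge c_def)
  qed
  also have "\<dots> = (\<Sum>j<d. ?w j ^ n * (\<Sum>t\<in>{..<d} - {j}. c j t))"
    using anti by (rule sum_antisym_pairs)
  finally have "kergin d a (\<lambda>x. (\<xi> \<bullet> x) ^ n) x =
    (\<Sum>j<d. ?w j ^ n * (kergin_P d a j x + (\<Sum>t\<in>{..<d} - {j}. c j t)))"
    by (simp add: kergin_def sum.distrib algebra_simps)
  also have "\<dots> = (\<Sum>j<d. ?w j ^ n * (\<Prod>m\<in>{..<d} - {j}. ((\<xi> \<bullet> x) - ?w m) / (?w j - ?w m)))"
  proof (rule sum.cong[OF refl])
    fix j assume "j \<in> {..<d}"
    then have j: "j < d" by simp
    let ?D = "\<Prod>m\<in>{..<d} - {j}. \<xi> \<bullet> (a j - a m)"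
    have D: "?D \<noteq> 0" using \<xi>[OF j] by (auto simp: prod_zero_iff)
    have rem: "?D = (\<xi> \<bullet> (a j - a t)) * (\<Prod>m\<in>{..<d} - {j} - {t}. \<xi> \<bullet> (a j - a m))" if "t \<in> {..<d} - {j}" for t
      using that by (intro prod.remove) auto
    have "(\<Prod>m\<in>{..<d} - {j}. \<xi> \<bullet> (x - a m)) = kergin_P d a j x * ?D + (\<Sum>t\<in>{..<d} - {j}. c j t * ?D)"
      unfolding kergin_partial_fractions[OF a j, of \<xi> x]
    proof (intro arg_cong2[where f="(+)"] sum.cong refl)
      fix t assume t: "t \<in> {..<d} - {j}"
      then have "\<xi> \<bullet> (a j - a t) \<noteq> 0" using \<xi>[of j t] j by auto
      then show "kergin_PP d a j t x * (\<xi> \<bullet> perp (a j - a t)) * (\<Prod>m\<in>{..<d} - {j} - {t}. \<xi> \<bullet> (a j - a m)) = c j t * ?D"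
        unfolding rem[OF t] by (simp add: c_def)
    qed
    also have "\<dots> = (kergin_P d a j x + (\<Sum>t\<in>{..<d} - {j}. c j t)) * ?D"
      by (simp add: sum_distrib_right distrib_right)
    finally have "kergin_P d a j x + (\<Sum>t\<in>{..<d} - {j}. c j t) = (\<Prod>m\<in>{..<d} - {j}. \<xi> \<bullet> (x - a m)) / ?D"
      using D by simp
    then show "?w j ^ n * (kergin_P d a j x + (\<Sum>t\<in>{..<d} - {j}. c j t)) =
       ?w j ^ n * (\<Prod>m\<in>{..<d} - {j}. ((\<xi> \<bullet> x) - ?w m) / (?w j - ?w m))"
      by (simp add: prod_dividef inner_diff_right)
  qed
  also have "\<dots> = (\<xi> \<bullet> x) ^ n"
  proof (rule lagrange_interpolation_power[OF _ n])
    show "inj_on ?w {..<d}"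
    proof (rule inj_onI, rule ccontr)
      fix s t assume "s \<in> {..<d}" "t \<in> {..<d}" "?w s = ?w t" "s \<noteq> t"
      then show False using \<xi>[of s t] by (simp add: inner_diff_right)
    qed
  qed
  finally show ?thesis .
qed

text \<open>For all but finitely many slopes the direction \<open>(1, \<tau>)\<close> separates the
  nodes. The error on the ridge power is then a polynomial in \<open>\<tau>\<close> with infinitely
  many zeros, so each coefficient, the error on one monomial, vanishes.\<close>

lemma kergin_monomial:
  assumes a: "inj a" "\<And>m. cmod (a m) = 1" and pq: "p + q < d"
  shows "kergin d a (\<lambda>x. Re x ^ p * Im x ^ q) x = Re x ^ p * Im x ^ q"
proof -
  define n where "n = p + q"
  define \<mu> where "\<mu> k x = Re x ^ (n - k) * Im x ^ k" for k and x :: complex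
  define C where "C k = real (n choose k) * (kergin d a (\<mu> k) x - \<mu> k x)" for k
  \<comment> \<open>The slopes at which two nodes share a projection. Pairs with equal imaginary
    parts merely add the value 0, since division by zero yields 0.\<close>
  define T where "T = (\<lambda>(s, t). - Re (a s - a t) / Im (a s - a t)) ` ({..<d} \<times> {..<d})"
  have \<mu>: "Ck_on 1 UNIV (\<mu> k)" for k
    unfolding \<mu>_def by (intro Ck_on_mult Ck_on_power Ck_on_Re Ck_on_Im open_UNIV)
  have zero: "(\<Sum>k\<le>n. C k * \<tau> ^ k) = 0" if "\<tau> \<notin> T" for \<tau>
  proof -
    define \<xi> where "\<xi> = Complex 1 \<tau>"
    have \<xi>: "\<xi> \<bullet> (a s - a t) \<noteq> 0" if st: "s < d" "t < d" "s \<noteq> t" for s t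
    proof
      assume "\<xi> \<bullet> (a s - a t) = 0"
      then have eq: "Re (a s - a t) + \<tau> * Im (a s - a t) = 0" by (simp add: \<xi>_def inner_complex_def)
      have "a s \<noteq> a t" using a(1) st by (auto simp: inj_def)
      then have "Im (a s - a t) \<noteq> 0" using eq by (auto simp: complex_eq_iff)
      then have "\<tau> = - Re (a s - a t) / Im (a s - a t)" using eq by (simp add: field_simps)
      then show False using \<open>\<tau> \<notin> T\<close> st unfolding T_def by force
    qed
    have binom: "(\<xi> \<bullet> y) ^ n = (\<Sum>k\<le>n. (real (n choose k) * \<tau> ^ k) * \<mu> k y)" for y
    proof -
      have "(\<xi> \<bullet> y) ^ n = (\<tau> * Im y + Re y) ^ n"
        by (simp add: \<xi>_def inner_complex_def add.commute)
      then show ?thesis by (simp add: \<mu>_def binomial_ring power_mult_distrib mult_ac)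
    qed
    have "(\<Sum>k\<le>n. (real (n choose k) * \<tau> ^ k) * kergin d a (\<mu> k) x) = kergin d a (\<lambda>y. (\<xi> \<bullet> y) ^ n) x"
      unfolding binom by (rule kergin_sum[symmetric, OF open_UNIV subset_UNIV \<mu>]) (simp add: a)
    also have "\<dots> = (\<Sum>k\<le>n. (real (n choose k) * \<tau> ^ k) * \<mu> k x)"
      unfolding binom[symmetric] using pq \<xi> by (intro kergin_ridge_power a) (auto simp: n_def)
    finally show ?thesis
      by (simp add: C_def algebra_simps sum_subtractf)
  qed
  have "finite T" by (simp add: T_def)
  then have "infinite (UNIV - T)" by (simp add: infinite_UNIV_char_0)
  then have "infinite {\<tau>. (\<Sum>k\<le>n. C k * \<tau> ^ k) = 0}"
    by (rule contrapos_nn) (auto intro: finite_subset[rotated] zero)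
  then have "C q = 0"
    using polyfun_finite_roots[of C n] n_def by (metis le_add2)
  then show ?thesis by (simp add: C_def \<mu>_def[abs_def] n_def)
qed

lemma kergin_polynomial:
  assumes a: "inj a" "\<And>m. cmod (a m) = 1" and "n + m < d"
  shows "kergin d a (\<lambda>x. \<Sum>p\<le>n. \<Sum>q\<le>m. c p q * (Re x ^ p * Im x ^ q)) x = (\<Sum>p\<le>n. \<Sum>q\<le>m. c p q * (Re x ^ p * Im x ^ q))"
proof -
  have smooth: "Ck_on 1 UNIV (\<lambda>x. Re x ^ p * Im x ^ q)" for p q
    by (intro Ck_on_mult Ck_on_power Ck_on_Re Ck_on_Im open_UNIV)
  have "kergin d a (\<lambda>x. \<Sum>i\<in>{..n} \<times> {..m}. c (fst i) (snd i) * (Re x ^ fst i * Im x ^ snd i)) x =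
    (\<Sum>i\<in>{..n} \<times> {..m}. c (fst i) (snd i) * (kergin d a (\<lambda>x. Re x ^ fst i * Im x ^ snd i) x))"
    by (rule kergin_sum[OF open_UNIV subset_UNIV smooth]) (simp add: a)
  also have "\<dots> = (\<Sum>i\<in>{..n} \<times> {..m}. c (fst i) (snd i) * (Re x ^ fst i * Im x ^ snd i))"
    by (intro sum.cong refl) (use assms(3) in \<open>auto simp: kergin_monomial[OF a]\<close>)
  finally show ?thesis by (simp add: sum.cartesian_product case_prod_unfold)
qed

section \<open>Markov inequality and ridge functions\<close>

text \<open>The two preimages under the Joukowski map are inverse to each other, so one of them lies
  outside the open unit disk.\<close>

lemma joukowski_inverse:
  obtains z :: complex where "cmod z \<ge> 1" "w = (z + inverse z) / 2"
proof -
  define z where "z = w + csqrt (w\<^sup>2 - 1)"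
  have "z * (w - csqrt (w\<^sup>2 - 1)) = w\<^sup>2 - (csqrt (w\<^sup>2 - 1))\<^sup>2"
    by (simp add: z_def power2_eq_square algebra_simps)
  then have 1: "z * (w - csqrt (w\<^sup>2 - 1)) = 1" by simp
  then have z0: "z \<noteq> 0" by auto
  have "inverse z = w - csqrt (w\<^sup>2 - 1)" using 1 inverse_unique by blast
  then have w: "w = (z + inverse z) / 2" by (simp add: z_def)
  show ?thesis
  proof (cases "cmod z \<ge> 1")
    case True
    then show ?thesis using w that by blast
  next
    case False
    then have "cmod (inverse z) \<ge> 1" using z0 by (simp add: norm_inverse one_le_inverse)
    then show ?thesis using w that[of "inverse z"] by (simp add: add.commute)
  qed
qed

text \<open>The sum of the distances from \<open>w\<close> to the foci 1 and -1 equals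
  \<open>|z| + 1 / |z|\<close>, and it is at most \<open>2 + \<beta>\<^sup>2 / 2\<close> near the
  interval. As \<open>|z| + 1 / |z|\<close> is quadratic near its minimum, a distance of order
  \<open>\<beta>\<^sup>2\<close> allows \<open>|z|\<close> to exceed 1 by \<open>\<beta>\<close>;
  this is the source of the square in Markov's inequality.\<close>

lemma joukowski_norm_le:
  fixes w z :: complex and v \<beta> :: real
  assumes z: "cmod z \<ge> 1" "w = (z + inverse z) / 2" and v: "\<bar>v\<bar> \<le> 1"
    and \<beta>: "0 < \<beta>" "\<beta> \<le> 1" "cmod (w - of_real v) \<le> \<beta>\<^sup>2 / 4"
  shows "cmod z \<le> 1 + \<beta>"
proof (rule ccontr)
  define b where "b = cmod z - 1"
  assume "\<not> cmod z \<le> 1 + \<beta>"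
  then have b: "b > \<beta>" by (simp add: b_def)
  have z0: "z \<noteq> 0" using z by auto
  have m: "w - 1 = (z - 1)\<^sup>2 / (2 * z)" "w + 1 = (z + 1)\<^sup>2 / (2 * z)"
    using z0 unfolding z(2) by (simp_all add: field_simps power2_eq_square)
  have "(cmod (z - 1))\<^sup>2 + (cmod (z + 1))\<^sup>2 = 2 * (cmod z)\<^sup>2 + 2"
    unfolding cmod_power2 by (simp add: power2_eq_square algebra_simps)
  then have "cmod (w - 1) + cmod (w + 1) = ((cmod z)\<^sup>2 + 1) / cmod z"
    unfolding m norm_divide norm_mult norm_power using z0
    by (simp add: add_divide_distrib[symmetric]) (simp add: field_simps)
  moreover have "cmod (w - 1) \<le> cmod (w - of_real v) + (1 - v)"
    using norm_triangle_ineq[of "w - of_real v" "of_real v - 1"] v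
    by (simp add: norm_of_real[of "v - 1", simplified])
  moreover have "cmod (w + 1) \<le> cmod (w - of_real v) + (1 + v)"
    using norm_triangle_ineq[of "w - of_real v" "of_real v + 1"] v
    by (simp add: norm_of_real[of "v + 1", simplified])
  ultimately have "((cmod z)\<^sup>2 + 1) / cmod z \<le> 2 + \<beta>\<^sup>2 / 2" using \<beta>(3) by linarith
  then have "(1 + b)\<^sup>2 + 1 \<le> (2 + \<beta>\<^sup>2 / 2) * (1 + b)"
    using z(1) z0 by (simp add: b_def divide_le_eq)
  then have le: "b\<^sup>2 \<le> \<beta>\<^sup>2 / 2 * (1 + b)" by (simp add: power2_eq_square algebra_simps)
  have "\<beta>\<^sup>2 < b\<^sup>2" using b \<beta> by (intro power_strict_mono) auto
  have "\<beta>\<^sup>2 \<le> 1" using \<beta> by (simp add: power_le_one)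
  show False
  proof (cases "b \<le> 1")
    case True
    have "\<beta>\<^sup>2 / 2 * (1 + b) \<le> \<beta>\<^sup>2 / 2 * 2" using True by (intro mult_left_mono) auto
    then show False using le \<open>\<beta>\<^sup>2 < b\<^sup>2\<close> by simp
  next
    case False
    have "\<beta>\<^sup>2 / 2 * (1 + b) \<le> 1 / 2 * (1 + b)" using \<open>\<beta>\<^sup>2 \<le> 1\<close> False by (intro mult_right_mono) auto
    with le have "b\<^sup>2 \<le> 1 / 2 * (1 + b)" by (rule order_trans)
    moreover have "b < b\<^sup>2" using False by (simp add: power2_eq_square)
    ultimately show False using False by simp
  qed
qed

text \<open>Maximum principle for the reversed polynomial, evaluated at
  \<open>inverse z\<close>.\<close>

lemma poly_bound_outside_disc:
  fixes q :: "complex poly"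
  assumes "degree q \<le> N" "\<And>z. cmod z = 1 \<Longrightarrow> cmod (poly q z) \<le> B" "cmod z \<ge> 1"
  shows "cmod (poly q z) \<le> B * cmod z ^ N"
proof -
  have z0: "z \<noteq> 0" using assms(3) by auto
  have B: "0 \<le> B" using order_trans[OF norm_ge_zero assms(2)[of 1]] by simp
  have "cmod (poly (reflect_poly q) x) \<le> B" if "x \<in> cball 0 1" for x
  proof (rule maximum_modulus_frontier[where f="poly (reflect_poly q)" and S="cball 0 1"])
    fix y :: complex assume "y \<in> frontier (cball 0 1)"
    then have y: "cmod y = 1" by simp
    then have "y \<noteq> 0" by auto
    then show "cmod (poly (reflect_poly q) y) \<le> B"
      using assms(2)[of "inverse y"] y by (simp add: poly_reflect_poly_nz norm_mult norm_power norm_inverse)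
  qed (use that in \<open>auto intro!: holomorphic_intros continuous_intros\<close>)
  from this[of "inverse z"] have "cmod (poly (reflect_poly q) (inverse z)) \<le> B"
    using assms(3) by (simp add: norm_inverse inverse_le_1_iff)
  moreover have "poly q z = z ^ degree q * poly (reflect_poly q) (inverse z)"
    using z0 by (simp add: poly_reflect_poly_nz power_inverse)
  ultimately have "cmod (poly q z) \<le> cmod z ^ degree q * B"
    by (simp add: norm_mult norm_power mult_left_mono)
  also have "\<dots> \<le> cmod z ^ N * B"
    using assms(1,3) B by (intro mult_right_mono power_increasing) auto
  finally show ?thesis by (simp add: mult.commute)
qed

text \<open>Bernstein's growth estimate on ellipses: multiplied by \<open>z^n\<close>, the
  composition with the Joukowski map becomes a polynomial of degree at most \<open>2 n\<close>. It
  is bounded by \<open>B\<close> on the circle, which is mapped to the interval.\<close>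

lemma poly_bound_near_interval:
  fixes p :: "complex poly"
  assumes deg: "degree p \<le> n" and B: "\<And>v. \<bar>v\<bar> \<le> 1 \<Longrightarrow> cmod (poly p (of_real v)) \<le> B"
    and z: "cmod z \<ge> 1"
  shows "cmod (poly p ((z + inverse z) / 2)) \<le> B * cmod z ^ n"
proof -
  define q where "q = (\<Sum>k\<le>n. smult (coeff p k) ([:1/2, 0, 1/2:] ^ k * monom 1 (n - k)))"
  have q: "poly q z = z ^ n * poly p ((z + inverse z) / 2)" if "z \<noteq> 0" for z
  proof -
    have "((1 + z\<^sup>2) / 2) ^ k * z ^ (n - k) = z ^ n * ((z + inverse z) / 2) ^ k" if "k \<le> n" for k
    proof -
      have "(1 + z\<^sup>2) / 2 = z * ((z + inverse z) / 2)"
        using \<open>z \<noteq> 0\<close> by (simp add: power2_eq_square field_simps)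
      then have "((1 + z\<^sup>2) / 2) ^ k * z ^ (n - k) = (z ^ k * z ^ (n - k)) * ((z + inverse z) / 2) ^ k"
        by (simp only: power_mult_distrib mult_ac)
      then show ?thesis using that by (simp flip: power_add)
    qed
    then have "poly q z = (\<Sum>k\<le>n. coeff p k * (z ^ n * ((z + inverse z) / 2) ^ k))"
      unfolding q_def poly_sum
      by (intro sum.cong) (auto simp: poly_monom power2_eq_square add_divide_distrib)
    also have "\<dots> = z ^ n * (\<Sum>k\<le>n. coeff p k * ((z + inverse z) / 2) ^ k)"
      by (simp add: sum_distrib_left mult_ac)
    also have "(\<Sum>k\<le>n. coeff p k * ((z + inverse z) / 2) ^ k) = poly p ((z + inverse z) / 2)"
      unfolding poly_altdef using deg
      by (intro sum.mono_neutral_right) (auto simp: coeff_eq_0)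
    finally show ?thesis .
  qed
  have "degree q \<le> 2 * n"
    unfolding q_def
  proof (intro degree_sum_le)
    fix k assume "k \<in> {..n}"
    have "degree ([:1/2, 0, 1/2::complex:] ^ k * monom 1 (n - k)) \<le> 2 * k + (n - k)"
      using degree_power_le[of "[:1/2, 0, 1/2::complex:]" k]
      by (intro order_trans[OF degree_mult_le] add_mono degree_monom_le) auto
    then show "degree (smult (coeff p k) ([:1/2, 0, 1/2:] ^ k * monom 1 (n - k))) \<le> 2 * n"
      using \<open>k \<in> {..n}\<close> by (intro order_trans[OF degree_smult_le]) auto
  qed simp
  moreover have "cmod (poly q y) \<le> B" if y: "cmod y = 1" for y
  proof -
    have "y \<noteq> 0" using y by auto
    have "y * cnj y = 1" using y by (simp flip: complex_norm_square)
    then have "inverse y = cnj y" by (rule inverse_unique)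
    then have "(y + inverse y) / 2 = of_real (Re y)" by (simp add: complex_eq_iff)
    then show ?thesis using B[of "Re y"] abs_Re_le_cmod[of y] y
      by (simp add: q[OF \<open>y \<noteq> 0\<close>] norm_mult norm_power)
  qed
  ultimately have "cmod (poly q z) \<le> B * cmod z ^ (2 * n)"
    using z by (intro poly_bound_outside_disc) auto
  moreover have z0: "z \<noteq> 0" using z by auto
  ultimately have "cmod z ^ n * cmod (poly p ((z + inverse z) / 2)) \<le> cmod z ^ n * (B * cmod z ^ n)"
    unfolding q[OF z0] norm_mult norm_power mult_2 power_add by (simp only: mult_ac)
  then show ?thesis by (rule mult_left_le_imp_le) (use z0 in simp)
qed

text \<open>Cauchy's estimate on a circle of radius \<open>\<beta>\<^sup>2 / 4\<close> with
  \<open>\<beta> = 1 / (n + 1)\<close>: there the growth factor is at most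
  \<open>(1 + \<beta>)^n \<le> exp 1 \<le> 3\<close>, and \<open>12 = 3 * 4\<close>.\<close>

lemma markov_interval:
  fixes p :: "complex poly"
  assumes deg: "degree p \<le> n" and B: "\<And>v. \<bar>v\<bar> \<le> 1 \<Longrightarrow> cmod (poly p (of_real v)) \<le> B"
    and v: "\<bar>v\<bar> \<le> 1"
  shows "cmod (poly (pderiv p) (of_real v)) \<le> 12 * (real n + 1)\<^sup>2 * B"
proof -
  define \<beta> where "\<beta> = 1 / (real n + 1)"
  have \<beta>: "0 < \<beta>" "\<beta> \<le> 1" by (simp_all add: \<beta>_def)
  have B0: "0 \<le> B" using order_trans[OF norm_ge_zero B[of 0]] by simp
  have "cmod ((deriv ^^ 1) (poly p) (of_real v)) \<le> fact 1 * (3 * B) / (\<beta>\<^sup>2 / 4) ^ 1"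
  proof (rule Cauchy_inequality)
    fix x assume "cmod (of_real v - x) = \<beta>\<^sup>2 / 4"
    then have x: "cmod (x - of_real v) \<le> \<beta>\<^sup>2 / 4" by (simp add: norm_minus_commute)
    obtain z where z: "cmod z \<ge> 1" "x = (z + inverse z) / 2" by (rule joukowski_inverse)
    have "cmod z ^ n \<le> (1 + \<beta>) ^ n"
      using joukowski_norm_le[OF z v \<beta> x] by (intro power_mono) auto
    also have "\<dots> \<le> exp \<beta> ^ n" using \<beta> by (intro power_mono exp_ge_add_one_self) auto
    also have "\<dots> = exp (real n * \<beta>)" by (simp add: exp_of_nat_mult)
    also have "\<dots> \<le> exp 1" by (simp add: \<beta>_def)
    also have "\<dots> \<le> 3" by (rule exp_le)
    finally have "B * cmod z ^ n \<le> B * 3" using B0 by (rule mult_left_mono)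
    then show "cmod (poly p x) \<le> 3 * B"
      using poly_bound_near_interval[OF deg B z(1)] unfolding z(2)[symmetric] by linarith
  qed (use \<beta> in \<open>auto intro!: holomorphic_intros continuous_intros\<close>)
  moreover have "deriv (poly p) (of_real v) = poly (pderiv p) (of_real v)"
    by (rule DERIV_imp_deriv) (rule poly_DERIV)
  ultimately show ?thesis by (simp add: \<beta>_def power_divide mult_ac)
qed

lemma markov_interval_iterated:
  fixes p :: "complex poly"
  assumes "degree p \<le> n" "\<And>v. \<bar>v\<bar> \<le> 1 \<Longrightarrow> cmod (poly p (of_real v)) \<le> B" "\<bar>v\<bar> \<le> 1"
  shows "cmod (poly ((pderiv ^^ k) p) (of_real v)) \<le> (12 * (real n + 1)\<^sup>2) ^ k * B"
  using assms
proof (induction k arbitrary: p B)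
  case (Suc k)
  have "cmod (poly ((pderiv ^^ k) (pderiv p)) (of_real v)) \<le> (12 * (real n + 1)\<^sup>2) ^ k * (12 * (real n + 1)\<^sup>2 * B)"
    using Suc.prems markov_interval[OF Suc.prems(1,2)] by (intro Suc.IH) (auto simp: degree_pderiv)
  then show ?case by (simp add: funpow_swap1 mult_ac)
qed auto

text \<open>Restriction to the diameter through \<open>z\<close> reduces to the interval. The
  exponent is not optimal on a disk, but it gives both kinds of basis polynomials the same
  factor.\<close>

lemma markov_disc_iterated:
  fixes p :: "complex poly"
  assumes "degree p \<le> n" "\<And>z. cmod z \<le> 1 \<Longrightarrow> cmod (poly p z) \<le> B" "cmod z \<le> 1"
  shows "cmod (poly ((pderiv ^^ k) p) z) \<le> (12 * (real n + 1)\<^sup>2) ^ k * B"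
  using assms
proof (induction k arbitrary: p B)
  case (Suc k)
  have "cmod (poly (pderiv p) z) \<le> 12 * (real n + 1)\<^sup>2 * B" if "cmod z \<le> 1" for z
  proof -
    define c where "c = (if z = 0 then 1 else z / of_real (cmod z))"
    have c: "cmod c = 1" "z = c * of_real (cmod z)" by (auto simp: c_def norm_divide)
    define q where "q = pcompose p [:0, c:]"
    have pq: "poly q x = poly p (c * x)" for x by (simp add: q_def poly_pcompose mult.commute)
    have "cmod (poly (pderiv q) (of_real (cmod z))) \<le> 12 * (real n + 1)\<^sup>2 * B"
    proof (rule markov_interval)
      show "degree q \<le> n" using Suc.prems(1) degree_pcompose_le[of p "[:0, c:]"]
        by (simp add: q_def split: if_splits)
      show "cmod (poly q (of_real v)) \<le> B" if "\<bar>v\<bar> \<le> 1" for v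
        using Suc.prems(2)[of "c * of_real v"] that c by (simp add: pq norm_mult)
    qed (use that in auto)
    moreover have "poly (pderiv q) (of_real (cmod z)) = c * poly (pderiv p) z"
      using c(2) by (simp add: q_def pderiv_pcompose poly_pcompose pderiv_pCons mult.commute)
    ultimately show ?thesis by (simp add: norm_mult c(1))
  qed
  then have "cmod (poly ((pderiv ^^ k) (pderiv p)) z) \<le> (12 * (real n + 1)\<^sup>2) ^ k * (12 * (real n + 1)\<^sup>2 * B)"
    using Suc.prems by (intro Suc.IH) (auto simp: degree_pderiv)
  then show ?case by (simp add: funpow_swap1 mult_ac)
qed auto

text \<open>Complex coefficients let one notion cover both kinds of basis polynomials:
  \<open>1, \<i>\<close> gives the real part of a polynomial in \<open>z\<close>, and real
  \<open>\<alpha>, \<beta>\<close> give a plane wave. Partial derivatives stay in the class.\<close>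

definition ridge :: "complex poly \<Rightarrow> complex \<Rightarrow> complex \<Rightarrow> complex \<Rightarrow> real" where
  "ridge p \<alpha> \<beta> x = Re (poly p (\<alpha> * of_real (Re x) + \<beta> * of_real (Im x)))"

lemma has_derivative_ridge:
  "(ridge p \<alpha> \<beta> has_derivative
    (\<lambda>h. Re (poly (pderiv p) (\<alpha> * of_real (Re x) + \<beta> * of_real (Im x)) * (\<alpha> * of_real (Re h) + \<beta> * of_real (Im h))))) (at x)"
proof -
  let ?l = "\<lambda>x. \<alpha> * of_real (Re x) + \<beta> * of_real (Im x)"
  have "(?l has_derivative ?l) (at x)" by (auto intro!: derivative_eq_intros)
  moreover have "(poly p has_derivative (\<lambda>h. poly (pderiv p) (?l x) * h)) (at (?l x))"
    using poly_DERIV[of p "?l x"] by (simp add: has_field_derivative_def)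
  ultimately have "((\<lambda>x. poly p (?l x)) has_derivative (\<lambda>h. poly (pderiv p) (?l x) * ?l h)) (at x)"
    by (rule has_derivative_compose)
  from has_derivative_Re[OF this] show ?thesis unfolding ridge_def[abs_def] .
qed

lemma partial_deriv_ridge:
  "partial_deriv 1 (ridge p \<alpha> \<beta>) = ridge (smult \<alpha> (pderiv p)) \<alpha> \<beta>"
  "partial_deriv \<i> (ridge p \<alpha> \<beta>) = ridge (smult \<beta> (pderiv p)) \<alpha> \<beta>"
  by (rule ext, simp only: partial_deriv_eq[OF has_derivative_ridge], simp add: ridge_def mult.commute)+

lemma Ck_on_ridge: "Ck_on k U (ridge p \<alpha> \<beta>)"
proof (induction k arbitrary: p)
  case 0
  show ?case unfolding ridge_def[abs_def] by (auto intro!: continuous_intros)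
next
  case (Suc k)
  have "ridge p \<alpha> \<beta> differentiable at x" for x
    using has_derivative_ridge unfolding differentiable_def by blast
  then show ?case using Suc by (auto simp: Basis_complex_def partial_deriv_ridge)
qed

lemma multi_deriv_ridge:
  "multi_deriv (m, n) (ridge p \<alpha> \<beta>) = ridge (smult (\<alpha> ^ m * \<beta> ^ n) ((pderiv ^^ (m + n)) p)) \<alpha> \<beta>"
proof -
  have *: "(partial_deriv \<i> ^^ n) (ridge p \<alpha> \<beta>) = ridge (smult (\<beta> ^ n) ((pderiv ^^ n) p)) \<alpha> \<beta>"
    by (induction n) (simp_all add: partial_deriv_ridge pderiv_smult mult.commute)
  have "(partial_deriv 1 ^^ m) (ridge q \<alpha> \<beta>) = ridge (smult (\<alpha> ^ m) ((pderiv ^^ m) q)) \<alpha> \<beta>" for q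
    by (induction m) (simp_all add: partial_deriv_ridge pderiv_smult mult.commute)
  moreover have "(pderiv ^^ m) (smult c q) = smult c ((pderiv ^^ m) q)" for c and q :: "complex poly" and m
    by (induction m) (simp_all add: pderiv_smult)
  ultimately show ?thesis by (simp add: multi_deriv_def * funpow_add mult.commute)
qed

lemma multi_deriv_ridge_le:
  assumes "cmod \<alpha> \<le> 1" "cmod \<beta> \<le> 1"
    and "cmod (poly ((pderiv ^^ (m + n)) p) (\<alpha> * of_real (Re x) + \<beta> * of_real (Im x))) \<le> B"
  shows "\<bar>multi_deriv (m, n) (ridge p \<alpha> \<beta>) x\<bar> \<le> B"
proof -
  let ?y = "poly ((pderiv ^^ (m + n)) p) (\<alpha> * of_real (Re x) + \<beta> * of_real (Im x))"
  have "\<bar>multi_deriv (m, n) (ridge p \<alpha> \<beta>) x\<bar> \<le> cmod (\<alpha> ^ m * \<beta> ^ n * ?y)"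
    unfolding multi_deriv_ridge ridge_def poly_smult by (rule abs_Re_le_cmod)
  also have "\<dots> = cmod \<alpha> ^ m * cmod \<beta> ^ n * cmod ?y" by (simp add: norm_mult norm_power)
  also have "\<dots> \<le> 1 * 1 * B"
    using assms by (intro mult_mono power_le_one) auto
  finally show ?thesis by simp
qed

section \<open>Bounds for the basis polynomials\<close>

definition kergin_P_poly :: "nat \<Rightarrow> (nat \<Rightarrow> complex) \<Rightarrow> nat \<Rightarrow> complex poly" where
  "kergin_P_poly d a j = (\<Prod>m\<in>{..<d} - {j}. smult (inverse (a j - a m)) [:- a m, 1:])"

text \<open>The profile of \<^const>\<open>kergin_PP\<close> along the unit vector \<open>u\<close>, rescaled by the distance of the two nodes.\<close>

definition kergin_PP_poly :: "nat \<Rightarrow> (nat \<Rightarrow> complex) \<Rightarrow> nat \<Rightarrow> nat \<Rightarrow> complex \<Rightarrow> complex poly" where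
  "kergin_PP_poly d a s t u =
    smult (of_real (inverse (\<Prod>m\<in>{..<d} - {s} - {t}. u \<bullet> (a s - a m))))
      (\<Prod>m\<in>{..<d} - {s}. [:- of_real (u \<bullet> a m), 1:])"

lemma poly_kergin_P_poly: "poly (kergin_P_poly d a j) z = lagrange d a j z"
  unfolding kergin_P_poly_def lagrange_def poly_prod
  by (rule prod.cong) (simp_all add: divide_inverse algebra_simps)

lemma kergin_P_ridge: "kergin_P d a j = ridge (kergin_P_poly d a j) 1 \<i>"
proof
  fix x
  have "x = 1 * of_real (Re x) + \<i> * of_real (Im x)" by (simp add: complex_eq_iff)
  then show "kergin_P d a j x = ridge (kergin_P_poly d a j) 1 \<i> x"
    unfolding ridge_def poly_kergin_P_poly by (simp add: kergin_P_def lagrange_def)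
qed

lemma degree_prod_linear_le:
  fixes f :: "nat \<Rightarrow> 'a::comm_ring_1 poly"
  assumes "\<And>m. degree (f m) \<le> 1"
  shows "degree (\<Prod>m\<in>{..<d} - {j}. f m) \<le> d"
proof -
  have "degree (\<Prod>m\<in>{..<d} - {j}. f m) \<le> (\<Sum>m\<in>{..<d} - {j}. (degree \<circ> f) m)"
    by (rule degree_prod_sum_le) simp
  also have "\<dots> \<le> (\<Sum>m\<in>{..<d} - {j}. 1)" using assms by (intro sum_mono) simp
  also have "\<dots> \<le> d" using card_mono[of "{..<d}" "{..<d} - {j}"] by auto
  finally show ?thesis .
qed

lemma degree_kergin_P_poly: "degree (kergin_P_poly d a j) \<le> d"
  unfolding kergin_P_poly_def
  by (intro degree_prod_linear_le order_trans[OF degree_smult_le]) simp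

lemma degree_kergin_PP_poly: "degree (kergin_PP_poly d a s t u) \<le> d"
  unfolding kergin_PP_poly_def
  by (intro order_trans[OF degree_smult_le] degree_prod_linear_le) simp

lemma poly_kergin_PP_poly:
  "poly (kergin_PP_poly d a s t u) (of_real w) =
    of_real ((\<Prod>m\<in>{..<d} - {s}. w - u \<bullet> a m) / (\<Prod>m\<in>{..<d} - {s} - {t}. u \<bullet> (a s - a m)))"
  by (simp add: kergin_PP_poly_def poly_prod divide_inverse mult.commute)

text \<open>Normalising the direction extracts \<open>r^(d - 1)\<close> from the numerator and
  \<open>r^2 * r^(d - 2)\<close> from the denominator, so one factor \<open>1 / r\<close>
  survives.\<close>

lemma kergin_PP_ridge:
  assumes "s < d" "t < d" "s \<noteq> t" "a s \<noteq> a t"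
  defines "u \<equiv> perp (a s - a t) / of_real (cmod (a s - a t))"
  shows "kergin_PP d a s t = (\<lambda>x. inverse (cmod (a s - a t)) *
    ridge (kergin_PP_poly d a s t u) (of_real (Re u)) (of_real (Im u)) x)"
proof
  fix x
  define r where "r = cmod (a s - a t)"
  have r: "r > 0" using assms by (simp add: r_def)
  have p: "perp (a s - a t) = r *\<^sub>R u" using r by (simp add: u_def r_def scaleR_conv_of_real)
  let ?I = "{..<d} - {s}" and ?J = "{..<d} - {s} - {t}"
  have card: "card ?I = Suc (card ?J)" using card_Suc_Diff1[of ?I t] assms by simp
  have "kergin_PP d a s t x = (r ^ Suc (card ?J) * (\<Prod>m\<in>?I. u \<bullet> (x - a m))) /
    (r\<^sup>2 * (r ^ card ?J * (\<Prod>m\<in>?J. u \<bullet> (a s - a m))))"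
    unfolding kergin_PP_eq[OF assms(1-3)] r_def[symmetric] p inner_scaleR_left prod.distrib prod_constant card ..
  also have "\<dots> = inverse r * ((\<Prod>m\<in>?I. u \<bullet> (x - a m)) / (\<Prod>m\<in>?J. u \<bullet> (a s - a m)))"
    using r by (simp add: power2_eq_square divide_simps)
  also have "(\<Prod>m\<in>?I. u \<bullet> (x - a m)) / (\<Prod>m\<in>?J. u \<bullet> (a s - a m)) =
    ridge (kergin_PP_poly d a s t u) (of_real (Re u)) (of_real (Im u)) x"
  proof -
    have "complex_of_real (Re u) * of_real (Re x) + of_real (Im u) * of_real (Im x) = of_real (u \<bullet> x)"
      by (simp add: inner_complex_def)
    then show ?thesis unfolding ridge_def by (simp only: poly_kergin_PP_poly Re_complex_of_real inner_diff_right)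
  qed
  finally show "kergin_PP d a s t x = inverse (cmod (a s - a t)) *
    ridge (kergin_PP_poly d a s t u) (of_real (Re u)) (of_real (Im u)) x" by (simp add: r_def)
qed

text \<open>If \<open>z\<close>, \<open>z'\<close> are the points of the circle projecting to \<open>w\<close> then
  the profile is, up to the factor \<open>r\<^sup>2 / 2\<close>, dominated by a product of two Lagrange polynomials at \<open>z\<close> and \<open>z'\<close>:
  the two ways of pairing them have the square of the profile as their product.\<close>

lemma kergin_PP_poly_bound:
  assumes a: "inj a" "\<And>m. cmod (a m) = 1" and st: "s < d" "t < d" "s \<noteq> t"
    and M: "\<And>j z. j < d \<Longrightarrow> cmod z \<le> 1 \<Longrightarrow> cmod (lagrange d a j z) \<le> M"
    and w: "\<bar>w\<bar> \<le> 1"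
  defines "u \<equiv> perp (a s - a t) / of_real (cmod (a s - a t))"
  shows "cmod (poly (kergin_PP_poly d a s t u) (of_real w)) \<le> 2 * M\<^sup>2"
proof -
  define r where "r = cmod (a s - a t)"
  have ne: "a i = a j \<longleftrightarrow> i = j" for i j using a(1) by (auto simp: inj_def)
  have r: "0 < r" "r \<le> 2" using norm_triangle_ineq4[of "a s" "a t"] st by (simp_all add: r_def a ne)
  have "a s \<noteq> a t" using st ne by simp
  note uc = unit_chord[OF a(2) a(2) this, folded u_def]
  \<comment> \<open>The points of the unit circle with projection \<open>w\<close> onto
    \<open>u\<close> are \<open>u * (w + \<i> * sqrt (1 - w\<^sup>2))\<close> and its mirror image
    \<open>z'\<close>.\<close>
  define z where "z = u * Complex w (sqrt (1 - w\<^sup>2))"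
  define z' where "z' = u * Complex w (- sqrt (1 - w\<^sup>2))"
  have w2: "w\<^sup>2 \<le> 1" using w by (simp add: abs_le_square_iff flip: abs_square_le_1)
  have one: "cmod (Complex w (sqrt (1 - w\<^sup>2))) = 1" "cmod (Complex w (- sqrt (1 - w\<^sup>2))) = 1"
    using w2 by (simp_all add: cmod_def)
  have nz: "cmod z = 1" "cmod z' = 1" by (simp_all add: z_def z'_def norm_mult one uc(1))
  have "Complex w (sqrt (1 - w\<^sup>2)) * Complex w (- sqrt (1 - w\<^sup>2)) = 1"
    using w2 by (simp add: complex_eq_iff power2_eq_square)
  then have zz: "z * z' = u\<^sup>2" unfolding z_def z'_def by (simp add: power2_eq_square mult_ac)
  have zs: "z + z' = 2 * of_real w * u"
    unfolding z_def z'_def by (simp add: complex_eq_iff algebra_simps)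
  let ?I = "{..<d} - {s}"
  define J where "J = {..<d} - {s} - {t}"
  have J: "finite J" "s \<notin> J" "t \<notin> J" by (auto simp: J_def)
  have z_chord: "cmod (z - a m) * cmod (z' - a m) = 2 * \<bar>w - u \<bullet> a m\<bar>" for m
    by (rule norm_mult_chords[OF uc(1) a(2) zz zs])
  have a_chord: "cmod (a s - a m) * cmod (a t - a m) = 2 * \<bar>u \<bullet> (a s - a m)\<bar>" for m
    using norm_mult_chords[OF uc(1) a(2) uc(2,4)] by (simp add: inner_diff_right)
  define Z where "Z = (\<Prod>m\<in>J. (cmod (z - a m) * cmod (z' - a m)) / (cmod (a s - a m) * cmod (a t - a m)))"
  define A A' B B' where "A = cmod (z - a s)" "A' = cmod (z' - a s)" "B = cmod (z - a t)" "B' = cmod (z' - a t)"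
  note defs = A_A'_B_B'_def
  \<comment> \<open>Both products are twice the distance from \<open>w\<close> to the common
    projection of the two nodes.\<close>
  have AB: "A * A' = B * B'" using z_chord[of s] z_chord[of t] uc(3) by (simp add: defs)
  have Z0: "0 \<le> Z" unfolding Z_def by (intro prod_nonneg) auto
  have It: "?I = insert t J" using st by (auto simp: J_def)
  have Is: "{..<d} - {t} = insert s J" using st by (auto simp: J_def)
  have ls: "cmod (lagrange d a s v) = cmod (v - a t) / r * (\<Prod>m\<in>J. cmod (v - a m) / cmod (a s - a m))" for v
    unfolding lagrange_def It using J by (simp add: norm_mult norm_divide r_def flip: prod_norm)
  have lt: "cmod (lagrange d a t v) = cmod (v - a s) / r * (\<Prod>m\<in>J. cmod (v - a m) / cmod (a t - a m))" for v
    unfolding lagrange_def Is using J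
    by (simp add: norm_mult norm_divide r_def norm_minus_commute[of "a t" "a s"] flip: prod_norm)
  have Z1: "Z = (\<Prod>m\<in>J. cmod (z - a m) / cmod (a s - a m)) * (\<Prod>m\<in>J. cmod (z' - a m) / cmod (a t - a m))"
    and Z2: "Z = (\<Prod>m\<in>J. cmod (z' - a m) / cmod (a s - a m)) * (\<Prod>m\<in>J. cmod (z - a m) / cmod (a t - a m))"
    unfolding Z_def prod.distrib[symmetric] by (simp_all add: mult.commute)
  have "B * A' * Z = r\<^sup>2 * (cmod (lagrange d a s z) * cmod (lagrange d a t z'))"
    unfolding ls lt Z1 using r by (simp add: defs power2_eq_square field_simps)
  also have "\<dots> \<le> r\<^sup>2 * (M * M)"
    using M[OF st(1)] M[OF st(2)] nz order_trans[OF norm_ge_zero M[OF st(1), of 0]]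
    by (intro mult_left_mono mult_mono) auto
  finally have 1: "B * A' * Z \<le> (r * M)\<^sup>2" by (simp add: power2_eq_square mult_ac)
  have "B' * A * Z = r\<^sup>2 * (cmod (lagrange d a s z') * cmod (lagrange d a t z))"
    unfolding ls lt Z2 using r by (simp add: defs power2_eq_square field_simps)
  also have "\<dots> \<le> r\<^sup>2 * (M * M)"
    using M[OF st(1)] M[OF st(2)] nz order_trans[OF norm_ge_zero M[OF st(1), of 0]]
    by (intro mult_left_mono mult_mono) auto
  finally have 2: "B' * A * Z \<le> (r * M)\<^sup>2" by (simp add: power2_eq_square mult_ac)
  have "(B * B' * Z)\<^sup>2 = (B * B' * Z) * (A * A' * Z)" using AB by (simp add: power2_eq_square)
  also have "\<dots> = (B * A' * Z) * (B' * A * Z)" by (simp add: mult_ac)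
  also have "\<dots> \<le> (r * M)\<^sup>2 * (r * M)\<^sup>2"
    using 1 2 Z0 by (intro mult_mono) (auto simp: defs)
  finally have "(B * B' * Z)\<^sup>2 \<le> ((r * M)\<^sup>2)\<^sup>2" by (simp add: power2_eq_square)
  then have "B * B' * Z \<le> (r * M)\<^sup>2" by (rule power2_le_imp_le) simp
  \<comment> \<open>A chord has length at most 2; the final constant is half of 4 because
    \<open>B * B'\<close> is twice the factor of node \<open>t\<close>.\<close>
  also have "\<dots> \<le> (2 * M)\<^sup>2"
    unfolding power_mult_distrib using r by (intro mult_right_mono power_mono) auto
  finally have BZ: "B * B' * Z \<le> 4 * M\<^sup>2" by (simp add: power_mult_distrib)
  have "cmod (poly (kergin_PP_poly d a s t u) (of_real w)) =
    (\<Prod>m\<in>?I. \<bar>w - u \<bullet> a m\<bar>) / (\<Prod>m\<in>J. \<bar>u \<bullet> (a s - a m)\<bar>)"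
    unfolding poly_kergin_PP_poly norm_of_real J_def by (simp add: abs_prod)
  also have "\<dots> = \<bar>w - u \<bullet> a t\<bar> * (\<Prod>m\<in>J. \<bar>w - u \<bullet> a m\<bar> / \<bar>u \<bullet> (a s - a m)\<bar>)"
    unfolding It using J by (simp add: prod_dividef)
  also have "(\<Prod>m\<in>J. \<bar>w - u \<bullet> a m\<bar> / \<bar>u \<bullet> (a s - a m)\<bar>) = Z"
    unfolding Z_def z_chord a_chord by simp
  also have "\<bar>w - u \<bullet> a t\<bar> = B * B' / 2" using z_chord[of t] by (simp add: defs)
  finally show ?thesis using BZ by simp
qed

text \<open>The bound for a pair is stated after multiplication by the distance of its nodes, which
  removes the factor \<open>1 / r\<close>; the segment functional later supplies this
  distance.\<close>

lemma kergin_multi_deriv_bound: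
  fixes m n :: nat
  assumes a: "inj a" "\<And>m. cmod (a m) = 1"
    and M: "\<And>j z. j < d \<Longrightarrow> cmod z \<le> 1 \<Longrightarrow> cmod (lagrange d a j z) \<le> M"
    and x: "cmod x \<le> 1"
  defines "c \<equiv> (12 * (real d + 1)\<^sup>2) ^ (m + n)"
  shows "j < d \<Longrightarrow> \<bar>multi_deriv (m, n) (kergin_P d a j) x\<bar> \<le> c * M"
    and "s < d \<Longrightarrow> t < d \<Longrightarrow> s \<noteq> t \<Longrightarrow> \<bar>multi_deriv (m, n) (kergin_PP d a s t) x\<bar> * cmod (a s - a t) \<le> c * (2 * M\<^sup>2)"
proof -
  assume j: "j < d"
  have "x = 1 * of_real (Re x) + \<i> * of_real (Im x)" by (simp add: complex_eq_iff)
  then have "cmod (poly ((pderiv ^^ (m + n)) (kergin_P_poly d a j)) (1 * of_real (Re x) + \<i> * of_real (Im x))) \<le> c * M"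
    unfolding c_def using x M[OF j]
    by (intro markov_disc_iterated degree_kergin_P_poly) (auto simp: poly_kergin_P_poly)
  then show "\<bar>multi_deriv (m, n) (kergin_P d a j) x\<bar> \<le> c * M"
    unfolding kergin_P_ridge by (intro multi_deriv_ridge_le) auto
next
  assume st: "s < d" "t < d" "s \<noteq> t"
  define r where "r = cmod (a s - a t)"
  define u where "u = perp (a s - a t) / of_real (cmod (a s - a t))"
  have Re_mult: "Re (of_real q * w) = q * Re w" for q w by simp
  have "a s \<noteq> a t" using st a(1) by (auto simp: inj_def)
  then have r: "r > 0" by (simp add: r_def)
  note uc = unit_chord[OF a(2) a(2) \<open>a s \<noteq> a t\<close>, folded u_def]
  let ?R = "ridge (kergin_PP_poly d a s t u) (of_real (Re u)) (of_real (Im u))"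
  have eq: "kergin_PP d a s t = ridge (smult (of_real (inverse r)) (kergin_PP_poly d a s t u)) (of_real (Re u)) (of_real (Im u))"
    unfolding kergin_PP_ridge[OF st \<open>a s \<noteq> a t\<close>, folded u_def] r_def[symmetric]
    by (simp add: ridge_def[abs_def] Re_mult del: of_real_inverse)
  have "(pderiv ^^ k) (smult q p) = smult q ((pderiv ^^ k) p)" for q :: complex and p k
    by (induction k) (simp_all add: pderiv_smult)
  then have "multi_deriv (m, n) (kergin_PP d a s t) x = inverse r * multi_deriv (m, n) ?R x"
    unfolding eq multi_deriv_ridge by (simp add: ridge_def[abs_def] Re_mult mult.left_commute[of _ "of_real (inverse r)"] del: of_real_inverse)
  moreover have "\<bar>multi_deriv (m, n) ?R x\<bar> \<le> c * (2 * M\<^sup>2)"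
  proof (rule multi_deriv_ridge_le)
    have "complex_of_real (Re u) * of_real (Re x) + of_real (Im u) * of_real (Im x) = of_real (u \<bullet> x)"
      by (simp add: inner_complex_def)
    moreover have "\<bar>u \<bullet> x\<bar> \<le> 1"
      using Cauchy_Schwarz_ineq2[of u x] uc(1) x by simp
    ultimately show "cmod (poly ((pderiv ^^ (m + n)) (kergin_PP_poly d a s t u))
        (of_real (Re u) * of_real (Re x) + of_real (Im u) * of_real (Im x))) \<le> c * (2 * M\<^sup>2)"
      unfolding c_def using kergin_PP_poly_bound[OF a st M, folded u_def]
      by (simp only:) (intro markov_interval_iterated degree_kergin_PP_poly, auto)
  qed (use abs_Re_le_cmod[of u] abs_Im_le_cmod[of u] uc(1) in auto)
  ultimately show "\<bar>multi_deriv (m, n) (kergin_PP d a s t) x\<bar> * cmod (a s - a t) \<le> c * (2 * M\<^sup>2)"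
    using r by (simp add: abs_mult r_def[symmetric] field_simps)
qed

section \<open>Jackson approximation\<close>

text \<open>The Dirichlet kernel \<open>sin ((2 n + 1) \<phi>) / sin \<phi>\<close> as a polynomial
  in \<open>s = sin \<phi>\<close>; the multiplier \<open>2 - 4 s^2\<close> is
  \<open>2 cos (2 \<phi>)\<close>.\<close>

fun dirichlet_poly :: "nat \<Rightarrow> real poly" where
  "dirichlet_poly 0 = 1"
| "dirichlet_poly (Suc 0) = [:3, 0, -4:]"
| "dirichlet_poly (Suc (Suc n)) = [:2, 0, -4:] * dirichlet_poly (Suc n) - dirichlet_poly n"

lemma degree_dirichlet_poly: "degree (dirichlet_poly n) \<le> 2 * n"
proof (induction n rule: dirichlet_poly.induct)
  case (3 n)
  have "degree ([:2, 0, -4::real:] * dirichlet_poly (Suc n)) \<le> 2 + 2 * Suc n"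
    by (intro order_trans[OF degree_mult_le] add_mono 3) simp
  then show ?case using 3 by (simp only: dirichlet_poly.simps) (intro degree_diff_le, auto)
qed simp_all

lemma dirichlet_poly_sin: "poly (dirichlet_poly n) (sin \<phi>) * sin \<phi> = sin ((2 * real n + 1) * \<phi>)"
proof (induction n rule: dirichlet_poly.induct)
  case 2
  have "sin (3 * \<phi>) = sin (2 * \<phi> + \<phi>)" by (simp add: algebra_simps)
  also have "\<dots> = 2 * sin \<phi> * (cos \<phi>)\<^sup>2 + (1 - 2 * (sin \<phi>)\<^sup>2) * sin \<phi>"
    unfolding sin_add sin_double cos_double_sin by (simp add: power2_eq_square)
  also have "\<dots> = 2 * sin \<phi> * (1 - (sin \<phi>)\<^sup>2) + (1 - 2 * (sin \<phi>)\<^sup>2) * sin \<phi>"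
    by (simp only: cos_squared_eq)
  finally show ?case by (simp add: algebra_simps power2_eq_square)
next
  case (3 n)
  define \<psi> where "\<psi> = (2 * real n + 3) * \<phi>"
  have "sin (\<psi> + 2 * \<phi>) + sin (\<psi> - 2 * \<phi>) = 2 * sin \<psi> * cos (2 * \<phi>)"
    by (simp add: sin_add sin_diff)
  then have *: "sin (\<psi> + 2 * \<phi>) = 2 * sin \<psi> * (1 - 2 * (sin \<phi>)\<^sup>2) - sin (\<psi> - 2 * \<phi>)"
    by (simp only: cos_double_sin)
  have "poly (dirichlet_poly (Suc n)) (sin \<phi>) * sin \<phi> = sin \<psi>" "poly (dirichlet_poly n) (sin \<phi>) * sin \<phi> = sin (\<psi> - 2 * \<phi>)"
    using 3 by (simp_all add: \<psi>_def algebra_simps)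
  moreover have "(2 * real (Suc (Suc n)) + 1) * \<phi> = \<psi> + 2 * \<phi>" by (simp add: \<psi>_def algebra_simps)
  moreover have "poly (dirichlet_poly (Suc (Suc n))) (sin \<phi>) * sin \<phi> =
      2 * (poly (dirichlet_poly (Suc n)) (sin \<phi>) * sin \<phi>) * (1 - 2 * (sin \<phi>)\<^sup>2) - poly (dirichlet_poly n) (sin \<phi>) * sin \<phi>"
    by (simp add: algebra_simps power2_eq_square)
  ultimately show ?case by (simp only: *)
qed simp

lemma abs_sin_mult_le: "\<bar>sin (real n * x)\<bar> \<le> real n * \<bar>sin x\<bar>"
proof (induction n)
  case (Suc n)
  have "\<bar>sin (real (Suc n) * x)\<bar> = \<bar>sin (real n * x) * cos x + cos (real n * x) * sin x\<bar>"
    by (simp add: sin_add algebra_simps)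
  also have "\<dots> \<le> \<bar>sin (real n * x)\<bar> * \<bar>cos x\<bar> + \<bar>cos (real n * x)\<bar> * \<bar>sin x\<bar>"
    by (simp add: abs_mult[symmetric])
  also have "\<dots> \<le> \<bar>sin (real n * x)\<bar> * 1 + 1 * \<bar>sin x\<bar>"
    by (intro add_mono mult_left_mono mult_right_mono) auto
  finally show ?case using Suc by (simp add: algebra_simps)
qed simp

lemma dirichlet_poly_upper:
  assumes "\<bar>s\<bar> \<le> 1"
  shows "\<bar>poly (dirichlet_poly n) s\<bar> \<le> 2 * real n + 1" "\<bar>poly (dirichlet_poly n) s\<bar> * \<bar>s\<bar> \<le> 1"
proof -
  define \<phi> where "\<phi> = arcsin s"
  have s: "s = sin \<phi>" using assms by (simp add: \<phi>_def)
  have eq: "\<bar>poly (dirichlet_poly n) s\<bar> * \<bar>s\<bar> = \<bar>sin (real (2 * n + 1) * \<phi>)\<bar>"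
    unfolding s abs_mult[symmetric] dirichlet_poly_sin by (simp add: add.commute)
  then show "\<bar>poly (dirichlet_poly n) s\<bar> * \<bar>s\<bar> \<le> 1" by simp
  show "\<bar>poly (dirichlet_poly n) s\<bar> \<le> 2 * real n + 1"
  proof (cases "s = 0")
    case True
    \<comment> \<open>At \<open>s = 0\<close> the sine identity carries no information, so the value
      is taken from the recursion.\<close>
    have "poly (dirichlet_poly n) 0 = 2 * real n + 1"
      by (induction n rule: dirichlet_poly.induct) (simp_all add: algebra_simps)
    then show ?thesis using True by simp
  next
    case False
    have "\<bar>poly (dirichlet_poly n) s\<bar> * \<bar>s\<bar> \<le> (2 * real n + 1) * \<bar>s\<bar>"
      unfolding eq using abs_sin_mult_le[of "2 * n + 1" \<phi>] by (simp add: s add.commute)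
    then show ?thesis using False by simp
  qed
qed

lemma sin_ge_half:
  assumes "0 \<le> x" "x \<le> 1"
  shows "x / 2 \<le> sin (x::real)"
proof -
  have "(\<lambda>x. sin x - x / 2) 0 \<le> (\<lambda>x. sin x - x / 2) x"
  proof (rule DERIV_nonneg_imp_nondecreasing[OF assms(1)])
    fix t assume t: "0 \<le> t" "t \<le> x"
    have "cos (pi / 3) \<le> cos t"
      using t assms pi_gt3 by (intro cos_monotone_0_pi_le) auto
    then show "\<exists>y. ((\<lambda>x. sin x - x / 2) has_real_derivative y) (at t) \<and> 0 \<le> y"
      by (intro exI[of _ "cos t - 1 / 2"]) (auto intro!: derivative_eq_intros simp: cos_60)
  qed
  then show ?thesis by simp
qed

text \<open>With \<open>s = sin \<phi>\<close> the hypothesis gives \<open>m \<phi> \<le> 1\<close>,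
  where the sine is at least half its argument. This is what bounds the mass of the kernel from
  below.\<close>

lemma dirichlet_poly_lower:
  assumes s: "\<bar>s\<bar> * (2 * (2 * real n + 1)) \<le> 1"
  shows "(2 * real n + 1) / 2 \<le> \<bar>poly (dirichlet_poly n) s\<bar>"
proof (cases "s = 0")
  case True
  have "poly (dirichlet_poly n) 0 = 2 * real n + 1"
    by (induction n rule: dirichlet_poly.induct) (simp_all add: algebra_simps)
  then show ?thesis using True by simp
next
  case False
  define m where "m = 2 * real n + 1"
  have m: "m \<ge> 1" by (simp add: m_def)
  have "\<bar>s\<bar> * 2 \<le> \<bar>s\<bar> * (2 * m)" using m by (intro mult_left_mono) auto
  then have s1: "\<bar>s\<bar> \<le> 1 / 2" using s by (simp add: m_def)
  define \<phi> where "\<phi> = arcsin \<bar>s\<bar>"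
  have sphi: "\<bar>s\<bar> = sin \<phi>" using s1 by (simp add: \<phi>_def)
  have "arcsin \<bar>s\<bar> \<le> arcsin (1 / 2)" using s1 by (intro arcsin_le_arcsin) auto
  also have "arcsin (1 / 2) = pi / 6"
    using arcsin_sin[of "pi / 6"] by (simp add: sin_30)
  finally have "\<phi> \<le> pi / 6" by (simp add: \<phi>_def)
  moreover have "0 \<le> \<phi>" using arcsin_le_arcsin[of 0 "\<bar>s\<bar>"] s1 by (simp add: \<phi>_def)
  ultimately have phi: "0 \<le> \<phi>" "\<phi> \<le> 1" using pi_less_4 by auto
  have "\<phi> * m \<le> 2 * \<bar>s\<bar> * m" using sin_ge_half[OF phi] m sphi by (intro mult_right_mono) auto
  also have "\<dots> \<le> 1" using s by (simp add: m_def mult_ac)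
  finally have phi1: "m * \<phi> \<le> 1" by (simp add: mult.commute)
  have e: "poly (dirichlet_poly n) \<bar>s\<bar> * \<bar>s\<bar> = sin (m * \<phi>)"
    using dirichlet_poly_sin[of n \<phi>] sphi by (simp add: m_def)
  have "\<bar>poly (dirichlet_poly n) \<bar>s\<bar>\<bar> * \<bar>s\<bar> = \<bar>sin (m * \<phi>)\<bar>"
    unfolding e[symmetric] abs_mult by simp
  moreover have "m * \<phi> / 2 \<le> sin (m * \<phi>)" using phi m phi1 by (intro sin_ge_half) auto
  moreover have "m / 2 * \<bar>s\<bar> \<le> m * \<phi> / 2" using m phi sin_x_le_x[of \<phi>] sphi by (simp add: mult_left_mono)
  ultimately have "m / 2 * \<bar>s\<bar> \<le> \<bar>poly (dirichlet_poly n) \<bar>s\<bar>\<bar> * \<bar>s\<bar>" by linarith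
  then have "m / 2 \<le> \<bar>poly (dirichlet_poly n) \<bar>s\<bar>\<bar>" using False by simp
  moreover have "poly (dirichlet_poly n) (- x) = poly (dirichlet_poly n) x" for x
    by (induction n rule: dirichlet_poly.induct) simp_all
  then have "poly (dirichlet_poly n) \<bar>s\<bar> = poly (dirichlet_poly n) s" by (cases "s \<ge> 0") (auto simp: abs_if)
  ultimately show ?thesis by (simp add: m_def)
qed

text \<open>An algebraic analogue of Jackson's kernel: with \<open>m = 2 n + 1\<close>, the normalised power
  \<open>(sin (m \<phi>) / sin \<phi>)\<^sup>2\<^sup>r\<^sup>+\<^sup>2\<close> as a polynomial in \<open>t = 2 a sin \<phi>\<close>.\<close>

lemma jackson_kernel:
  fixes a :: real and r :: nat
  assumes a: "a > 0"
  obtains C where "C \<ge> 0" "\<And>n. \<exists>K::real poly. degree K \<le> 4 * n * (r + 1) \<and> (\<forall>t. 0 \<le> poly K t) \<and>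
    integral {-a..a} (poly K) = 1 \<and>
    integral {-a..a} (\<lambda>t. \<bar>t\<bar> ^ r * poly K t) \<le> C / (real n + 1) ^ r"
proof -
  \<comment> \<open>\<open>C / m^r\<close> is the quotient of the bounds \<open>upper\<close> and
    \<open>lower\<close> below, and \<open>m \<ge> n + 1\<close>.\<close>
  define C where "C = a ^ r * pi * 4 ^ (2 * r + 2)"
  have "\<exists>K::real poly. degree K \<le> 4 * n * (r + 1) \<and> (\<forall>t. 0 \<le> poly K t) \<and>
    integral {-a..a} (poly K) = 1 \<and>
    integral {-a..a} (\<lambda>t. \<bar>t\<bar> ^ r * poly K t) \<le> C / (real n + 1) ^ r" for n
  proof -
    define m where "m = 2 * real n + 1"
    have m: "m \<ge> 1" "m > 0" by (simp_all add: m_def)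
    \<comment> \<open>The scale \<open>2 * a\<close> makes \<open>dirichlet_poly_lower\<close> apply
      on all of \<open>|t| \<le> a / m\<close>.\<close>
    define P where "P = pcompose (dirichlet_poly n) [:0, 1 / (2 * a):]"
    define Q where "Q = P ^ (2 * r + 2)"
    have P: "poly P t = poly (dirichlet_poly n) (t / (2 * a))" for t
      by (simp add: P_def poly_pcompose)
    have Q: "poly Q t = \<bar>poly P t\<bar> ^ (2 * r + 2)" for t
      unfolding Q_def poly_power by (rule power_even_abs[symmetric]) simp
    have int: "f integrable_on {-a..a}" if "continuous_on {-a..a} f" for f :: "real \<Rightarrow> real"
      using that by (rule integrable_continuous_real)
    have "degree P \<le> 2 * n" unfolding P_def
      using degree_pcompose_le[of "dirichlet_poly n" "[:0, 1 / (2 * a):]"] degree_dirichlet_poly[of n]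
      by (auto split: if_splits)
    then have "degree P * (2 * r + 2) \<le> 2 * n * (2 * r + 2)" by (rule mult_le_mono1)
    then have deg: "degree Q \<le> 4 * n * (r + 1)"
      unfolding Q_def using degree_power_le[of P "2 * r + 2"] by (simp add: algebra_simps)
    define I where "I = integral {-a..a} (poly Q)"
    have lower: "(2 * (a / m)) * (m / 2) ^ (2 * r + 2) \<le> I"
    proof -
      have "(2 * (a / m)) * (m / 2) ^ (2 * r + 2) = integral {-(a / m)..a / m} (\<lambda>t. (m / 2) ^ (2 * r + 2))"
        using a m by simp
      also have "\<dots> \<le> integral {-(a / m)..a / m} (poly Q)"
      proof (rule integral_le)
        fix t assume "t \<in> {-(a / m)..a / m}"
        then have "\<bar>t\<bar> * m \<le> a" using m by (auto simp: field_simps abs_le_iff)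
        then have "\<bar>t / (2 * a)\<bar> * (2 * m) \<le> 1" using a by (simp add: field_simps abs_mult)
        then have "m / 2 \<le> \<bar>poly P t\<bar>" unfolding P m_def by (rule dirichlet_poly_lower)
        then show "(m / 2) ^ (2 * r + 2) \<le> poly Q t" unfolding Q using m by (intro power_mono) auto
      qed (auto intro!: integrable_continuous_real continuous_intros)
      also have "\<dots> \<le> I" unfolding I_def
        using a m by (intro integral_subset_le integrable_continuous_real continuous_intros)
          (auto simp: Q field_simps mult_left_mono)
      finally show ?thesis .
    qed
    have "0 < (2 * (a / m)) * (m / 2) ^ (2 * r + 2)" using a m by simp
    with lower have I: "I > 0" by linarith
    have upper: "integral {-a..a} (\<lambda>t. \<bar>t\<bar> ^ r * poly Q t) \<le>
        (a / m) ^ r * m ^ (2 * r + 2) * (2 * 4 ^ (r + 1)) * (pi * (a / m))"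
    proof -
      define c where "c = (a / m) ^ r * m ^ (2 * r + 2) * (2 * 4 ^ (r + 1))"
      have c: "c \<ge> 0" using a m by (simp add: c_def)
      \<comment> \<open>The majorant is chosen to have an arctangent as primitive, so the weighted
        moment is bounded by an explicit integral.\<close>
      have pw: "\<bar>t\<bar> ^ r * poly Q t \<le> c * (1 / (1 + (m * t / a)\<^sup>2))" if t: "t \<in> {-a..a}" for t
      proof -
        define x where "x = m * \<bar>t\<bar> / a"
        have x: "x \<ge> 0" "\<bar>t\<bar> = a / m * x" "x\<^sup>2 = (m * t / a)\<^sup>2" using a m by (simp_all add: x_def power_divide power_mult_distrib)
        have s1: "\<bar>t / (2 * a)\<bar> \<le> 1" using t a by (auto simp: abs_le_iff field_simps)
        have 1: "\<bar>poly P t\<bar> \<le> m" unfolding P m_def by (rule dirichlet_poly_upper(1)[OF s1])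
        have "\<bar>poly P t\<bar> * \<bar>t / (2 * a)\<bar> \<le> 1" unfolding P by (rule dirichlet_poly_upper(2)[OF s1])
        then have 2: "\<bar>poly P t\<bar> * x \<le> 2 * m" using a m by (simp add: x_def field_simps abs_mult)
        have "x ^ r * \<bar>poly P t\<bar> ^ (2 * r + 2) \<le> m ^ (2 * r + 2) * (2 * 4 ^ (r + 1) / (1 + x\<^sup>2))"
        \<comment> \<open>The bound \<open>m\<close> on the kernel serves near 0. Away from 0 its
          decay \<open>2 * m / x\<close> is used; the exponent \<open>2 * r + 2\<close> absorbs the
          moment \<open>x^r\<close> and still leaves at least \<open>x^2\<close> for
          integrability.\<close>
        proof (cases "x \<le> 1")
          case True
          have "x ^ r * \<bar>poly P t\<bar> ^ (2 * r + 2) \<le> 1 * m ^ (2 * r + 2)"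
            using 1 x True by (intro mult_mono power_mono power_le_one) auto
          also have "\<dots> \<le> m ^ (2 * r + 2) * (2 * 4 ^ (r + 1) / (1 + x\<^sup>2))"
          proof -
            have "x\<^sup>2 \<le> 1" using x(1) True by (simp add: power_le_one)
            moreover have "(1::real) \<le> 4 ^ (r + 1)" by (rule one_le_power) simp
            ultimately have "1 + x\<^sup>2 \<le> 2 * 4 ^ (r + 1)" by linarith
            then have "1 \<le> 2 * 4 ^ (r + 1) / (1 + x\<^sup>2)"
              using le_divide_eq_1_pos[of "1 + x\<^sup>2"] zero_le_power2[of x] by (smt (verit))
            then have "m ^ (2 * r + 2) * 1 \<le> m ^ (2 * r + 2) * (2 * 4 ^ (r + 1) / (1 + x\<^sup>2))"
              using m by (intro mult_left_mono) auto
            then show ?thesis by (simp only: mult_1_left mult_1_right)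
          qed
          finally show ?thesis .
        next
          case False
          then have x1: "x > 1" by simp
          have "x ^ (r + 2) * (x ^ r * \<bar>poly P t\<bar> ^ (2 * r + 2)) = (\<bar>poly P t\<bar> * x) ^ (2 * r + 2)"
          proof -
            have "x ^ (r + 2) * (x ^ r * \<bar>poly P t\<bar> ^ (2 * r + 2)) = x ^ ((r + 2) + r) * \<bar>poly P t\<bar> ^ (2 * r + 2)"
              by (simp only: power_add mult.assoc)
            moreover have "(r + 2) + r = 2 * r + 2" by simp
            ultimately show ?thesis by (simp only: power_mult_distrib mult.commute)
          qed
          also have "\<dots> \<le> (2 * m) ^ (2 * r + 2)" using 2 x by (intro power_mono) auto
          also have "\<dots> = m ^ (2 * r + 2) * 4 ^ (r + 1)"
            using power_mult[of "2::real" 2 "r + 1"] by (simp add: power_mult_distrib)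
          finally have A: "x ^ (r + 2) * (x ^ r * \<bar>poly P t\<bar> ^ (2 * r + 2)) \<le> m ^ (2 * r + 2) * 4 ^ (r + 1)" .
          have "1 + x\<^sup>2 \<le> 2 * x\<^sup>2" using x1 one_le_power[of x 2] by simp
          also have "\<dots> \<le> 2 * x ^ (r + 2)" using x1 by (intro mult_left_mono power_increasing) auto
          finally have "(1 + x\<^sup>2) * (x ^ r * \<bar>poly P t\<bar> ^ (2 * r + 2)) \<le> (2 * x ^ (r + 2)) * (x ^ r * \<bar>poly P t\<bar> ^ (2 * r + 2))"
            using x by (intro mult_right_mono) auto
          also have "\<dots> \<le> m ^ (2 * r + 2) * (2 * 4 ^ (r + 1))"
          proof -
            have "2 * (x ^ (r + 2) * (x ^ r * \<bar>poly P t\<bar> ^ (2 * r + 2))) \<le> 2 * (m ^ (2 * r + 2) * 4 ^ (r + 1))"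
              using A by (intro mult_left_mono) auto
            then show ?thesis by (simp only: mult_ac)
          qed
          finally have "(x ^ r * \<bar>poly P t\<bar> ^ (2 * r + 2)) * (1 + x\<^sup>2) \<le> m ^ (2 * r + 2) * (2 * 4 ^ (r + 1))"
            by (simp only: mult.commute)
          moreover have "1 + x\<^sup>2 > 0" by (simp add: add_pos_nonneg)
          ultimately show ?thesis by (simp only: times_divide_eq_right pos_le_divide_eq)
        qed
        then have "(a / m) ^ r * (x ^ r * \<bar>poly P t\<bar> ^ (2 * r + 2)) \<le> (a / m) ^ r * (m ^ (2 * r + 2) * (2 * 4 ^ (r + 1) / (1 + x\<^sup>2)))"
          using a m by (intro mult_left_mono) auto
        then show ?thesis unfolding Q c_def x(3)[symmetric] x(2) power_mult_distrib
          by (simp only: mult_1_right times_divide_eq_right mult.assoc)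
      qed
      have "((\<lambda>t. c * (1 / (1 + (m * t / a)\<^sup>2))) has_integral
         c * (a / m) * arctan (m * a / a) - c * (a / m) * arctan (m * (- a) / a)) {-a..a}"
        using a m by (intro fundamental_theorem_of_calculus)
          (auto intro!: derivative_eq_intros simp: has_real_derivative_iff_has_vector_derivative[symmetric] divide_simps)
      then have "integral {-a..a} (\<lambda>t. c * (1 / (1 + (m * t / a)\<^sup>2))) = c * (a / m) * (2 * arctan m)"
        using a by (subst integral_unique) (auto simp: arctan_minus mult_ac)
      also have "\<dots> \<le> c * (a / m) * pi"
        using c a m arctan_ubound[of m] by (intro mult_left_mono) auto
      finally have "integral {-a..a} (\<lambda>t. c * (1 / (1 + (m * t / a)\<^sup>2))) \<le> c * (pi * (a / m))" by (simp add: mult_ac)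
      moreover have "integral {-a..a} (\<lambda>t. \<bar>t\<bar> ^ r * poly Q t) \<le> integral {-a..a} (\<lambda>t. c * (1 / (1 + (m * t / a)\<^sup>2)))"
        by (intro integral_le pw int continuous_intros) (use a in \<open>auto simp: add_nonneg_eq_0_iff\<close>)
      ultimately show ?thesis unfolding c_def by linarith
    qed
    define K where "K = smult (1 / I) Q"
    have "integral {-a..a} (\<lambda>t. \<bar>t\<bar> ^ r * poly K t) = integral {-a..a} (\<lambda>t. \<bar>t\<bar> ^ r * poly Q t) / I"
      by (simp add: K_def mult.left_commute flip: integral_divide)
    also have "\<dots> \<le> ((a / m) ^ r * m ^ (2 * r + 2) * (2 * 4 ^ (r + 1)) * (pi * (a / m))) / ((2 * (a / m)) * (m / 2) ^ (2 * r + 2))"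
      using upper lower I a m by (intro frac_le) auto
    also have "\<dots> = C / m ^ r"
    proof -
      have "(2::real) ^ (2 * r + 2) = 4 ^ (r + 1)" using power_mult[of "2::real" 2 "r + 1"] by simp
      moreover have "(16::real) ^ r = 4 ^ r * 4 ^ r" by (simp flip: power_mult_distrib)
      ultimately show ?thesis using a m by (simp add: C_def power_divide divide_simps power_add power_mult power2_eq_square)
    qed
    also have "\<dots> \<le> C / (real n + 1) ^ r"
      using a by (intro divide_left_mono power_mono mult_pos_pos) (auto simp: m_def C_def)
    finally have "integral {-a..a} (\<lambda>t. \<bar>t\<bar> ^ r * poly K t) \<le> C / (real n + 1) ^ r" .
    moreover have "integral {-a..a} (poly K) = 1"
    proof -
      have "poly K = (\<lambda>t. poly Q t / I)" by (simp add: K_def fun_eq_iff)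
      then show ?thesis using I by (simp add: I_def)
    qed
    moreover have "0 \<le> poly K t" for t using I by (simp add: K_def Q)
    moreover have "degree K \<le> 4 * n * (r + 1)" using deg degree_smult_le[of "1 / I" Q] by (simp add: K_def)
    ultimately show ?thesis by blast
  qed
  moreover have "C \<ge> 0" using a by (simp add: C_def)
  ultimately show ?thesis using that by blast
qed

lemma has_derivative_dir_deriv:
  assumes "f differentiable at x"
  shows "(f has_derivative (\<lambda>h. dir_deriv h f x)) (at x)"
proof -
  obtain f' where f': "(f has_derivative f') (at x)" using assms unfolding differentiable_def by blast
  then show ?thesis using dir_deriv_eq[OF f'] by simp
qed

section \<open>Convolution with a kernel along a direction\<close>

definition kernel_avg :: "(real \<Rightarrow> real) \<Rightarrow> real \<Rightarrow> complex \<Rightarrow> (complex \<Rightarrow> real) \<Rightarrow> complex \<Rightarrow> real" where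
  "kernel_avg k a v g x = integral {-a..a} (\<lambda>t. k t * g (x - t *\<^sub>R v))"

lemma continuous_on_comp_UNIV:
  assumes "continuous_on UNIV g" "continuous_on A f"
  shows "continuous_on A (\<lambda>x. g (f x))"
  by (rule continuous_on_compose2[OF assms]) simp

context
  fixes k :: "real \<Rightarrow> real" and a :: real
  assumes k: "continuous_on UNIV k"
begin

lemma kernel_integrable:
  fixes g :: "complex \<Rightarrow> real"
  assumes "continuous_on UNIV g"
  shows "(\<lambda>t. k t * g (x - t *\<^sub>R v)) integrable_on {-a..a}"
  by (intro integrable_continuous_real continuous_intros continuous_on_comp_UNIV[OF k] continuous_on_comp_UNIV[OF assms])

lemma kernel_avg_continuous:
  assumes "continuous_on UNIV g"
  shows "continuous_on UNIV (kernel_avg k a v g)"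
proof -
  have "continuous_on (UNIV \<times> cbox (-a) a) (\<lambda>(x, t). k t * g (x - t *\<^sub>R v))"
    unfolding split_beta
    by (intro continuous_intros continuous_on_comp_UNIV[OF k] continuous_on_comp_UNIV[OF assms])
  from integral_continuous_on_param[OF this] show ?thesis
    by (simp add: kernel_avg_def[abs_def])
qed

lemma kernel_avg_derivative:
  assumes g: "Ck_on 1 UNIV g"
  shows "kernel_avg k a v g differentiable at x"
    and "b \<in> Basis \<Longrightarrow> partial_deriv b (kernel_avg k a v g) x = kernel_avg k a v (partial_deriv b g) x"
proof -
  \<comment> \<open>The Frechet derivative of the integrand as a continuous family of bounded linear
    maps, the form needed for differentiation under the integral. The derivative falls on
    \<open>g\<close>, never on the kernel.\<close>
  define L where "L x t = k t *\<^sub>R (partial_deriv 1 g (x - t *\<^sub>R v) *\<^sub>R blinfun_inner_left 1 +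
      partial_deriv \<i> g (x - t *\<^sub>R v) *\<^sub>R blinfun_inner_left \<i>)" for x and t :: real
  have gd: "g differentiable at y" and gc: "continuous_on UNIV (partial_deriv 1 g)" "continuous_on UNIV (partial_deriv \<i> g)" for y
    using g by (auto simp: Basis_complex_def)
  have gc0: "continuous_on UNIV g" using g by (rule Ck_on_continuous)
  have L: "blinfun_apply (L x t) = (\<lambda>h. k t * dir_deriv h g (x - t *\<^sub>R v))" for x t
    by (auto simp: L_def fun_eq_iff blinfun.bilinear_simps dir_deriv_def Basis_complex_def)
  have cont: "continuous_on (UNIV \<times> cbox (-a) a) (\<lambda>(x, t). L x t)"
    unfolding split_beta L_def
    by (intro continuous_intros continuous_on_comp_UNIV[OF k] continuous_on_comp_UNIV[OF gc(1)] continuous_on_comp_UNIV[OF gc(2)])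
  have "((\<lambda>x. integral (cbox (-a) a) (\<lambda>t. k t * g (x - t *\<^sub>R v))) has_derivative
      blinfun_apply (integral (cbox (-a) a) (L x))) (at x within UNIV)"
  proof (rule leibniz_rule[OF _ _ cont])
    fix x t
    have "((\<lambda>x. x - t *\<^sub>R v) has_derivative (\<lambda>h. h)) (at x)" by (auto intro!: derivative_eq_intros)
    from has_derivative_compose[OF this has_derivative_dir_deriv[OF gd]]
    show "((\<lambda>x. k t * g (x - t *\<^sub>R v)) has_derivative blinfun_apply (L x t)) (at x within UNIV)"
      unfolding L by (auto intro!: derivative_eq_intros)
  next
    show "(\<lambda>t. k t * g (x - t *\<^sub>R v)) integrable_on cbox (-a) a" for x
      using kernel_integrable[OF gc0] by simp
  qed auto
  then have D: "(kernel_avg k a v g has_derivative blinfun_apply (integral {-a..a} (L x))) (at x)"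
    by (simp add: kernel_avg_def[abs_def])
  then show "kernel_avg k a v g differentiable at x" unfolding differentiable_def by blast
  have "continuous_on {-a..a} (L x)"
    unfolding L_def
    by (intro continuous_intros continuous_on_comp_UNIV[OF k] continuous_on_comp_UNIV[OF gc(1)] continuous_on_comp_UNIV[OF gc(2)])
  then have int: "L x integrable_on {-a..a}" by (rule integrable_continuous_real)
  have one: "dir_deriv b g y = partial_deriv b g y" if "b \<in> Basis" for b y
    using dir_deriv_eq[OF has_derivative_dir_deriv[OF gd]] partial_deriv_eq[OF has_derivative_dir_deriv[OF gd]] by simp
  show "partial_deriv b (kernel_avg k a v g) x = kernel_avg k a v (partial_deriv b g) x" if "b \<in> Basis"
    unfolding partial_deriv_eq[OF D] blinfun_apply_integral[OF int] L kernel_avg_def one[OF that] ..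
qed

lemma kernel_avg_Ck: "Ck_on m UNIV g \<Longrightarrow> Ck_on m UNIV (kernel_avg k a v g)"
proof (induction m arbitrary: g)
  case 0
  then show ?case by (simp add: kernel_avg_continuous)
next
  case (Suc m)
  have g1: "Ck_on 1 UNIV g" by (rule Ck_on_le[OF Suc.prems]) simp
  have "partial_deriv b (kernel_avg k a v g) = kernel_avg k a v (partial_deriv b g)" if "b \<in> Basis" for b
    using kernel_avg_derivative(2)[OF g1 that] by (simp add: fun_eq_iff)
  then show ?case using Suc kernel_avg_derivative(1)[OF g1] by simp
qed

lemma kernel_avg_diff:
  assumes "continuous_on UNIV g" "continuous_on UNIV h"
  shows "kernel_avg k a v (\<lambda>x. g x - h x) x = kernel_avg k a v g x - kernel_avg k a v h x"
  unfolding kernel_avg_def right_diff_distrib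
  by (rule Henstock_Kurzweil_Integration.integral_diff) (rule kernel_integrable[OF assms(1)], rule kernel_integrable[OF assms(2)])

lemma kernel_avg_bound:
  assumes "continuous_on UNIV g" "\<And>x. \<bar>g x\<bar> \<le> B" "\<And>t. 0 \<le> k t" "integral {-a..a} k = 1"
  shows "\<bar>kernel_avg k a v g x\<bar> \<le> B"
proof -
  have "norm (kernel_avg k a v g x) \<le> integral {-a..a} (\<lambda>t. B * k t)"
    unfolding kernel_avg_def
    using assms(2,3) continuous_on_subset[OF k subset_UNIV]
    by (intro integral_norm_bound_integral kernel_integrable[OF assms(1)] integrable_continuous_real continuous_intros)
      (auto simp: abs_mult mult.commute[of B] intro!: mult_left_mono)
  also have "\<dots> = B" using assms(4) by simp
  finally show ?thesis by simp
qed

end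

section \<open>Finite differences\<close>

primrec fdiff :: "complex \<Rightarrow> nat \<Rightarrow> (complex \<Rightarrow> real) \<Rightarrow> complex \<Rightarrow> real" where
  "fdiff v 0 g = g"
| "fdiff v (Suc r) g = fdiff v r (\<lambda>x. g x - g (x - v))"

lemma fdiff_sum:
  "fdiff v r g x = (\<Sum>j\<le>r. (-1) ^ j * real (r choose j) * g (x - real j *\<^sub>R v))"
proof (induction r arbitrary: g)
  case (Suc r)
  let ?c = "\<lambda>r j. (-1) ^ j * real (r choose j)" and ?g = "\<lambda>j. g (x - real j *\<^sub>R v)"
  have "(\<Sum>j\<le>r. ?c r j * ?g j) = (\<Sum>j\<le>Suc r. ?c r j * ?g j)" by simp
  also have "\<dots> = ?g 0 + (\<Sum>j\<le>r. - ((-1) ^ j * real (r choose Suc j) * ?g (Suc j)))"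
    by (subst sum.atMost_Suc_shift) simp
  finally have 1: "(\<Sum>j\<le>r. ?c r j * ?g j) = ?g 0 + (\<Sum>j\<le>r. - ((-1) ^ j * real (r choose Suc j) * ?g (Suc j)))" .
  have eq: "x - real j *\<^sub>R v - v = x - real (Suc j) *\<^sub>R v" for j by (simp add: algebra_simps)
  have "fdiff v (Suc r) g x = (\<Sum>j\<le>r. ?c r j * ?g j) - (\<Sum>j\<le>r. ?c r j * ?g (Suc j))"
    by (simp only: fdiff.simps Suc eq right_diff_distrib sum_subtractf)
  also have "\<dots> = (\<Sum>j\<le>Suc r. ?c (Suc r) j * ?g j)"
    unfolding 1 by (subst sum.atMost_Suc_shift)
      (simp add: sum_subtractf sum_negf sum.distrib algebra_simps)
  finally show ?case .
qed simp

lemma partial_deriv_shift: "partial_deriv b (\<lambda>x. g (x - v)) x = partial_deriv b g (x - v)"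
  unfolding partial_deriv_def by (simp add: algebra_simps)

lemma differentiable_shift:
  fixes g :: "complex \<Rightarrow> real"
  assumes "g differentiable at (x - v)"
  shows "(\<lambda>x. g (x - v)) differentiable at x"
proof -
  obtain g' where "(g has_derivative g') (at (x - v))" using assms unfolding differentiable_def by blast
  moreover have "((\<lambda>x. x - v) has_derivative (\<lambda>h. h)) (at x)" by (auto intro!: derivative_eq_intros)
  ultimately show ?thesis using has_derivative_compose unfolding differentiable_def by blast
qed

lemma Ck_on_shift: "Ck_on m UNIV g \<Longrightarrow> Ck_on m UNIV (\<lambda>x. g (x - v))"
proof (induction m arbitrary: g)
  case (Suc m)
  have "partial_deriv b (\<lambda>x. g (x - v)) = (\<lambda>x. partial_deriv b g (x - v))" for b
    by (rule ext) (rule partial_deriv_shift)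
  then show ?case using Suc by (auto intro: differentiable_shift)
next
  case 0
  then have "continuous_on UNIV g" by simp
  from continuous_on_comp_UNIV[OF this, of UNIV "\<lambda>x. x - v"] show ?case
    by (simp add: continuous_on_diff)
qed

lemma partial_deriv_pow_diff_shift:
  assumes "Ck_on m UNIV g" "b \<in> Basis"
  shows "(partial_deriv b ^^ m) (\<lambda>x. g x - g (x - v)) x = (partial_deriv b ^^ m) g x - (partial_deriv b ^^ m) g (x - v)"
  using assms(1)
proof (induction m arbitrary: g)
  case (Suc m)
  have "partial_deriv b (\<lambda>x. g x - g (x - v)) = (\<lambda>y. partial_deriv b g y - partial_deriv b g (y - v))"
  proof
    fix y
    have d: "g differentiable at y" "(\<lambda>x. g (x - v)) differentiable at y" for y
      using Suc.prems by (auto intro!: differentiable_shift)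
    show "partial_deriv b (\<lambda>x. g x - g (x - v)) y = partial_deriv b g y - partial_deriv b g (y - v)"
      using partial_deriv_add[OF d(1) differentiable_minus[OF d(2)], of b]
        partial_deriv_mult[OF differentiable_const d(2), of b "-1"]
      by (simp add: partial_deriv_shift)
  qed
  then show ?case using Suc.IH[of "partial_deriv b g"] Suc.prems assms(2) by (simp add: funpow_swap1)
qed simp

lemma Ck_on_partial_deriv_pow:
  "Ck_on (m + l) U g \<Longrightarrow> b \<in> Basis \<Longrightarrow> Ck_on l U ((partial_deriv b ^^ m) g)"
  by (induction m arbitrary: g) (simp_all add: funpow_Suc_right del: funpow.simps(2))

text \<open>By the mean value theorem each difference trades one derivative in direction
  \<open>b\<close> for a factor \<open>|t|\<close>.\<close>

lemma fdiff_bound: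
  assumes "Ck_on r UNIV g" "b \<in> Basis" "\<And>x. \<bar>(partial_deriv b ^^ r) g x\<bar> \<le> B"
  shows "\<bar>fdiff (t *\<^sub>R b) r g x\<bar> \<le> \<bar>t\<bar> ^ r * B"
  using assms(1,3)
proof (induction r arbitrary: g B)
  case (Suc r)
  let ?h = "\<lambda>x. g x - g (x - t *\<^sub>R b)" and ?G = "(partial_deriv b ^^ r) g"
  have G: "Ck_on 1 UNIV ?G"
    using Suc.prems(1) assms(2) by (intro Ck_on_partial_deriv_pow) auto
  have "\<bar>?G x - ?G (x - t *\<^sub>R b)\<bar> \<le> \<bar>t\<bar> * B" for x
  proof -
    have dG: "?G differentiable at y" for y using G by auto
    have "norm (?G (x + 0 *\<^sub>R b) - ?G (x + (-t) *\<^sub>R b)) \<le> B * norm (0 - (- t))"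
      by (rule field_differentiable_bound[OF convex_UNIV])
        (use has_partial_deriv[OF dG] Suc.prems(2) in auto)
    then show ?thesis by (simp add: mult.commute)
  qed
  moreover note g = Ck_on_pred[OF Suc.prems(1)]
  ultimately have "\<bar>(partial_deriv b ^^ r) ?h x\<bar> \<le> \<bar>t\<bar> * B" for x
    by (simp only: partial_deriv_pow_diff_shift[OF g assms(2)])
  then have "\<bar>fdiff (t *\<^sub>R b) r ?h x\<bar> \<le> \<bar>t\<bar> ^ r * (\<bar>t\<bar> * B)"
    by (rule Suc.IH[OF Ck_on_diff[OF open_UNIV g Ck_on_shift[OF g]]])
  then show ?case by (simp add: mult_ac)
qed simp

section \<open>The generalised Jackson operator in one coordinate direction\<close>

definition jackson :: "real poly \<Rightarrow> real \<Rightarrow> nat \<Rightarrow> complex \<Rightarrow> (complex \<Rightarrow> real) \<Rightarrow> complex \<Rightarrow> real" where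
  "jackson K a r b g x = (\<Sum>j = 1..r. (-1) ^ (j + 1) * real (r choose j) * kernel_avg (poly K) a (real j *\<^sub>R b) g x)"

lemma poly_continuous_UNIV: "continuous_on UNIV (poly (K::real poly))"
  by (intro continuous_intros)

lemma jackson_Ck: "Ck_on m UNIV g \<Longrightarrow> Ck_on m UNIV (jackson K a r b g)"
  unfolding jackson_def[abs_def]
  by (rule Ck_on_sum[OF open_UNIV], rule Ck_on_cmult[OF open_UNIV], rule kernel_avg_Ck[OF poly_continuous_UNIV])

lemma partial_deriv_sum_cmult:
  assumes "\<And>i. i \<in> I \<Longrightarrow> f i differentiable at x"
  shows "partial_deriv b (\<lambda>x. \<Sum>i\<in>I. c i * f i x) x = (\<Sum>i\<in>I. c i * partial_deriv b (f i) x)"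
  using assms
proof (induction I rule: infinite_finite_induct)
  case (insert i I)
  then show ?case
    using partial_deriv_add[of "\<lambda>x. c i * f i x" x "\<lambda>x. \<Sum>i\<in>I. c i * f i x" b]
      partial_deriv_mult[OF differentiable_const, of "f i" x b "c i"]
    by (simp add: differentiable_mult differentiable_sum)
qed simp_all

lemma partial_deriv_jackson:
  assumes "Ck_on 1 UNIV g" "c \<in> Basis"
  shows "partial_deriv c (jackson K a r b g) = jackson K a r b (partial_deriv c g)"
proof (rule ext)
  fix x
  note d = kernel_avg_derivative[OF poly_continuous_UNIV assms(1)]
  have "partial_deriv c (jackson K a r b g) x =
    (\<Sum>j = 1..r. (-1) ^ (j + 1) * real (r choose j) * partial_deriv c (kernel_avg (poly K) a (real j *\<^sub>R b) g) x)"
    unfolding jackson_def[abs_def] by (rule partial_deriv_sum_cmult[where I="{1..r}"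
        and c="\<lambda>j. (-1) ^ (j + 1) * real (r choose j)" and f="\<lambda>j. kernel_avg (poly K) a (real j *\<^sub>R b) g"])
      (rule d)
  then show "partial_deriv c (jackson K a r b g) x = jackson K a r b (partial_deriv c g) x"
    by (simp only: jackson_def d(2)[OF assms(2)])
qed


lemma partial_deriv_pow_jackson:
  assumes "Ck_on m UNIV g" "c \<in> Basis"
  shows "(partial_deriv c ^^ m) (jackson K a r b g) = jackson K a r b ((partial_deriv c ^^ m) g)"
  using assms(1)
proof (induction m arbitrary: g)
  case (Suc m)
  have "partial_deriv c (jackson K a r b g) = jackson K a r b (partial_deriv c g)"
    by (rule partial_deriv_jackson[OF Ck_on_le[OF Suc.prems] assms(2)]) simp
  then show ?case using Suc.IH[of "partial_deriv c g"] Suc.prems assms(2) by (simp add: funpow_swap1)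
qed simp

lemma multi_deriv_jackson:
  assumes "Ck_on (p + q) UNIV g"
  shows "multi_deriv (p, q) (jackson K a r b g) = jackson K a r b (multi_deriv (p, q) g)"
proof -
  have B: "1 \<in> (Basis :: complex set)" "\<i> \<in> (Basis :: complex set)" by (auto simp: Basis_complex_def)
  have "Ck_on q UNIV g" "Ck_on p UNIV ((partial_deriv \<i> ^^ q) g)"
    using assms Ck_on_le Ck_on_partial_deriv_pow[of q p UNIV g \<i>] B by (auto simp: add.commute)
  then show ?thesis by (simp add: multi_deriv_def partial_deriv_pow_jackson B)
qed

context
  fixes K :: "real poly" and a :: real
  assumes nonneg: "\<And>t. 0 \<le> poly K t" and mass: "integral {-a..a} (poly K) = 1"
begin

lemma jackson_bound:
  assumes "continuous_on UNIV g" "\<And>x. \<bar>g x\<bar> \<le> B"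
  shows "\<bar>jackson K a r b g x\<bar> \<le> 2 ^ r * B"
proof -
  have B: "0 \<le> B" using order_trans[OF abs_ge_zero assms(2)] .
  have "\<bar>jackson K a r b g x\<bar> \<le> (\<Sum>j = 1..r. real (r choose j) * B)"
    unfolding jackson_def
    by (rule order_trans[OF sum_abs])
      (auto intro!: sum_mono mult_left_mono kernel_avg_bound[OF poly_continuous_UNIV assms nonneg mass] simp: abs_mult)
  also have "\<dots> \<le> (\<Sum>j\<le>r. real (r choose j) * B)" using B by (intro sum_mono2) auto
  also have "\<dots> = 2 ^ r * B" by (simp add: choose_row_sum flip: sum_distrib_right of_nat_sum)
  finally show ?thesis .
qed

text \<open>This explains the coefficients of \<open>jackson\<close>: in the averaged
  \<open>r\<close>-th difference the term \<open>j = 0\<close> is \<open>g x\<close>, because the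
  kernel has mass 1, and the other terms are the operator with opposite sign. The rate is therefore
  the \<open>r\<close>-th moment of the kernel.\<close>

lemma jackson_error_eq:
  assumes "continuous_on UNIV g"
  shows "((\<lambda>t. poly K t * fdiff (t *\<^sub>R b) r g x) has_integral (g x - jackson K a r b g x)) {-a..a}"
proof -
  let ?c = "\<lambda>j. (-1) ^ j * real (r choose j)"
  have 1: "((\<lambda>t. poly K t * g (x - t *\<^sub>R v)) has_integral kernel_avg (poly K) a v g x) {-a..a}" for v
    unfolding kernel_avg_def by (intro integrable_integral kernel_integrable[OF poly_continuous_UNIV assms])
  have "((\<lambda>t. \<Sum>j\<le>r. ?c j * (poly K t * g (x - t *\<^sub>R (real j *\<^sub>R b)))) has_integral
     (\<Sum>j\<le>r. ?c j * kernel_avg (poly K) a (real j *\<^sub>R b) g x)) {-a..a}"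
    by (intro has_integral_sum has_integral_mult_right 1) simp
  moreover have "(\<Sum>j\<le>r. ?c j * (poly K t * g (x - t *\<^sub>R (real j *\<^sub>R b)))) = poly K t * fdiff (t *\<^sub>R b) r g x" for t
    unfolding fdiff_sum sum_distrib_left by (intro sum.cong) (simp_all add: mult_ac)
  moreover have "(\<Sum>j\<le>r. ?c j * kernel_avg (poly K) a (real j *\<^sub>R b) g x) = g x - jackson K a r b g x"
  proof -
    have "{..r} = insert 0 {1..r}" by auto
    moreover have "kernel_avg (poly K) a 0 g x = g x" using mass by (simp add: kernel_avg_def)
    ultimately show ?thesis by (simp add: jackson_def sum_negf)
  qed
  ultimately show ?thesis by simp
qed

lemma jackson_error:
  assumes "Ck_on r UNIV g" "b \<in> Basis" "\<And>x. \<bar>(partial_deriv b ^^ r) g x\<bar> \<le> B"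
  shows "\<bar>g x - jackson K a r b g x\<bar> \<le> B * integral {-a..a} (\<lambda>t. \<bar>t\<bar> ^ r * poly K t)"
proof -
  note hi = jackson_error_eq[OF Ck_on_continuous[OF assms(1)], of b r x]
  have "norm (integral {-a..a} (\<lambda>t. poly K t * fdiff (t *\<^sub>R b) r g x)) \<le>
      integral {-a..a} (\<lambda>t. B * (\<bar>t\<bar> ^ r * poly K t))"
  proof (rule integral_norm_bound_integral)
    show "(\<lambda>t. poly K t * fdiff (t *\<^sub>R b) r g x) integrable_on {-a..a}" using hi by blast
    show "(\<lambda>t. B * (\<bar>t\<bar> ^ r * poly K t)) integrable_on {-a..a}"
      by (intro integrable_continuous_real continuous_intros)
    fix t
    have "poly K t * \<bar>fdiff (t *\<^sub>R b) r g x\<bar> \<le> poly K t * (\<bar>t\<bar> ^ r * B)"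
      using fdiff_bound[OF assms] nonneg by (intro mult_left_mono)
    then show "norm (poly K t * fdiff (t *\<^sub>R b) r g x) \<le> B * (\<bar>t\<bar> ^ r * poly K t)"
      using nonneg[of t] by (simp add: abs_mult mult_ac)
  qed
  then show ?thesis using integral_unique[OF hi] by simp
qed

text \<open>The error splits as \<open>(g - J g) + J (g - J' g)\<close> with \<open>J\<close> in
  direction \<open>\<i>\<close> and \<open>J'\<close> in direction 1; the second part is enlarged by
  at most the norm \<open>2^r\<close> of \<open>J\<close>.\<close>

lemma jackson_jackson_error:
  assumes "Ck_on r UNIV g" "\<And>b x. b \<in> Basis \<Longrightarrow> \<bar>(partial_deriv b ^^ r) g x\<bar> \<le> B"
  shows "\<bar>g x - jackson K a r \<i> (jackson K a r 1 g) x\<bar> \<le> (1 + 2 ^ r) * B * integral {-a..a} (\<lambda>t. \<bar>t\<bar> ^ r * poly K t)"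
proof -
  let ?m = "integral {-a..a} (\<lambda>t. \<bar>t\<bar> ^ r * poly K t)"
  have B: "1 \<in> (Basis :: complex set)" "\<i> \<in> (Basis :: complex set)" by (auto simp: Basis_complex_def)
  note c = Ck_on_continuous[OF assms(1)] Ck_on_continuous[OF jackson_Ck[OF assms(1)]]
  have "\<bar>jackson K a r \<i> (\<lambda>x. g x - jackson K a r 1 g x) x\<bar> \<le> 2 ^ r * (B * ?m)"
    by (intro jackson_bound continuous_intros c jackson_error assms B)
  moreover have "jackson K a r \<i> (\<lambda>x. g x - jackson K a r 1 g x) x = jackson K a r \<i> g x - jackson K a r \<i> (jackson K a r 1 g) x"
    unfolding jackson_def[of K a r \<i>] kernel_avg_diff[OF poly_continuous_UNIV c]
    by (simp add: right_diff_distrib sum_subtractf sum_negf)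
  moreover have "\<bar>g x - jackson K a r \<i> g x\<bar> \<le> B * ?m" by (intro jackson_error assms B)
  ultimately show ?thesis by (simp add: algebra_simps)
qed

end

section \<open>Polynomials from compactly supported functions\<close>

lemma poly_affine_expand:
  fixes K :: "real poly" and j :: real
  obtains \<kappa> where "\<And>p. continuous_on UNIV (\<kappa> p)"
    "\<And>\<xi> s. poly K ((\<xi> - s) / j) = (\<Sum>p\<le>degree K. \<kappa> p s * \<xi> ^ p)"
proof
  define \<kappa> where "\<kappa> p s = (\<Sum>i\<le>degree K. coeff K i * (1 / j) ^ p * (- s / j) ^ (i - p) * real (i choose p))" for p s
  show "continuous_on UNIV (\<kappa> p)" for p unfolding \<kappa>_def divide_inverse by (intro continuous_intros)
  fix \<xi> s
  have "((\<xi> - s) / j) ^ i = (\<Sum>p\<le>degree K. real (i choose p) * (\<xi> / j) ^ p * (- s / j) ^ (i - p))" if "i \<le> degree K" for i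
  proof -
    have "((\<xi> - s) / j) ^ i = (\<xi> / j + - s / j) ^ i" by (simp add: diff_divide_distrib)
    also have "\<dots> = (\<Sum>p\<le>i. real (i choose p) * (\<xi> / j) ^ p * (- s / j) ^ (i - p))" by (rule binomial_ring)
    also have "\<dots> = (\<Sum>p\<le>degree K. real (i choose p) * (\<xi> / j) ^ p * (- s / j) ^ (i - p))"
      using that by (intro sum.mono_neutral_left) auto
    finally show ?thesis .
  qed
  then have "poly K ((\<xi> - s) / j) =
      (\<Sum>i\<le>degree K. coeff K i * (\<Sum>p\<le>degree K. real (i choose p) * (\<xi> / j) ^ p * (- s / j) ^ (i - p)))"
    unfolding poly_altdef by (intro sum.cong) auto
  also have "\<dots> = (\<Sum>p\<le>degree K. \<kappa> p s * \<xi> ^ p)"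
    unfolding \<kappa>_def sum_distrib_left sum_distrib_right
    by (subst sum.swap) (simp add: power_divide mult_ac)
  finally show "poly K ((\<xi> - s) / j) = (\<Sum>p\<le>degree K. \<kappa> p s * \<xi> ^ p)" .
qed

text \<open>Substituting \<open>s = \<xi> - j * t\<close> moves \<open>\<xi>\<close> from the
  function into the polynomial kernel. Since \<open>h\<close> vanishes outside
  \<open>{-R..R}\<close> and \<open>a\<close> is large enough for the moving window to contain this
  interval, the domain of integration no longer depends on \<open>\<xi>\<close>.\<close>

lemma kernel_substitution:
  fixes h :: "real \<Rightarrow> real" and K :: "real poly"
  assumes h: "continuous_on UNIV h" "\<And>s. R < \<bar>s\<bar> \<Longrightarrow> h s = 0"
    and a: "\<rho> + R \<le> a" "\<bar>\<xi>\<bar> \<le> \<rho>" "1 \<le> j" "0 \<le> R"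
  shows "integral {-a..a} (\<lambda>t. poly K t * h (\<xi> - j * t)) = integral {-R..R} (\<lambda>s. poly K ((\<xi> - s) / j) * h s) / j"
proof -
  let ?F = "\<lambda>s. poly K ((\<xi> - s) / j) * h s"
  have a0: "a \<ge> 0" using a by linarith
  have "a \<le> j * a" using a(3) a0 by (simp add: mult_le_cancel_right1)
  then have sub: "{-R..R} \<subseteq> {\<xi> - j * a..\<xi> + j * a}" using a by auto
  have "continuous_on {-R..R} ?F"
    unfolding divide_inverse by (intro continuous_intros continuous_on_subset[OF h(1)]) auto
  then have "(?F has_integral integral {-R..R} ?F) {-R..R}"
    by (intro integrable_integral integrable_continuous_real)
  then have "(?F has_integral integral {-R..R} ?F) {\<xi> - j * a..\<xi> + j * a}"
    by (rule has_integral_on_superset[OF _ _ sub]) (use h(2) in \<open>auto simp: abs_if\<close>)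
  then have "(?F has_integral integral {-R..R} ?F) (cbox (\<xi> - j * a) (\<xi> + j * a))" by simp
  from has_integral_affinity[OF this, of "-j" \<xi>]
  have "((\<lambda>t. ?F (- j * t + \<xi>)) has_integral integral {-R..R} ?F / j) ((\<lambda>x. (- 1 / j) * x + \<xi> / j) ` {\<xi> - j * a..\<xi> + j * a})"
    using a(3) by (simp add: divide_inverse mult.commute)
  also have "(\<lambda>x. (- 1 / j) * x + \<xi> / j) ` {\<xi> - j * a..\<xi> + j * a} = {-a..a}"
    using a(3) a0 unfolding image_affinity_atLeastAtMost by (auto simp: field_simps)
  finally have "((\<lambda>t. ?F (- j * t + \<xi>)) has_integral integral {-R..R} ?F / j) {-a..a}" .
  moreover have "(\<xi> - (- j * t + \<xi>)) / j = t" "- j * t + \<xi> = \<xi> - j * t" for t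
    using a(3) by simp_all
  ultimately have "((\<lambda>t. poly K t * h (\<xi> - j * t)) has_integral integral {-R..R} ?F / j) {-a..a}"
    by (simp only:)
  then show ?thesis by (rule integral_unique)
qed

text \<open>The weights are obtained before \<open>h\<close>, so the same ones serve a whole family
  of functions depending on the other coordinate, and the coefficients vary continuously with
  it.\<close>

lemma jackson_line:
  fixes K :: "real poly"
  assumes a: "\<rho> + R \<le> a" "0 \<le> R"
  obtains w :: "nat \<Rightarrow> real \<Rightarrow> real" where "\<And>p. continuous_on UNIV (w p)"
    "\<And>h \<xi>. continuous_on UNIV h \<Longrightarrow> (\<And>s. R < \<bar>s\<bar> \<Longrightarrow> h s = 0) \<Longrightarrow> \<bar>\<xi>\<bar> \<le> \<rho> \<Longrightarrow>
      (\<Sum>j = 1..r. (-1) ^ (j + 1) * real (r choose j) * integral {-a..a} (\<lambda>t. poly K t * h (\<xi> - real j * t))) =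
      (\<Sum>p\<le>degree K. integral {-R..R} (\<lambda>s. w p s * h s) * \<xi> ^ p)"
proof -
  let ?c = "\<lambda>j. (-1) ^ (j + 1) * real (r choose j)"
  have "\<exists>\<kappa>. (\<forall>p. continuous_on UNIV (\<kappa> p)) \<and>
    (\<forall>\<xi> s. poly K ((\<xi> - s) / real j) = (\<Sum>p\<le>degree K. \<kappa> p s * \<xi> ^ p))" for j :: nat
    by (rule poly_affine_expand[of K "real j"]) blast
  then obtain \<kappa> where \<kappa>: "\<And>j p. continuous_on UNIV (\<kappa> j p)"
    "\<And>j \<xi> s. poly K ((\<xi> - s) / real j) = (\<Sum>p\<le>degree K. \<kappa> j p s * \<xi> ^ p)" by metis
  define w where "w p s = (\<Sum>j = 1..r. ?c j / real j * \<kappa> j p s)" for p s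
  have w: "continuous_on UNIV (w p)" for p
    unfolding w_def by (intro continuous_intros \<kappa>)
  have "(\<Sum>j = 1..r. ?c j * integral {-a..a} (\<lambda>t. poly K t * h (\<xi> - real j * t))) =
      (\<Sum>p\<le>degree K. integral {-R..R} (\<lambda>s. w p s * h s) * \<xi> ^ p)"
    if h: "continuous_on UNIV h" "\<And>s. R < \<bar>s\<bar> \<Longrightarrow> h s = 0" and \<xi>: "\<bar>\<xi>\<bar> \<le> \<rho>" for h \<xi>
  proof -
    have int: "(\<lambda>s. f s * h s) integrable_on {-R..R}" if "continuous_on UNIV f" for f
      by (intro integrable_continuous_real continuous_intros continuous_on_subset[OF h(1)] continuous_on_subset[OF that]) auto
    have "integral {-a..a} (\<lambda>t. poly K t * h (\<xi> - real j * t)) =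
       (\<Sum>p\<le>degree K. integral {-R..R} (\<lambda>s. \<kappa> j p s * h s) * \<xi> ^ p) / real j" if "j \<in> {1..r}" for j
    proof -
      have "integral {-a..a} (\<lambda>t. poly K t * h (\<xi> - real j * t)) = integral {-R..R} (\<lambda>s. poly K ((\<xi> - s) / real j) * h s) / real j"
        using that by (intro kernel_substitution[OF h a(1) \<xi> _ a(2)]) auto
      also have "(\<lambda>s. poly K ((\<xi> - s) / real j) * h s) = (\<lambda>s. \<Sum>p\<le>degree K. (\<kappa> j p s * h s) * \<xi> ^ p)"
        by (simp add: \<kappa>(2) sum_distrib_right sum_distrib_left mult_ac)
      also have "integral {-R..R} \<dots> = (\<Sum>p\<le>degree K. integral {-R..R} (\<lambda>s. \<kappa> j p s * h s) * \<xi> ^ p)"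
        by (intro integral_unique has_integral_sum has_integral_mult_left integrable_integral int \<kappa>) simp
      finally show ?thesis .
    qed
    then have "(\<Sum>j = 1..r. ?c j * integral {-a..a} (\<lambda>t. poly K t * h (\<xi> - real j * t))) =
      (\<Sum>j = 1..r. \<Sum>p\<le>degree K. ?c j / real j * integral {-R..R} (\<lambda>s. \<kappa> j p s * h s) * \<xi> ^ p)"
      by (intro sum.cong refl) (simp add: sum_divide_distrib sum_distrib_left mult_ac)
    also have "\<dots> = (\<Sum>p\<le>degree K. (\<Sum>j = 1..r. ?c j / real j * integral {-R..R} (\<lambda>s. \<kappa> j p s * h s)) * \<xi> ^ p)"
      by (subst sum.swap) (simp add: sum_distrib_right)
    also have "\<dots> = (\<Sum>p\<le>degree K. integral {-R..R} (\<lambda>s. w p s * h s) * \<xi> ^ p)"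
    proof (intro sum.cong refl arg_cong2[where f="(*)"])
      fix p
      have "integral {-R..R} (\<lambda>s. w p s * h s) = integral {-R..R} (\<lambda>s. \<Sum>j = 1..r. ?c j / real j * (\<kappa> j p s * h s))"
        by (simp add: w_def sum_distrib_right mult.assoc)
      also have "\<dots> = (\<Sum>j = 1..r. ?c j / real j * integral {-R..R} (\<lambda>s. \<kappa> j p s * h s))"
        by (intro integral_unique has_integral_sum has_integral_mult_right integrable_integral int \<kappa>) simp
      finally show "(\<Sum>j = 1..r. ?c j / real j * integral {-R..R} (\<lambda>s. \<kappa> j p s * h s)) = integral {-R..R} (\<lambda>s. w p s * h s)" ..
    qed
    finally show ?thesis .
  qed
  then show ?thesis using that w by blast
qed

lemma Complex_eq_shift: "Complex x y - t *\<^sub>R (j *\<^sub>R 1) = Complex (x - j * t) y" "Complex x y - t *\<^sub>R (j *\<^sub>R \<i>) = Complex x (y - j * t)"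
  by (simp_all add: complex_eq_iff mult.commute)

text \<open>The operator in the first coordinate gives a polynomial in \<open>Re z\<close> whose
  coefficients are continuous functions of \<open>Im z\<close>, again supported in
  \<open>{-R..R}\<close>; \<open>jackson_line\<close> then applies to these in the second
  coordinate.\<close>

lemma jackson_polynomial:
  assumes g: "continuous_on UNIV g" "\<And>x. R < \<bar>Re x\<bar> \<or> R < \<bar>Im x\<bar> \<Longrightarrow> g x = 0"
    and a: "\<rho> + R \<le> a" "0 \<le> R"
  obtains c where "\<And>z. \<bar>Re z\<bar> \<le> \<rho> \<Longrightarrow> \<bar>Im z\<bar> \<le> \<rho> \<Longrightarrow> jackson K a r \<i> (jackson K a r 1 g) z =
    (\<Sum>p\<le>degree K. \<Sum>q\<le>degree K. c p q * (Re z ^ p * Im z ^ q))"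
proof -
  obtain w :: "nat \<Rightarrow> real \<Rightarrow> real" where w: "\<And>p. continuous_on UNIV (w p)"
    "\<And>h \<xi>. continuous_on UNIV h \<Longrightarrow> (\<And>s. R < \<bar>s\<bar> \<Longrightarrow> h s = 0) \<Longrightarrow> \<bar>\<xi>\<bar> \<le> \<rho> \<Longrightarrow>
      (\<Sum>j = 1..r. (-1) ^ (j + 1) * real (r choose j) * integral {-a..a} (\<lambda>t. poly K t * h (\<xi> - real j * t))) =
      (\<Sum>p\<le>degree K. integral {-R..R} (\<lambda>s. w p s * h s) * \<xi> ^ p)"
    by (rule jackson_line[OF a, of r K]) blast
  have gc: "continuous_on A (\<lambda>s. g (Complex (f s) (f' s)))"
    if "continuous_on A f" "continuous_on A f'" for A :: "'b::topological_space set" and f f'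
    by (intro continuous_on_comp_UNIV[OF g(1)] continuous_on_Complex that)
  define \<gamma> where "\<gamma> p y = integral {-R..R} (\<lambda>s. w p s * g (Complex s y))" for p y
  have \<gamma>c: "continuous_on UNIV (\<gamma> p)" for p
  proof -
    have "continuous_on (UNIV \<times> cbox (-R) R) (\<lambda>(y, s). w p s * g (Complex s y))"
      unfolding split_beta by (intro continuous_intros gc continuous_on_comp_UNIV[OF w(1)])
    from integral_continuous_on_param[OF this] show ?thesis by (simp add: \<gamma>_def[abs_def])
  qed
  have \<gamma>0: "\<gamma> p y = 0" if "R < \<bar>y\<bar>" for p y using that by (simp add: \<gamma>_def g(2))
  \<comment> \<open>Only \<open>x\<close> is restricted to \<open>\<rho>\<close>: averaging in the
    second coordinate needs this formula at every \<open>y\<close>.\<close>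
  have J1: "jackson K a r 1 g (Complex x y) = (\<Sum>p\<le>degree K. \<gamma> p y * x ^ p)" if "\<bar>x\<bar> \<le> \<rho>" for x y
    unfolding jackson_def kernel_avg_def Complex_eq_shift \<gamma>_def
  proof (rule w(2)[OF _ _ that])
    show "continuous_on UNIV (\<lambda>s. g (Complex s y))" by (intro gc continuous_on_id continuous_on_const)
  qed (simp add: g(2))
  define c where "c p q = integral {-R..R} (\<lambda>s. w q s * \<gamma> p s)" for p q
  have "jackson K a r \<i> (jackson K a r 1 g) (Complex x y) = (\<Sum>p\<le>degree K. \<Sum>q\<le>degree K. c p q * (x ^ p * y ^ q))"
    if x: "\<bar>x\<bar> \<le> \<rho>" and y: "\<bar>y\<bar> \<le> \<rho>" for x y
  proof -
    let ?h = "\<lambda>y. \<Sum>p\<le>degree K. \<gamma> p y * x ^ p"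
    have "jackson K a r \<i> (jackson K a r 1 g) (Complex x y) = (\<Sum>q\<le>degree K. integral {-R..R} (\<lambda>s. w q s * ?h s) * y ^ q)"
      unfolding jackson_def[of K a r \<i>] kernel_avg_def Complex_eq_shift J1[OF x]
    proof (rule w(2)[OF _ _ y])
      show "continuous_on UNIV ?h" by (intro continuous_on_sum continuous_on_mult continuous_on_const \<gamma>c)
    qed (simp add: \<gamma>0)
    also have "\<dots> = (\<Sum>q\<le>degree K. \<Sum>p\<le>degree K. c p q * (x ^ p * y ^ q))"
    proof (rule sum.cong[OF refl])
      fix q
      have "integral {-R..R} (\<lambda>s. w q s * ?h s) = integral {-R..R} (\<lambda>s. \<Sum>p\<le>degree K. (w q s * \<gamma> p s) * x ^ p)"
        by (simp add: sum_distrib_left mult.assoc)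
      also have "\<dots> = (\<Sum>p\<le>degree K. c p q * x ^ p)"
        unfolding c_def
        by (intro integral_unique has_integral_sum has_integral_mult_left integrable_integral
            integrable_continuous_real continuous_on_mult continuous_on_subset[OF w(1)] continuous_on_subset[OF \<gamma>c]) auto
      finally show "integral {-R..R} (\<lambda>s. w q s * ?h s) * y ^ q = (\<Sum>p\<le>degree K. c p q * (x ^ p * y ^ q))"
        by (simp add: sum_distrib_right mult.assoc)
    qed
    also have "\<dots> = (\<Sum>p\<le>degree K. \<Sum>q\<le>degree K. c p q * (x ^ p * y ^ q))" by (rule sum.swap)
    finally show ?thesis .
  qed
  from this[of "Re z" "Im z" for z] have "jackson K a r \<i> (jackson K a r 1 g) z = (\<Sum>p\<le>degree K. \<Sum>q\<le>degree K. c p q * (Re z ^ p * Im z ^ q))"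
    if "\<bar>Re z\<bar> \<le> \<rho>" "\<bar>Im z\<bar> \<le> \<rho>" for z
    using that by simp
  then show ?thesis using that by blast
qed

section \<open>Simultaneous approximation of a function and its derivatives\<close>

lemma partial_deriv_pow_cong:
  assumes "open U" "x \<in> U" "\<And>y. y \<in> U \<Longrightarrow> f y = g y"
  shows "(partial_deriv b ^^ m) f x = (partial_deriv b ^^ m) g x"
  using assms(2)
proof (induction m arbitrary: x)
  case (Suc m)
  then show ?case using partial_deriv_cong[OF assms(1) Suc.prems, of "(partial_deriv b ^^ m) f" "(partial_deriv b ^^ m) g"]
    by simp
qed (use assms(3) in simp)

lemma multi_deriv_cong:
  assumes "open U" "x \<in> U" "\<And>y. y \<in> U \<Longrightarrow> f y = g y"
  shows "multi_deriv \<beta> f x = multi_deriv \<beta> g x"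
  unfolding multi_deriv_def
  by (rule partial_deriv_pow_cong[OF assms(1,2)]) (rule partial_deriv_pow_cong[OF assms(1) _ assms(3)])

lemma Ck_on_multi_deriv:
  assumes "Ck_on (p + q + l) U g"
  shows "Ck_on l U (multi_deriv (p, q) g)"
proof -
  have "Ck_on (q + (p + l)) U g" using assms by (simp add: ac_simps)
  then have "Ck_on (p + l) U ((partial_deriv \<i> ^^ q) g)"
    by (rule Ck_on_partial_deriv_pow) (simp add: Basis_complex_def)
  then show ?thesis unfolding multi_deriv_def fst_conv snd_conv
    by (rule Ck_on_partial_deriv_pow) (simp add: Basis_complex_def)
qed

lemma bounded_outside_zero:
  fixes g :: "complex \<Rightarrow> real"
  assumes "continuous_on UNIV g" "\<And>x. R < cmod x \<Longrightarrow> g x = 0"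
  obtains B where "\<And>x. \<bar>g x\<bar> \<le> B"
proof -
  have "compact (g ` cball 0 R)"
    by (intro compact_continuous_image continuous_on_subset[OF assms(1)]) auto
  then have "bounded (g ` cball 0 R)" by (rule compact_imp_bounded)
  then obtain B where "\<forall>y\<in>g ` cball 0 R. norm y \<le> B" unfolding bounded_iff by blast
  then have B: "\<bar>g x\<bar> \<le> B" if "x \<in> cball 0 R" for x using that by auto
  have "\<bar>g x\<bar> \<le> max B 0" for x
    using B[of x] assms(2)[of x] by (cases "cmod x \<le> R") auto
  then show ?thesis using that by blast
qed

lemma multi_deriv_zero: "multi_deriv \<beta> (\<lambda>x. 0) x = 0" "(partial_deriv b ^^ m) (\<lambda>x. 0) = (\<lambda>x. 0)"
proof -
  have *: "(partial_deriv b ^^ m) (\<lambda>x. 0) = (\<lambda>x. 0)" for b m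
    by (induction m) (simp_all add: partial_deriv_const[abs_def])
  then show "(partial_deriv b ^^ m) (\<lambda>x. 0) = (\<lambda>x. 0)" .
  show "multi_deriv \<beta> (\<lambda>x. 0) x = 0" by (simp add: multi_deriv_def *)
qed

text \<open>One polynomial serves every derivative because the operator commutes with
  differentiation, so the error of a derivative is the approximation error of that derivative. The
  kernel half-width 4 is the sum of the support radius 2 and the radius 2 on which the approximant
  is a polynomial.\<close>

lemma jackson_approximation:
  fixes g :: "complex \<Rightarrow> real"
  assumes g: "Ck_on k UNIV g" "\<And>x. 2 < cmod x \<Longrightarrow> g x = 0"
  obtains C where "\<And>\<beta>. 0 \<le> C \<beta>"
    "\<And>n. \<exists>c. \<forall>p q x. p + q + r \<le> k \<longrightarrow> cmod x \<le> 1 \<longrightarrow>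
       \<bar>multi_deriv (p, q) g x - multi_deriv (p, q) (\<lambda>z. \<Sum>i\<le>4 * n * (r + 1). \<Sum>j\<le>4 * n * (r + 1). c i j * (Re z ^ i * Im z ^ j)) x\<bar>
         \<le> C (p, q) / (real n + 1) ^ r"
proof -
  have gc: "continuous_on UNIV g" using Ck_on_continuous[OF g(1)] .
  obtain C0 where C0: "C0 \<ge> 0" "\<And>n. \<exists>K::real poly. degree K \<le> 4 * n * (r + 1) \<and> (\<forall>t. 0 \<le> poly K t) \<and>
    integral {-4..4} (poly K) = 1 \<and> integral {-4..4} (\<lambda>t. \<bar>t\<bar> ^ r * poly K t) \<le> C0 / (real n + 1) ^ r"
    using jackson_kernel[of 4 r] by auto
  have out: "open {x. 2 < cmod x}" by (intro open_Collect_less continuous_intros)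
  have "\<exists>B\<ge>0. \<forall>b\<in>Basis. \<forall>x. \<bar>(partial_deriv b ^^ r) (multi_deriv (p, q) g) x\<bar> \<le> B" if pq: "p + q + r \<le> k" for p q
  proof -
    have "\<exists>B. \<forall>x. \<bar>(partial_deriv b ^^ r) (multi_deriv (p, q) g) x\<bar> \<le> B" if b: "b \<in> Basis" for b
    proof -
      have "Ck_on (r + 0) UNIV (multi_deriv (p, q) g)"
        using Ck_on_multi_deriv[OF Ck_on_le[OF g(1) pq]] by simp
      then have "Ck_on 0 UNIV ((partial_deriv b ^^ r) (multi_deriv (p, q) g))"
        using b by (rule Ck_on_partial_deriv_pow)
      then have c: "continuous_on UNIV ((partial_deriv b ^^ r) (multi_deriv (p, q) g))" by simp
      have z: "multi_deriv (p, q) g x = 0" if "x \<in> {x. 2 < cmod x}" for x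
        using multi_deriv_cong[OF out that, of g "\<lambda>x. 0"] g(2) by (simp add: multi_deriv_zero)
      have "(partial_deriv b ^^ r) (multi_deriv (p, q) g) x = 0" if "2 < cmod x" for x
        using partial_deriv_pow_cong[OF out, of x "multi_deriv (p, q) g" "\<lambda>x. 0" r b] z that by (simp add: multi_deriv_zero)
      from bounded_outside_zero[OF c this] show ?thesis by metis
    qed
    then obtain B where B: "\<And>b x. b \<in> Basis \<Longrightarrow> \<bar>(partial_deriv b ^^ r) (multi_deriv (p, q) g) x\<bar> \<le> B b" by metis
    have "\<bar>(partial_deriv b ^^ r) (multi_deriv (p, q) g) x\<bar> \<le> max 0 (max (B 1) (B \<i>))" if "b \<in> Basis" for b x
      using B[OF that, of x] that by (auto simp: Basis_complex_def)
    then show ?thesis by (intro exI[of _ "max 0 (max (B 1) (B \<i>))"]) auto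
  qed
  then obtain B where B: "\<And>p q b x. p + q + r \<le> k \<Longrightarrow> b \<in> Basis \<Longrightarrow> \<bar>(partial_deriv b ^^ r) (multi_deriv (p, q) g) x\<bar> \<le> B p q"
    "\<And>p q. p + q + r \<le> k \<Longrightarrow> 0 \<le> B p q" by metis
  define C where "C \<beta> = (1 + 2 ^ r) * \<bar>B (fst \<beta>) (snd \<beta>)\<bar> * C0" for \<beta>
  have "\<exists>c. \<forall>p q x. p + q + r \<le> k \<longrightarrow> cmod x \<le> 1 \<longrightarrow>
       \<bar>multi_deriv (p, q) g x - multi_deriv (p, q) (\<lambda>z. \<Sum>i\<le>4 * n * (r + 1). \<Sum>j\<le>4 * n * (r + 1). c i j * (Re z ^ i * Im z ^ j)) x\<bar>
         \<le> C (p, q) / (real n + 1) ^ r" for n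
  proof -
    obtain K :: "real poly" where K: "degree K \<le> 4 * n * (r + 1)" "\<And>t. 0 \<le> poly K t" "integral {-4..4} (poly K) = 1"
      "integral {-4..4} (\<lambda>t. \<bar>t\<bar> ^ r * poly K t) \<le> C0 / (real n + 1) ^ r" using C0(2)[of n] by blast
    let ?N = "4 * n * (r + 1)"
    let ?J = "jackson K 4 r \<i> (jackson K 4 r 1 g)"
    have g0: "g x = 0" if "2 < \<bar>Re x\<bar> \<or> 2 < \<bar>Im x\<bar>" for x
      using that abs_Re_le_cmod[of x] abs_Im_le_cmod[of x] by (intro g(2)) linarith
    obtain c where c: "\<And>z. \<bar>Re z\<bar> \<le> 2 \<Longrightarrow> \<bar>Im z\<bar> \<le> 2 \<Longrightarrow> ?J z =
      (\<Sum>p\<le>degree K. \<Sum>q\<le>degree K. c p q * (Re z ^ p * Im z ^ q))"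
      by (rule jackson_polynomial[OF gc g0, where \<rho>=2 and a=4 and K=K and r=r]) auto
    \<comment> \<open>Zero padding makes the index range depend on \<open>n\<close> only.\<close>
    define c' where "c' p q = (if p \<le> degree K \<and> q \<le> degree K then c p q else 0)" for p q
    let ?Q = "\<lambda>z. \<Sum>i\<le>?N. \<Sum>j\<le>?N. c' i j * (Re z ^ i * Im z ^ j)"
    have Q: "?J z = ?Q z" if "z \<in> ball 0 2" for z
    proof -
      have "?Q z = (\<Sum>p\<le>degree K. \<Sum>q\<le>?N. c' p q * (Re z ^ p * Im z ^ q))"
        using K(1) by (intro sum.mono_neutral_right) (auto simp: c'_def)
      also have "\<dots> = (\<Sum>p\<le>degree K. \<Sum>q\<le>degree K. c' p q * (Re z ^ p * Im z ^ q))"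
        using K(1) by (intro sum.cong sum.mono_neutral_right refl) (auto simp: c'_def)
      also have "\<dots> = (\<Sum>p\<le>degree K. \<Sum>q\<le>degree K. c p q * (Re z ^ p * Im z ^ q))"
        by (intro sum.cong refl) (auto simp: c'_def)
      also have "\<dots> = ?J z"
        using that abs_Re_le_cmod[of z] abs_Im_le_cmod[of z] by (intro c[symmetric]) auto
      finally show ?thesis ..
    qed
    have "\<bar>multi_deriv (p, q) g x - multi_deriv (p, q) ?Q x\<bar> \<le> C (p, q) / (real n + 1) ^ r"
      if pq: "p + q + r \<le> k" and x: "cmod x \<le> 1" for p q x
    proof -
      let ?D = "multi_deriv (p, q)"
      \<comment> \<open>Agreement on the open ball of radius 2, not just on the closed disk, is
        needed to compare derivatives at boundary points.\<close>
      have "?D ?Q x = ?D ?J x" using x by (intro multi_deriv_cong[of "ball 0 2"] Q[symmetric]) auto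
      also have "?D ?J = jackson K 4 r \<i> (jackson K 4 r 1 (?D g))"
        using Ck_on_le[OF g(1), of "p + q"] pq by (simp add: multi_deriv_jackson jackson_Ck)
      finally have "\<bar>?D g x - ?D ?Q x\<bar> = \<bar>?D g x - jackson K 4 r \<i> (jackson K 4 r 1 (?D g)) x\<bar>" by simp
      also have "\<dots> \<le> (1 + 2 ^ r) * B p q * integral {-4..4} (\<lambda>t. \<bar>t\<bar> ^ r * poly K t)"
        by (rule jackson_jackson_error[OF K(2,3) Ck_on_multi_deriv[OF Ck_on_le[OF g(1) pq]] B(1)[OF pq]])
      also have "\<dots> \<le> (1 + 2 ^ r) * B p q * (C0 / (real n + 1) ^ r)"
        using K(4) B(2)[OF pq] by (intro mult_left_mono) auto
      also have "\<dots> = C (p, q) / (real n + 1) ^ r" using B(2)[OF pq] by (simp add: C_def)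
      finally show ?thesis .
    qed
    then show ?thesis by blast
  qed
  moreover have "0 \<le> C \<beta>" for \<beta> using C0(1) by (simp add: C_def)
  ultimately show ?thesis using that by blast
qed

section \<open>Cutoff functions of finite smoothness and extension to the plane\<close>

lemma Ck_on_pos_part_power:
  assumes U: "open U" and q: "\<And>k. Ck_on k U q"
  shows "Ck_on k U (\<lambda>x. max 0 (q x) ^ Suc k)"
proof (induction k)
  case 0
  then show ?case using q[of 0] by (auto intro!: continuous_intros)
next
  case (Suc k)
  let ?p = "\<lambda>x. max 0 (q x)"
  have D: "((\<lambda>x. ?p x ^ Suc (Suc k)) has_derivative (\<lambda>h. real (Suc (Suc k)) * ?p x ^ Suc k * dir_deriv h q x)) (at x)"
    if "x \<in> U" for x
  proof -
    have qd: "(q has_derivative (\<lambda>h. dir_deriv h q x)) (at x)"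
      using q[of 1] that by (intro has_derivative_dir_deriv) auto
    have "((\<lambda>y::real. max 0 y ^ Suc (Suc k)) has_real_derivative real (Suc (Suc k)) * max 0 y ^ Suc k) (at y)" for y
    proof (cases "y = 0")
      case False
      show ?thesis
      proof (cases "y > 0")
        case True
        then have "eventually (\<lambda>z. max 0 z ^ Suc (Suc k) = z ^ Suc (Suc k)) (nhds y)"
          by (intro eventually_mono[OF eventually_nhds_in_open[of "{0<..}" y]]) auto
        moreover have "((\<lambda>z. z ^ Suc (Suc k)) has_real_derivative real (Suc (Suc k)) * max 0 y ^ Suc k) (at y)"
          using True DERIV_pow[of "Suc (Suc k)" y UNIV] by simp
        ultimately show ?thesis by (rule DERIV_cong_ev[THEN iffD2, OF refl _ refl])
      next
        case False
        then have "y < 0" using \<open>y \<noteq> 0\<close> by simp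
        then have "eventually (\<lambda>z. max 0 z ^ Suc (Suc k) = 0) (nhds y)"
          by (intro eventually_mono[OF eventually_nhds_in_open[of "{..<0}" y]]) auto
        moreover have "((\<lambda>z. 0) has_real_derivative real (Suc (Suc k)) * max 0 y ^ Suc k) (at y)"
          using \<open>y < 0\<close> by simp
        ultimately show ?thesis by (rule DERIV_cong_ev[THEN iffD2, OF refl _ refl])
      qed
    next
      case True
      \<comment> \<open>At the kink the difference quotient is bounded by the next lower power of
        the positive part, which tends to 0.\<close>
      have "((\<lambda>z. max 0 z ^ Suc k * \<bar>z\<bar> / z) \<longlongrightarrow> 0) (at (0::real))"
      proof (rule Lim_null_comparison)
        show "eventually (\<lambda>z. norm (max 0 z ^ Suc k * \<bar>z\<bar> / z) \<le> max 0 z ^ Suc k) (at (0::real))"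
          by (auto simp: abs_mult power_abs intro!: always_eventually)
        have "((\<lambda>z::real. max 0 z ^ Suc k) \<longlongrightarrow> max 0 0 ^ Suc k) (at 0)"
          by (intro tendsto_intros)
        then show "((\<lambda>z::real. max 0 z ^ Suc k) \<longlongrightarrow> 0) (at 0)" by simp
      qed
      moreover have "max 0 z ^ Suc (Suc k) / z = max 0 z ^ Suc k * \<bar>z\<bar> / z" for z :: real
        by (simp add: max_def)
      ultimately have "((\<lambda>z::real. max 0 z ^ Suc (Suc k) / z) \<longlongrightarrow> 0) (at 0)" by (simp only:)
      then show ?thesis using True by (simp add: DERIV_def)
    qed
    from has_derivative_compose[OF qd this[of "q x", unfolded has_field_derivative_def]]
    show ?thesis .
  qed
  have "Ck_on k U (\<lambda>x. real (Suc (Suc k)) * ?p x ^ Suc k * partial_deriv b q x)" if "b \<in> Basis" for b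
    using q[of "Suc k"] that by (intro Ck_on_mult Ck_on_const U Suc) auto
  moreover have "partial_deriv b (\<lambda>x. ?p x ^ Suc (Suc k)) x = real (Suc (Suc k)) * ?p x ^ Suc k * partial_deriv b q x"
    if "x \<in> U" "b \<in> Basis" for b x
  proof -
    have "q differentiable at x" using q[of 1] that by auto
    from partial_deriv_eq[OF has_derivative_dir_deriv[OF this]] partial_deriv_eq[OF D[OF that(1)]]
    show ?thesis by simp
  qed
  ultimately have "Ck_on k U (partial_deriv b (\<lambda>x. ?p x ^ Suc (Suc k)))" if "b \<in> Basis" for b
    using Ck_on_cong[OF U, of "partial_deriv b (\<lambda>x. ?p x ^ Suc (Suc k))" "\<lambda>x. real (Suc (Suc k)) * ?p x ^ Suc k * partial_deriv b q x"] that
    by blast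
  then show ?case using D unfolding Ck_on.simps differentiable_def by blast
qed

text \<open>The cutoff is \<open>A / (A + B)\<close>, where \<open>A\<close> and \<open>B\<close>
  are powers of positive parts of differences of squared radii. A cutoff of class \<open>C^k\<close>
  suffices, since only finitely many derivatives are used at a time.\<close>

lemma smooth_extension:
  assumes U: "open U" "cball 0 1 \<subseteq> U" and f: "Ck_on k U f"
  obtains g \<delta> where "Ck_on k UNIV g" "\<And>x. 2 < cmod x \<Longrightarrow> g x = 0" "1 < \<delta>" "\<And>x. cmod x < \<delta> \<Longrightarrow> x \<in> U \<and> g x = f x"
proof -
  obtain \<epsilon> where \<epsilon>: "\<epsilon> > 0" "(\<Union>x\<in>cball (0::complex) 1. cball x \<epsilon>) \<subseteq> U"
    using compact_subset_open_imp_cball_epsilon_subset[OF compact_cball U] by blast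
  define e where "e = min \<epsilon> 1"
  \<comment> \<open>Capping the margin at 1 keeps the support within radius 2.\<close>
  have e: "0 < e" "e \<le> 1" "e \<le> \<epsilon>" using \<epsilon>(1) by (auto simp: e_def)
  have inU: "x \<in> U" if x: "cmod x \<le> 1 + e" for x
  proof (cases "cmod x \<le> 1")
    case True
    then show ?thesis using U(2) by auto
  next
    case False
    define y where "y = x / of_real (cmod x)"
    have "y \<in> cball 0 1" using False by (auto simp: y_def norm_divide)
    moreover have "x \<in> cball y \<epsilon>"
    proof -
      have "x \<noteq> 0" using False by auto
      then have "y - x = y * of_real (1 - cmod x)" by (simp add: y_def field_simps)
      then have "cmod (y - x) = cmod y * \<bar>1 - cmod x\<bar>" by (simp only: norm_mult norm_of_real)
      moreover have "cmod y = 1" using False by (auto simp: y_def norm_divide)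
      ultimately show ?thesis using x e False by (simp add: dist_norm)
    qed
    ultimately show ?thesis using \<epsilon>(2) by blast
  qed
  \<comment> \<open>The cutoff is 1 below \<open>r1\<close> and 0 from \<open>r2\<close> on; as
    \<open>r1 < r2\<close>, the functions \<open>A\<close> and \<open>B\<close> never vanish
    together.\<close>
  define r1 r2 where "r1 = 1 + e / 3" "r2 = 1 + 2 * e / 3"
  note r = r1_r2_def
  have r12: "1 < r1" "r1 < r2" "r2 < 1 + e" "r2 < 2" using e by (auto simp: r)
  define N where "N = (\<lambda>x. Re x ^ 2 + Im x ^ 2)"
  have N: "N x = (cmod x)\<^sup>2" for x by (simp add: N_def cmod_power2)
  have NC: "Ck_on l UNIV N" for l
    unfolding N_def by (intro Ck_on_add Ck_on_power Ck_on_Re Ck_on_Im open_UNIV)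
  define A where "A x = max 0 (r2\<^sup>2 - N x) ^ Suc k" for x
  define B where "B x = max 0 (N x - r1\<^sup>2) ^ Suc k" for x
  have AC: "Ck_on k UNIV A" unfolding A_def
    by (rule Ck_on_pos_part_power) (auto intro: Ck_on_diff NC)
  have BC: "Ck_on k UNIV B" unfolding B_def
    by (rule Ck_on_pos_part_power) (auto intro: Ck_on_diff NC)
  have r_sq: "r1\<^sup>2 < r2\<^sup>2" using r12 by (intro power_strict_mono) auto
  have AB: "A x + B x \<noteq> 0" for x
  proof -
    have "A x \<ge> 0" "B x \<ge> 0" by (simp_all add: A_def B_def)
    moreover have "A x > 0 \<or> B x > 0" using r_sq unfolding A_def B_def
      by (cases "N x < r2\<^sup>2") (auto intro!: zero_less_power)
    ultimately show ?thesis by linarith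
  qed
  define \<psi> where "\<psi> x = A x * inverse (A x + B x)" for x
  have \<psi>: "Ck_on k UNIV \<psi>"
    unfolding \<psi>_def by (intro Ck_on_mult Ck_on_inverse Ck_on_add AC BC open_UNIV) (simp add: AB)
  have \<psi>0: "\<psi> x = 0" if "r2 \<le> cmod x" for x
  proof -
    have "r2\<^sup>2 \<le> N x" unfolding N using that r12 by (intro power_mono) auto
    then show ?thesis by (simp add: \<psi>_def A_def)
  qed
  have \<psi>1: "\<psi> x = 1" if "cmod x < r1" for x
  proof -
    have "N x \<le> r1\<^sup>2" unfolding N using that r12 by (intro power_mono) auto
    then have "B x = 0" by (simp add: B_def)
    then show ?thesis using AB[of x] by (simp add: \<psi>_def)
  qed
  define g where "g x = (if cmod x < 1 + e then \<psi> x * f x else 0)" for x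
  have "Ck_on k (ball 0 (1 + e)) g"
  proof -
    have "Ck_on k (ball 0 (1 + e)) (\<lambda>x. \<psi> x * f x)"
      by (intro Ck_on_mult open_ball Ck_on_subset[OF \<psi>] Ck_on_subset[OF f]) (auto intro: inU)
    then show ?thesis by (subst Ck_on_cong[OF open_ball, of _ _ _ "\<lambda>x. \<psi> x * f x"]) (auto simp: g_def)
  qed
  moreover have op: "open (- cball (0::complex) r2)" by (intro open_Compl closed_cball)
  moreover have "Ck_on k (- cball 0 r2) g"
    by (subst Ck_on_cong[OF op, of _ "\<lambda>x. 0"]) (auto simp: g_def \<psi>0)
  ultimately have "Ck_on k (ball 0 (1 + e) \<union> - cball 0 r2) g"
    by (intro Ck_on_Un) auto
  \<comment> \<open>The open sets overlap in an annulus where the cutoff is already 0, so smoothness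
    can be checked on each separately.\<close>
  moreover have "ball 0 (1 + e) \<union> - cball 0 r2 = (UNIV :: complex set)" using r12 by auto
  ultimately have "Ck_on k UNIV g" by simp
  moreover have "g x = 0" if "2 < cmod x" for x using that e by (simp add: g_def)
  moreover have "x \<in> U \<and> g x = f x" if "cmod x < r1" for x
    using that r12 inU[of x] \<psi>1[OF that] by (auto simp: g_def)
  ultimately show ?thesis using that[of g r1] r12 by blast
qed

section \<open>Convergence\<close>

lemma partial_deriv_pow_sum_cmult:
  assumes "\<And>i l. i \<in> I \<Longrightarrow> Ck_on l UNIV (f i)" "b \<in> Basis"
  shows "(partial_deriv b ^^ m) (\<lambda>x. \<Sum>i\<in>I. c i * f i x) = (\<lambda>x. \<Sum>i\<in>I. c i * (partial_deriv b ^^ m) (f i) x)"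
proof (induction m)
  case (Suc m)
  show ?case
  proof (rule ext)
    fix x
    have "(partial_deriv b ^^ m) (f i) differentiable at x" if "i \<in> I" for i
      using Ck_on_partial_deriv_pow[OF assms(1)[OF that, of "m + 1"] assms(2)] by auto
    then have "partial_deriv b (\<lambda>x. \<Sum>i\<in>I. c i * (partial_deriv b ^^ m) (f i) x) x =
      (\<Sum>i\<in>I. c i * partial_deriv b ((partial_deriv b ^^ m) (f i)) x)"
      by (rule partial_deriv_sum_cmult[where f="\<lambda>i. (partial_deriv b ^^ m) (f i)"])
    then show "(partial_deriv b ^^ Suc m) (\<lambda>x. \<Sum>i\<in>I. c i * f i x) x = (\<Sum>i\<in>I. c i * (partial_deriv b ^^ Suc m) (f i) x)"
      by (simp add: Suc)
  qed
qed simp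

lemma multi_deriv_sum_cmult:
  assumes "\<And>i l. i \<in> I \<Longrightarrow> Ck_on l UNIV (f i)"
  shows "multi_deriv \<beta> (\<lambda>x. \<Sum>i\<in>I. c i * f i x) x = (\<Sum>i\<in>I. c i * multi_deriv \<beta> (f i) x)"
proof -
  have B: "1 \<in> (Basis :: complex set)" "\<i> \<in> (Basis :: complex set)" by (auto simp: Basis_complex_def)
  have 1: "(partial_deriv \<i> ^^ snd \<beta>) (\<lambda>x. \<Sum>i\<in>I. c i * f i x) = (\<lambda>x. \<Sum>i\<in>I. c i * (partial_deriv \<i> ^^ snd \<beta>) (f i) x)"
    by (rule partial_deriv_pow_sum_cmult[OF assms B(2)])
  have "Ck_on l UNIV ((partial_deriv \<i> ^^ snd \<beta>) (f i))" if "i \<in> I" for i l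
    by (rule Ck_on_partial_deriv_pow[OF assms[OF that] B(2)])
  from partial_deriv_pow_sum_cmult[OF this B(1), where c=c and m="fst \<beta>" and I=I]
  show ?thesis unfolding multi_deriv_def 1 by (simp only:)
qed

lemma multi_deriv_add:
  assumes "\<And>l. Ck_on l UNIV f" "\<And>l. Ck_on l UNIV g"
  shows "multi_deriv \<beta> (\<lambda>x. f x + g x) x = multi_deriv \<beta> f x + multi_deriv \<beta> g x"
  \<comment> \<open>A sum of two functions is treated as a sum indexed by the booleans.\<close>
  using multi_deriv_sum_cmult[of UNIV "\<lambda>b. if b then f else g" \<beta> "\<lambda>_. 1" x] assms
  by (simp add: UNIV_bool add.commute)

text \<open>Agreement on an open neighbourhood of the disk also gives agreement of the derivatives
  along the segments, which lie in the disk by convexity.\<close>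

lemma kergin_cong:
  assumes U: "open U" "cball 0 1 \<subseteq> U" "\<And>x. x \<in> U \<Longrightarrow> f x = g x" and a: "\<And>j. cmod (a j) \<le> 1"
  shows "kergin d a f = kergin d a g"
proof
  fix x
  have "segment_functional (a s) (a t) (dir_deriv y f) = segment_functional (a s) (a t) (dir_deriv y g)" for s t y
    unfolding segment_functional_def
  proof (rule Henstock_Kurzweil_Integration.integral_cong)
    fix \<tau> :: real assume "\<tau> \<in> {0..1}"
    then have "a s + \<tau> *\<^sub>R (a t - a s) \<in> U" using U(2) segment_point_in_disc[OF a a] by auto
    then show "dir_deriv y f (a s + \<tau> *\<^sub>R (a t - a s)) = dir_deriv y g (a s + \<tau> *\<^sub>R (a t - a s))"
      unfolding dir_deriv_def using partial_deriv_cong[OF U(1) _ U(3)] by simp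
  qed
  moreover have "f (a j) = g (a j)" for j using U(2,3) a[of j] by auto
  ultimately show "kergin d a f x = kergin d a g x" by (simp add: kergin_def)
qed

text \<open>The segment functional is at most the distance of the two nodes times
  \<open>2 * \<eta>\<close>, one \<open>\<eta>\<close> per coordinate, and this distance cancels the
  inverse distance in \<open>kergin_PP\<close>. In the constant, \<open>5 = 1 + 4\<close>: one from
  the nodes and four from the pairs, of which there are at most \<open>d\<^sup>2\<close>.\<close>

lemma kergin_stability:
  assumes a: "inj a" "\<And>m. cmod (a m) = 1"
    and M: "\<And>j z. j < d \<Longrightarrow> cmod z \<le> 1 \<Longrightarrow> cmod (lagrange d a j z) \<le> M" "1 \<le> M"
    and h: "Ck_on 1 UNIV h" "\<And>z. cmod z \<le> 1 \<Longrightarrow> \<bar>h z\<bar> \<le> \<eta>"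
      "\<And>b z. b \<in> Basis \<Longrightarrow> cmod z \<le> 1 \<Longrightarrow> \<bar>partial_deriv b h z\<bar> \<le> \<eta>"
    and x: "cmod x \<le> 1"
  shows "\<bar>multi_deriv (m, n) (kergin d a h) x\<bar> \<le> 5 * (12 * (real d + 1)\<^sup>2) ^ (m + n) * M\<^sup>2 * (real d)\<^sup>2 * \<eta>"
    and "Ck_on l UNIV (kergin d a h)"
proof -
  define c where "c = (12 * (real d + 1)\<^sup>2) ^ (m + n)"
  have c: "c \<ge> 0" by (simp add: c_def)
  have \<eta>: "\<eta> \<ge> 0" using order_trans[OF abs_ge_zero h(2)[of 0]] by simp
  define S where "S s t = segment_functional (a s) (a t) (dir_deriv (perp (a s - a t)) h)" for s t
  have S: "\<bar>S s t\<bar> \<le> cmod (a s - a t) * (2 * \<eta>)" for s t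
  proof -
    let ?y = "perp (a s - a t)"
    have "norm (integral {0..1} (\<lambda>\<tau>. dir_deriv ?y h (a s + \<tau> *\<^sub>R (a t - a s)))) \<le>
        integral {0..1} (\<lambda>\<tau>::real. cmod (a s - a t) * (2 * \<eta>))"
    proof (rule integral_norm_bound_integral)
      show "(\<lambda>\<tau>. dir_deriv ?y h (a s + \<tau> *\<^sub>R (a t - a s))) integrable_on {0..1}"
        using dir_deriv_segment_continuous[OF subset_UNIV h(1), of "a s" "a t"] a(2)
        by (intro integrable_continuous_real) simp
      fix \<tau> :: real assume "\<tau> \<in> {0..1}"
      then have z: "cmod (a s + \<tau> *\<^sub>R (a t - a s)) \<le> 1" using segment_point_in_disc a(2) by simp
      let ?z = "a s + \<tau> *\<^sub>R (a t - a s)"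
      have "\<bar>dir_deriv ?y h ?z\<bar> \<le> (\<Sum>b\<in>Basis. \<bar>partial_deriv b h ?z * (?y \<bullet> b)\<bar>)"
        unfolding dir_deriv_def by (rule sum_abs)
      also have "\<dots> \<le> (\<Sum>b\<in>(Basis::complex set). \<eta> * cmod ?y)"
        unfolding abs_mult using h(3)[OF _ z] \<eta> by (intro sum_mono mult_mono Basis_le_norm) auto
      also have "\<dots> = cmod (a s - a t) * (2 * \<eta>)" by (simp add: Basis_complex_def norm_perp)
      finally show "norm (dir_deriv ?y h ?z) \<le> cmod (a s - a t) * (2 * \<eta>)" by simp
    qed (rule integrable_const_ivl)
    then show ?thesis by (simp add: S_def segment_functional_def)
  qed
  let ?I = "Sigma {..<d} (\<lambda>t. {..<t})"
  let ?F = "\<lambda>x. \<Sum>j<d. h (a j) * kergin_P d a j x"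
  let ?G = "\<lambda>x. \<Sum>i\<in>?I. S (snd i) (fst i) * kergin_PP d a (snd i) (fst i) x"
  have eq: "kergin d a h = (\<lambda>x. ?F x + ?G x)"
    by (simp add: fun_eq_iff kergin_def S_def sum.Sigma case_prod_unfold mult.commute)
  have Psm: "Ck_on l UNIV (kergin_P d a j)" for l j unfolding kergin_P_ridge by (rule Ck_on_ridge)
  have PPsm: "Ck_on l UNIV (kergin_PP d a (snd i) (fst i))" if "i \<in> ?I" for l i
  proof -
    have st: "snd i < d" "fst i < d" "snd i \<noteq> fst i" using that by auto
    have "a (snd i) \<noteq> a (fst i)" using st a(1) by (auto simp: inj_def)
    show ?thesis unfolding kergin_PP_ridge[OF st \<open>a (snd i) \<noteq> a (fst i)\<close>]
      by (intro Ck_on_cmult Ck_on_ridge open_UNIV)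
  qed
  have F: "Ck_on l UNIV ?F" for l by (intro Ck_on_sum Ck_on_cmult Psm open_UNIV)
  have G: "Ck_on l UNIV ?G" for l
    by (rule Ck_on_sum[OF open_UNIV], rule Ck_on_cmult[OF open_UNIV], rule PPsm)
  show "Ck_on l UNIV (kergin d a h)" unfolding eq by (rule Ck_on_add[OF open_UNIV F G])
  have "multi_deriv (m, n) (kergin d a h) x =
    (\<Sum>j<d. h (a j) * multi_deriv (m, n) (kergin_P d a j) x) +
    (\<Sum>i\<in>?I. S (snd i) (fst i) * multi_deriv (m, n) (kergin_PP d a (snd i) (fst i)) x)"
    unfolding eq multi_deriv_add[OF F G]
    by (intro arg_cong2[where f="(+)"] multi_deriv_sum_cmult Psm PPsm)
  also have "\<bar>\<dots>\<bar> \<le> real d * (\<eta> * (c * M)) + (real d)\<^sup>2 * (2 * \<eta> * (c * (2 * M\<^sup>2)))"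
  proof (rule order_trans[OF abs_triangle_ineq add_mono])
    have "\<bar>\<Sum>j<d. h (a j) * multi_deriv (m, n) (kergin_P d a j) x\<bar> \<le> (\<Sum>j<d. \<eta> * (c * M))"
      unfolding c_def using kergin_multi_deriv_bound(1)[OF a M(1) x] h(2) a(2) \<eta>
      by (intro order_trans[OF sum_abs] sum_mono) (auto simp: abs_mult intro!: mult_mono)
    then show "\<bar>\<Sum>j<d. h (a j) * multi_deriv (m, n) (kergin_P d a j) x\<bar> \<le> real d * (\<eta> * (c * M))" by simp
    have "\<bar>\<Sum>i\<in>?I. S (snd i) (fst i) * multi_deriv (m, n) (kergin_PP d a (snd i) (fst i)) x\<bar> \<le>
       (\<Sum>i\<in>?I. 2 * \<eta> * (c * (2 * M\<^sup>2)))"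
    proof (intro order_trans[OF sum_abs] sum_mono)
      fix i assume "i \<in> ?I"
      then have st: "snd i < d" "fst i < d" "snd i \<noteq> fst i" by auto
      let ?D = "multi_deriv (m, n) (kergin_PP d a (snd i) (fst i)) x"
      have "\<bar>S (snd i) (fst i) * ?D\<bar> \<le> (cmod (a (snd i) - a (fst i)) * (2 * \<eta>)) * \<bar>?D\<bar>"
        unfolding abs_mult by (intro mult_right_mono S) simp
      also have "\<dots> = 2 * \<eta> * (\<bar>?D\<bar> * cmod (a (snd i) - a (fst i)))" by (simp add: mult_ac)
      also have "\<dots> \<le> 2 * \<eta> * (c * (2 * M\<^sup>2))"
        unfolding c_def using kergin_multi_deriv_bound(2)[OF a M(1) x st] \<eta> by (intro mult_left_mono) auto
      finally show "\<bar>S (snd i) (fst i) * ?D\<bar> \<le> 2 * \<eta> * (c * (2 * M\<^sup>2))" .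
    qed
    also have "\<dots> = real (card ?I) * (2 * \<eta> * (c * (2 * M\<^sup>2)))" by simp
    also have "\<dots> \<le> (real d)\<^sup>2 * (2 * \<eta> * (c * (2 * M\<^sup>2)))"
    proof (rule mult_right_mono)
      have "card ?I \<le> card ({..<d} \<times> {..<d})" by (intro card_mono) auto
      then have "card ?I \<le> d * d" by (simp add: card_cartesian_product)
      then show "real (card ?I) \<le> (real d)\<^sup>2"
        by (simp only: power2_eq_square of_nat_mult[symmetric] of_nat_le_iff)
    qed (use \<eta> c in simp)
    finally show "\<bar>\<Sum>i\<in>?I. S (snd i) (fst i) * multi_deriv (m, n) (kergin_PP d a (snd i) (fst i)) x\<bar> \<le>
      (real d)\<^sup>2 * (2 * \<eta> * (c * (2 * M\<^sup>2)))" .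
  qed
  also have "\<dots> \<le> (real d)\<^sup>2 * (\<eta> * (c * M\<^sup>2)) + (real d)\<^sup>2 * (2 * \<eta> * (c * (2 * M\<^sup>2)))"
  proof (intro add_right_mono mult_mono mult_left_mono)
    show "real d \<le> (real d)\<^sup>2" by (cases d) (auto simp: power2_eq_square)
    show "M \<le> M\<^sup>2" using M(2) by (simp add: power2_eq_square)
  qed (use c \<eta> M(2) in auto)
  finally show "\<bar>multi_deriv (m, n) (kergin d a h) x\<bar> \<le> 5 * (12 * (real d + 1)\<^sup>2) ^ (m + n) * M\<^sup>2 * (real d)\<^sup>2 * \<eta>"
    unfolding c_def by (simp add: algebra_simps)
qed

lemma tendsto_log_square_over_self: "((\<lambda>d. (1 + log 2 (real d))\<^sup>2 / real d) \<longlongrightarrow> 0) sequentially"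
proof -
  have lim: "((\<lambda>d. (1 / real d powr (1/2) + ln (real d) / real d powr (1/2) * (1 / ln 2))\<^sup>2) \<longlongrightarrow> (0 + 0 * (1 / ln 2))\<^sup>2) sequentially"
    by (intro tendsto_intros lim_ln_over_power lim_1_over_real_power) auto
  have eq: "(1 / real d powr (1/2) + ln (real d) / real d powr (1/2) * (1 / ln 2))\<^sup>2 = (1 + log 2 (real d))\<^sup>2 / real d" for d
  proof -
    have "1 / real d powr (1/2) + ln (real d) / real d powr (1/2) * (1 / ln 2) = (1 + log 2 (real d)) / real d powr (1/2)"
      by (simp add: log_def add_divide_distrib)
    moreover have "(real d powr (1/2))\<^sup>2 = real d" by (simp add: powr_half_sqrt)
    ultimately show ?thesis by (simp only: power_divide)
  qed
  show ?thesis using lim unfolding eq by simp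
qed

lemma kergin_leja_convergence:
  assumes L: "leja_sequence (cball 0 1) e" and e0: "e 0 = 1"
    and f: "Ck_near (max 1 (m + n) + (2 * (m + n) + 3)) (cball 0 1) f"
  shows "uniform_limit (cball 0 1) (\<lambda>d. multi_deriv (m, n) (kergin d e f)) (multi_deriv (m, n) f) sequentially"
proof -
  \<comment> \<open>Markov's inequality costs \<open>d^(2 (m + n))\<close> and stability
    \<open>d\<^sup>2\<close>; one more power of \<open>d\<close> beats the squared
    logarithm.\<close>
  define r where "r = 2 * (m + n) + 3"
  \<comment> \<open>First derivatives and the derivative of order \<open>m + n\<close> must all be
    approximated at rate \<open>r\<close>.\<close>
  define k where "k = max 1 (m + n) + r"
  note inj = leja_inj[OF L] and nrm = leja_norm[OF L e0]
  have nle: "cmod (e j) \<le> 1" for j using leja_norm[OF L e0, of j] by simp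
  obtain U where U: "open U" "cball 0 1 \<subseteq> U" "Ck_on k U f"
    using f unfolding Ck_near_def k_def r_def by blast
  obtain g \<delta> where g: "Ck_on k UNIV g" "\<And>x. 2 < cmod x \<Longrightarrow> g x = 0" and \<delta>: "1 < \<delta>" "\<And>x. cmod x < \<delta> \<Longrightarrow> x \<in> U \<and> g x = f x"
    by (rule smooth_extension[OF U]) blast
  have fg: "f x = g x" if "x \<in> ball 0 \<delta>" for x using \<delta>(2)[of x] that by simp
  have sub: "cball 0 1 \<subseteq> ball (0::complex) \<delta>" using \<delta>(1) by auto
  have kf: "kergin d e f = kergin d e g" for d
    by (rule kergin_cong[OF open_ball sub fg nle])
  have mf: "multi_deriv (m, n) f x = multi_deriv (m, n) g x" if "cmod x \<le> 1" for x
  proof -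
    have "x \<in> ball 0 \<delta>" using that \<delta>(1) by simp
    then show ?thesis by (rule multi_deriv_cong[OF open_ball _ fg])
  qed
  obtain C where C: "\<And>\<beta>. 0 \<le> C \<beta>"
    "\<And>n. \<exists>c. \<forall>p q x. p + q + r \<le> k \<longrightarrow> cmod x \<le> 1 \<longrightarrow>
       \<bar>multi_deriv (p, q) g x - multi_deriv (p, q) (\<lambda>z. \<Sum>i\<le>4 * n * (r + 1). \<Sum>j\<le>4 * n * (r + 1). c i j * (Re z ^ i * Im z ^ j)) x\<bar>
         \<le> C (p, q) / (real n + 1) ^ r"
    by (rule jackson_approximation[OF g, of r], assumption, rule that, assumption+)
  \<comment> \<open>One constant for the value, the two first partials and the derivative whose
    convergence is claimed.\<close>
  define C' where "C' = C (0, 0) + C (1, 0) + C (0, 1) + C (m, n)"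
  have C': "0 \<le> C'" "C (0, 0) \<le> C'" "C (1, 0) \<le> C'" "C (0, 1) \<le> C'" "C (m, n) \<le> C'"
    using C(1)[of "(0, 0)"] C(1)[of "(1, 0)"] C(1)[of "(0, 1)"] C(1)[of "(m, n)"] by (auto simp: C'_def)
  \<comment> \<open>The approximant with parameter \<open>N\<close> has degree at most
    \<open>4 * N * (r + 1)\<close> in each variable, hence total degree at most
    \<open>q * N\<close>.\<close>
  define q where "q = 8 * (r + 1)"
  define A where "A = (5 * 48 ^ (m + n) + 1) * C' * real q ^ r"
  have bound: "\<bar>multi_deriv (m, n) (kergin d e f) x - multi_deriv (m, n) f x\<bar> \<le> A * ((1 + log 2 d)\<^sup>2 / d)"
    if d: "d \<ge> 1" and x: "cmod x \<le> 1" for d x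
  proof -
    define M where "M = 1 + log 2 d"
    have M: "1 \<le> M" using d by (simp add: M_def)
    \<comment> \<open>The largest parameter with total degree bound at most \<open>d - 1\<close>;
      being largest, it also satisfies \<open>d \<le> q * (N + 1)\<close>, which converts the rate
      in \<open>N\<close> into one in \<open>d\<close>.\<close>
    define N where "N = (d - 1) div q"
    have q0: "q > 0" by (simp add: q_def)
    have "N * q \<le> d - 1" unfolding N_def by (rule div_times_less_eq_dividend)
    then have deg: "4 * N * (r + 1) + 4 * N * (r + 1) < d" using d by (simp add: q_def algebra_simps)
    have "d - 1 < q * (N + 1)" unfolding N_def using q0 dividend_less_div_times[of q "d - 1"] by (simp add: algebra_simps)
    then have "real d \<le> real (q * (N + 1))" using d by (simp only: of_nat_le_iff)
    then have dN: "real d \<le> real q * (real N + 1)" by (simp add: distrib_left add.commute)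
    obtain c where c: "\<And>p q x. p + q + r \<le> k \<Longrightarrow> cmod x \<le> 1 \<Longrightarrow>
       \<bar>multi_deriv (p, q) g x - multi_deriv (p, q) (\<lambda>z. \<Sum>i\<le>4 * N * (r + 1). \<Sum>j\<le>4 * N * (r + 1). c i j * (Re z ^ i * Im z ^ j)) x\<bar>
         \<le> C (p, q) / (real N + 1) ^ r" using C(2)[of N] by blast
    define Q where "Q = (\<lambda>z. \<Sum>i\<le>4 * N * (r + 1). \<Sum>j\<le>4 * N * (r + 1). c i j * (Re z ^ i * Im z ^ j))"
    note c = c[folded Q_def]
    have QC: "Ck_on l UNIV Q" for l
      unfolding Q_def
      by (intro Ck_on_sum[OF open_UNIV] Ck_on_cmult[OF open_UNIV] Ck_on_mult[OF open_UNIV] Ck_on_power[OF open_UNIV] Ck_on_Re Ck_on_Im)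
    define \<eta> where "\<eta> = C' / (real N + 1) ^ r"
    have le_\<eta>: "\<bar>multi_deriv (p, q) g x - multi_deriv (p, q) Q x\<bar> \<le> \<eta>"
      if "p + q + r \<le> k" "C (p, q) \<le> C'" "cmod x \<le> 1" for p q x
      using c[OF that(1,3)] divide_right_mono[OF that(2), of "(real N + 1) ^ r"] by (simp add: \<eta>_def)
    define h where "h = (\<lambda>x. 1 * g x + (- 1) * Q x)"
    have g1: "Ck_on 1 UNIV g" by (rule Ck_on_le[OF g(1)]) (simp add: k_def)
    have kN: "0 + 0 + r \<le> k" "1 + 0 + r \<le> k" "0 + 1 + r \<le> k" "m + n + r \<le> k" by (simp_all add: k_def)
    have h1: "Ck_on 1 UNIV h" unfolding h_def by (intro Ck_on_add Ck_on_cmult QC g1 open_UNIV)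
    have hk: "kergin d e h y = 1 * kergin d e g y + (- 1) * kergin d e Q y" for y
      unfolding h_def by (rule kergin_lincomb[OF open_UNIV subset_UNIV g1 QC nle])
    have "kergin d e Q y = Q y" for y
      unfolding Q_def by (rule kergin_polynomial[OF inj nrm deg])
    \<comment> \<open>Since \<open>Q\<close> is reproduced, the error is the interpolant of the
      small function \<open>h\<close> minus \<open>h\<close> itself.\<close>
    then have eq: "kergin d e f = (\<lambda>y. kergin d e h y + Q y)"
      unfolding kf by (simp add: hk fun_eq_iff)
    have stab: "\<bar>multi_deriv (m, n) (kergin d e h) x\<bar> \<le> 5 * (12 * (real d + 1)\<^sup>2) ^ (m + n) * M\<^sup>2 * (real d)\<^sup>2 * \<eta>"
      and hsm: "Ck_on l UNIV (kergin d e h)" for l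
    proof -
      have 1: "\<bar>h z\<bar> \<le> \<eta>" if "cmod z \<le> 1" for z
        using le_\<eta>[OF kN(1) C'(2) that] by (simp add: h_def multi_deriv_def)
      have 2: "\<bar>partial_deriv b h z\<bar> \<le> \<eta>" if b: "b \<in> Basis" and z: "cmod z \<le> 1" for b z
      proof -
        have dd: "g differentiable at z" "Q differentiable at z" using g1 QC[of 1] by auto
        have "partial_deriv b h z = partial_deriv b g z - partial_deriv b Q z"
          unfolding h_def using partial_deriv_add[of "\<lambda>x. 1 * g x" z "\<lambda>x. (- 1) * Q x" b]
            partial_deriv_mult[OF differentiable_const dd(2), of b "- 1"] dd by simp
        then show ?thesis
          using b le_\<eta>[OF kN(2) C'(3) z] le_\<eta>[OF kN(3) C'(4) z] by (auto simp: Basis_complex_def multi_deriv_def)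
      qed
      have lag: "cmod (lagrange d e j z) \<le> M" if "j < d" "cmod z \<le> 1" for j z
        unfolding M_def by (rule leja_lagrange_le[OF L e0 that])
      show "\<bar>multi_deriv (m, n) (kergin d e h) x\<bar> \<le> 5 * (12 * (real d + 1)\<^sup>2) ^ (m + n) * M\<^sup>2 * (real d)\<^sup>2 * \<eta>"
        by (rule kergin_stability(1)[OF inj nrm lag M h1 1 2 x])
      show "Ck_on l UNIV (kergin d e h)" by (rule kergin_stability(2)[OF inj nrm lag M h1 1 2 x])
    qed
    have "multi_deriv (m, n) (kergin d e f) x = multi_deriv (m, n) (kergin d e h) x + multi_deriv (m, n) Q x"
      unfolding eq by (rule multi_deriv_add[OF hsm QC])
    then have "\<bar>multi_deriv (m, n) (kergin d e f) x - multi_deriv (m, n) f x\<bar> \<le>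
        5 * (12 * (real d + 1)\<^sup>2) ^ (m + n) * M\<^sup>2 * (real d)\<^sup>2 * \<eta> + \<eta>"
      using stab le_\<eta>[OF kN(4) C'(5) x] mf[OF x] by linarith
    also have "\<dots> \<le> 5 * (48 * (real d)\<^sup>2) ^ (m + n) * M\<^sup>2 * (real d)\<^sup>2 * (C' * real q ^ r / real d ^ r) + M\<^sup>2 * (real d ^ (2 * (m + n) + 2) * (C' * real q ^ r / real d ^ r))"
    proof -
      have "real d ^ r \<le> (real q * (real N + 1)) ^ r" using dN by (intro power_mono) auto
      then have "C' * real d ^ r \<le> C' * real q ^ r * (real N + 1) ^ r"
        using C'(1) by (simp add: power_mult_distrib mult_left_mono mult.assoc)
      then have \<eta>_le: "\<eta> \<le> C' * real q ^ r / real d ^ r"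
        using d by (simp add: \<eta>_def divide_simps)
      have \<eta>0: "0 \<le> \<eta>" using C'(1) by (simp add: \<eta>_def)
      have "(real d + 1)\<^sup>2 \<le> (2 * real d)\<^sup>2" using d by (intro power_mono) auto
      then have "12 * (real d + 1)\<^sup>2 \<le> 48 * (real d)\<^sup>2" by (simp add: power_mult_distrib)
      then have p: "(12 * (real d + 1)\<^sup>2) ^ (m + n) \<le> (48 * (real d)\<^sup>2) ^ (m + n)" by (intro power_mono) auto
      \<comment> \<open>The lone \<open>\<eta>\<close> is inflated by factors at least 1, so that
        both terms become multiples of \<open>M\<^sup>2 / d\<close>.\<close>
      have "1 * (1 * \<eta>) \<le> M\<^sup>2 * (real d ^ (2 * (m + n) + 2) * (C' * real q ^ r / real d ^ r))"
        using M d \<eta>_le \<eta>0 by (intro mult_mono one_le_power) auto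
      moreover have "5 * (12 * (real d + 1)\<^sup>2) ^ (m + n) * M\<^sup>2 * (real d)\<^sup>2 * \<eta> \<le>
          5 * (48 * (real d)\<^sup>2) ^ (m + n) * M\<^sup>2 * (real d)\<^sup>2 * (C' * real q ^ r / real d ^ r)"
        using p \<eta>_le \<eta>0 by (intro mult_mono mult_left_mono mult_right_mono) auto
      ultimately show ?thesis by simp
    qed
    also have "\<dots> = A * (M\<^sup>2 / d)"
    proof -
      have r: "real d ^ r = real d ^ (2 * (m + n)) * (real d)\<^sup>2 * real d"
        by (simp add: r_def power_add power3_eq_cube power2_eq_square)
      have p1: "(48 * (real d)\<^sup>2) ^ (m + n) = 48 ^ (m + n) * real d ^ (2 * (m + n))"
        by (simp only: power_mult_distrib power_mult[symmetric])
      have p2: "real d ^ (2 * (m + n) + 2) = real d ^ (2 * (m + n)) * (real d)\<^sup>2" by (simp only: power_add)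
      have A: "A = (5 * 48 ^ (m + n) + 1) * (C' * real q ^ r)" by (simp add: A_def)
      have cancel: "5 * (a * D) * m2 * d2 * (E / (D * d2 * d1)) + m2 * (D * d2 * (E / (D * d2 * d1))) = (5 * a + 1) * E * (m2 / d1)"
        if "D \<noteq> 0" "d2 \<noteq> 0" "d1 \<noteq> 0" for a D m2 d2 E d1 :: real
        using that by (simp add: field_simps)
      show ?thesis unfolding p1 p2 A by (subst (1 2) r, rule cancel) (use d in auto)
    qed
    finally show ?thesis by (simp add: M_def)
  qed
  have "((\<lambda>d. A * ((1 + log 2 (real d))\<^sup>2 / real d)) \<longlongrightarrow> 0) sequentially"
    using tendsto_mult_left[OF tendsto_log_square_over_self, of A] by simp
  then have lim: "eventually (\<lambda>d. A * ((1 + log 2 (real d))\<^sup>2 / real d) < \<epsilon>) sequentially" if "\<epsilon> > 0" for \<epsilon>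
    using that by (rule order_tendstoD(2))
  show ?thesis
  proof (rule uniform_limitI)
    fix \<epsilon> :: real assume "\<epsilon> > 0"
    show "\<forall>\<^sub>F d in sequentially. \<forall>x\<in>cball 0 1. dist (multi_deriv (m, n) (kergin d e f) x) (multi_deriv (m, n) f x) < \<epsilon>"
      using lim[OF \<open>\<epsilon> > 0\<close>] eventually_ge_at_top[of 1]
    proof eventually_elim
      case (elim d)
      then show ?case using bound[of d] by (fastforce simp: dist_real_def)
    qed
  qed
qed

theorem theorem4p3:
  fixes e :: "nat \<Rightarrow> complex"
  assumes "leja_sequence (cball 0 1) e" and "e 0 = 1"
  shows "(\<forall>f :: complex \<Rightarrow> real. Ck_near 4 (cball 0 1) f \<longrightarrow>
            uniform_limit (cball 0 1) (\<lambda>d. kergin d e f) f sequentially) \<and>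
         (\<forall>f :: complex \<Rightarrow> real. Cinf_near (cball 0 1) f \<longrightarrow>
            (\<forall>\<beta> :: nat \<times> nat.
               uniform_limit (cball 0 1) (\<lambda>d. multi_deriv \<beta> (kergin d e f)) (multi_deriv \<beta> f)
                 sequentially))"
proof (intro conjI allI impI)
  fix f :: "complex \<Rightarrow> real" assume "Ck_near 4 (cball 0 1) f"
  then show "uniform_limit (cball 0 1) (\<lambda>d. kergin d e f) f sequentially"
    \<comment> \<open>For \<open>m = n = 0\<close> the required smoothness is
      \<open>1 + 3 = 4\<close>.\<close>
    using kergin_leja_convergence[OF assms, of 0 0 f] by (simp add: multi_deriv_def)
next
  fix f :: "complex \<Rightarrow> real" and \<beta> :: "nat \<times> nat" assume "Cinf_near (cball 0 1) f"
  \<comment> \<open>Each multi-index uses only a finite order of smoothness depending on it.\<close>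
  then have "Ck_near k (cball 0 1) f" for k unfolding Cinf_near_def Ck_near_def by blast
  then show "uniform_limit (cball 0 1) (\<lambda>d. multi_deriv \<beta> (kergin d e f)) (multi_deriv \<beta> f) sequentially"
    using kergin_leja_convergence[OF assms, of "fst \<beta>" "snd \<beta>" f] by simp
qed

end
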